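(* Let $\mu\in\mathbb R$, $\sigma\ge 0$, let $\varphi\in\mathcal D$ and let $U:\mathbb R\to\mathbb R$ be increasing. Suppose that (A1) $\varphi$ is absolutely continuous with $\varphi'\in L^\infty(0,1)$; (A2) $U$ is locally Lipschitz; (A3) there exist $a,b\ge 0$ with $\sup_{\zeta\in\partial U(x)}|\zeta|\le a+b|x|$ for all $x\in\mathbb R$. Let $q^*\in\mathsf M\cap\mathsf K$ and suppose LICQ holds at $q^*$, i.e. the functions $1$ and $2q^*$ are linearly independent in $L^2(0,1)$ (equivalently, $\sigma^2>0$). If $q^*$ is a local minimizer of $\Psi$ over $\mathsf M\cap\mathsf K$ (with respect to the $L^2(0,1)$ norm), then the following hold, all subgradients and normal-cone elements being understood as elements of $L^2(0,1)$. (a) There exist $(\lambda_1,\lambda_2)\in\mathbb R^2$ and $z^*\in N_{\mathsf K}(q^* )$ such that $$0\in\partial\Psi(q^* )+\lambda_1+2\lambda_2 q^*+z^*,$$ where $z^*\in N_{\mathsf K}(q^* )$ is characterized by: $z^*\in L^2(0,1)$, $\mathcal Jz^*(t)\ge 0$ for all $t\in[0,1]$, $\mathcal Jz^*(1)=0$, and $\int_0^1\mathcal Jz^*(t)\,\mathrm dq^*(t)=0$. (b) Moreover, there exist a measurable selector $\xi(\cdot)\in\partial U(q^*(\cdot))$ and $z^*\in N_{\mathsf K}(q^* )$ with $$0=\varphi'\,\xi+\lambda_1+2\lambda_2\,q^*+z^*\quad\text{in }L^2(0,1).$$ (c) On any open interval $I\subseteq(0,1)$ on which $q^*$ is (a.e.)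 strictly increasing, the conclusion of (b) reduces to the pointwise condition $$-\lambda_1-2\lambda_2\,q^*(u)\in\varphi'(u)\,\partial U(q^*(u))\quad\text{for a.e. }u\in I.$$
   Context: $L^2(0,1)$ is the real Hilbert space with $\langle q_1,q_2\rangle=\int_0^1q_1q_2\,\mathrm du$. $\mathcal D$ is the set of nondecreasing right-continuous $\varphi:[0,1]\to[0,1]$ with $\varphi(0)=0$, $\varphi(1)=1$. "Increasing" means nondecreasing. The functional is $\Psi(q):=\int_0^1U(q(u))\,\mathrm d\varphi(u)$; under (A1) this is $\int_0^1U(q(u))\varphi'(u)\,\mathrm du$ for $q\in L^2(0,1)$. Monotone cone: $\mathsf K:=\{q\in L^2(0,1): q\text{ has an a.e. nondecreasing representative on }(0,1)\}$; this representative defines the nonnegative Stieltjes measure $\mathrm dq$. Moment set: $\mathsf M:=\{q\in L^2(0,1):\langle 1,q\rangle=\mu,\ \langle q,q\rangle=\mu^2+\sigma^2\}$. Normal cone at $q\in\mathsf K$: $N_{\mathsf K}(q):=\{z\in L^2(0,1):\langle z,h-q\rangle\le 0\ \forall h\in\mathsf K\}$. Primitive: $\mathcal Jz(t):=\int_0^tz(s)\,\mathrm ds$. Clarke subdifferential: for a locally Lipschitz $f:\mathcal X\to\mathbb R$ on a real Banach space, $f^\circ(x;h):=\limsup_{y\to x,\,t\to0^+}\frac{f(y+th)-f(y)}{t}$ and $\partial f(x):=\{v\in\mathcal X^*:\langle v,h\rangle\le f^\circ(x;h)\ \forall h\in\mathcal X\}$; for $\mathcal X=L^2(0,1)$ the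 dual is identified with $\mathcal X$ by Riesz. A real constant is also regarded as a constant function in $L^2(0,1)$. *)

theory Defs
  imports "HOL-Analysis.Analysis"
begin

section \<open>The Hilbert space $L^2(0,1)$\<close>

abbreviation I01 :: "real measure" where
  "I01 \<equiv> restrict_space lborel {0<..<1}"

definition square_integrable :: "(real \<Rightarrow> real) \<Rightarrow> bool" where
  "square_integrable f \<longleftrightarrow> f \<in> borel_measurable I01 \<and> integrable I01 (\<lambda>u. (f u)\<^sup>2)"

definition L2_rel :: "(real \<Rightarrow> real) \<Rightarrow> (real \<Rightarrow> real) \<Rightarrow> bool" where
  "L2_rel f g \<longleftrightarrow> square_integrable f \<and> square_integrable g \<and> (AE u in I01. f u = g u)"

lemma finite_measure_I01: "finite_measure I01"
  by (rule finite_measureI) (simp add: emeasure_restrict_space)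

lemma measure_I01: "measure I01 (space I01) = 1"
  by (simp add: measure_restrict_space)

lemma square_integrable_const: "square_integrable (\<lambda>_. c)"
  unfolding square_integrable_def
  using finite_measure.integrable_const[OF finite_measure_I01] by auto

lemma square_integrable_scale:
  "square_integrable f \<Longrightarrow> square_integrable (\<lambda>u. c * f u)"
  unfolding square_integrable_def by (auto simp: power_mult_distrib)

lemma square_integrable_mult:
  assumes "square_integrable f" "square_integrable g"
  shows "integrable I01 (\<lambda>u. f u * g u)"
proof (rule Bochner_Integration.integrable_bound)
  show "integrable I01 (\<lambda>u. (f u)\<^sup>2 + (g u)\<^sup>2)"
    using assms by (auto simp: square_integrable_def)
  show "(\<lambda>u. f u * g u) \<in> borel_measurable I01"
    using assms by (auto simp: square_integrable_def)
  have "\<bar>f u * g u\<bar> \<le> (f u)\<^sup>2 + (g u)\<^sup>2" for u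
  proof -
    have "0 \<le> (\<bar>f u\<bar> - \<bar>g u\<bar>)\<^sup>2" by simp
    then have "2 * (\<bar>f u\<bar> * \<bar>g u\<bar>) \<le> (f u)\<^sup>2 + (g u)\<^sup>2"
      by (simp add: power2_diff)
    moreover have "0 \<le> \<bar>f u\<bar> * \<bar>g u\<bar>" by simp
    ultimately show ?thesis unfolding abs_mult by linarith
  qed
  then show "AE u in I01. norm (f u * g u) \<le> norm ((f u)\<^sup>2 + (g u)\<^sup>2)"
    by (auto intro!: AE_I2)
qed

lemma square_integrable_add:
  assumes "square_integrable f" "square_integrable g"
  shows "square_integrable (\<lambda>u. f u + g u)"
proof -
  have "integrable I01 (\<lambda>u. (f u)\<^sup>2 + (g u)\<^sup>2 + 2 * (f u * g u))"
    using assms square_integrable_mult[OF assms] by (auto simp: square_integrable_def)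
  then show ?thesis
    using assms by (auto simp: square_integrable_def power2_sum mult.assoc)
qed

lemma square_integrable_diff:
  assumes "square_integrable f" "square_integrable g"
  shows "square_integrable (\<lambda>u. f u - g u)"
  using square_integrable_add[OF assms(1) square_integrable_scale[OF assms(2), of "-1"]]
  by simp

quotient_type L2 = "real \<Rightarrow> real" / partial: L2_rel
proof (rule part_equivpI)
  show "\<exists>f. L2_rel f f"
    using square_integrable_const[of 0] by (auto simp: L2_rel_def)
  show "symp L2_rel"
    by (rule sympI) (auto simp: L2_rel_def elim: AE_mp)
  show "transp L2_rel"
    by (rule transpI) (auto simp: L2_rel_def)
qed

lift_definition L2_const :: "real \<Rightarrow> L2" is "\<lambda>c _. c"
  by (simp add: L2_rel_def square_integrable_const)

instantiation L2 :: real_vector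
begin

lift_definition zero_L2 :: L2 is "\<lambda>_. 0"
  by (simp add: L2_rel_def square_integrable_const)

lift_definition plus_L2 :: "L2 \<Rightarrow> L2 \<Rightarrow> L2" is "\<lambda>f g u. f u + g u"
  by (auto simp: L2_rel_def intro: square_integrable_add)

lift_definition minus_L2 :: "L2 \<Rightarrow> L2 \<Rightarrow> L2" is "\<lambda>f g u. f u - g u"
  by (auto simp: L2_rel_def intro: square_integrable_diff)

lift_definition uminus_L2 :: "L2 \<Rightarrow> L2" is "\<lambda>f u. - f u"
  using square_integrable_scale[of _ "-1"] by (auto simp: L2_rel_def)

lift_definition scaleR_L2 :: "real \<Rightarrow> L2 \<Rightarrow> L2" is "\<lambda>c f u. c * f u"
  by (auto simp: L2_rel_def intro: square_integrable_scale)

instance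
proof
  fix x y z :: L2 and a b :: real
  show "x + y + z = x + (y + z)"
    by transfer (auto simp: L2_rel_def algebra_simps intro!: square_integrable_add)
  show "x + y = y + x"
    by transfer (auto simp: L2_rel_def algebra_simps intro!: square_integrable_add)
  show "0 + x = x"
    by transfer (auto simp: L2_rel_def)
  show "- x + x = 0"
    by transfer (auto simp: L2_rel_def square_integrable_const)
  show "x - y = x + - y"
    by transfer (auto simp: L2_rel_def intro!: square_integrable_diff)
  show "a *\<^sub>R (x + y) = a *\<^sub>R x + a *\<^sub>R y"
    by transfer (auto simp: L2_rel_def distrib_left
        intro!: square_integrable_add square_integrable_scale)
  show "(a + b) *\<^sub>R x = a *\<^sub>R x + b *\<^sub>R x"
    by transfer (auto simp: L2_rel_def distrib_right
        intro!: square_integrable_add square_integrable_scale)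
  show "a *\<^sub>R b *\<^sub>R x = (a * b) *\<^sub>R x"
    by transfer (auto simp: L2_rel_def mult.assoc intro!: square_integrable_scale)
  show "1 *\<^sub>R x = x"
    by transfer (auto simp: L2_rel_def)
qed

end

instantiation L2 :: real_inner
begin

lift_definition inner_L2 :: "L2 \<Rightarrow> L2 \<Rightarrow> real" is "\<lambda>f g. \<integral>u. f u * g u \<partial>I01"
proof -
  fix f f' g g' assume "L2_rel f f'" "L2_rel g g'"
  then show "(\<integral>u. f u * g u \<partial>I01) = (\<integral>u. f' u * g' u \<partial>I01)"
    by (intro integral_cong_AE) (auto simp: L2_rel_def square_integrable_def)
qed

definition norm_L2 :: "L2 \<Rightarrow> real" where "norm_L2 x = sqrt (inner x x)"
definition sgn_L2 :: "L2 \<Rightarrow> L2" where "sgn_L2 x = x /\<^sub>R norm x"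
definition dist_L2 :: "L2 \<Rightarrow> L2 \<Rightarrow> real" where "dist_L2 x y = norm (x - y)"
definition uniformity_L2 :: "(L2 \<times> L2) filter" where
  "uniformity_L2 = (INF e\<in>{0<..}. principal {(x, y). dist x y < e})"
definition open_L2 :: "L2 set \<Rightarrow> bool" where
  "open_L2 S \<longleftrightarrow> (\<forall>x\<in>S. \<forall>\<^sub>F (x', y) in uniformity. x' = x \<longrightarrow> y \<in> S)"

instance
proof
  fix x y z :: L2 and r :: real and S :: "L2 set"
  show "inner x y = inner y x"
    by transfer (simp add: mult.commute)
  show "inner (x + y) z = inner x z + inner y z"
    by transfer (simp add: L2_rel_def distrib_right square_integrable_mult)
  show "inner (r *\<^sub>R x) y = r * inner x y"
    by transfer (simp add: L2_rel_def mult.assoc)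
  show "0 \<le> inner x x"
    by transfer (simp add: Bochner_Integration.integral_nonneg)
  show "inner x x = 0 \<longleftrightarrow> x = 0"
  proof transfer
    fix f assume "L2_rel f f"
    then have f: "square_integrable f" "integrable I01 (\<lambda>u. f u * f u)"
      by (auto simp: L2_rel_def square_integrable_mult)
    have "(\<integral>u. f u * f u \<partial>I01) = 0 \<longleftrightarrow> (AE u in I01. f u * f u = 0)"
      by (rule integral_nonneg_eq_0_iff_AE[OF f(2)]) simp
    also have "\<dots> \<longleftrightarrow> L2_rel f (\<lambda>_. 0)"
      using f(1) square_integrable_const[of 0] by (simp add: L2_rel_def)
    finally show "(\<integral>u. f u * f u \<partial>I01) = 0 \<longleftrightarrow> L2_rel f (\<lambda>_. 0)" .
  qed
  show "norm x = sqrt (inner x x)" by (rule norm_L2_def)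
  show "sgn x = x /\<^sub>R norm x" by (rule sgn_L2_def)
  show "dist x y = norm (x - y)" by (rule dist_L2_def)
  show "uniformity = (INF e\<in>{0<..}. principal {(x :: L2, y). dist x y < e})"
    by (rule uniformity_L2_def)
  show "open S \<longleftrightarrow> (\<forall>x\<in>S. \<forall>\<^sub>F (x', y) in uniformity. x' = x \<longrightarrow> y \<in> S)"
    by (rule open_L2_def)
qed

end

lemma L2_rel_rep: "L2_rel (rep_L2 x) (rep_L2 x)"
  using Quotient3_rel_rep[OF Quotient3_L2, of x x] by simp

lemma square_integrable_rep [simp]: "square_integrable (rep_L2 x)"
  using L2_rel_rep[of x] by (simp add: L2_rel_def)

lemma rep_L2_measurable [measurable]: "rep_L2 x \<in> borel_measurable I01"
  using square_integrable_rep[of x] by (simp add: square_integrable_def)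

lemma rep_abs_L2: "square_integrable f \<Longrightarrow> AE u in I01. rep_L2 (abs_L2 f) u = f u"
  using rep_abs_rsp_left[OF Quotient3_L2, of f f] by (simp add: L2_rel_def)

lemma inner_L2_eq: "inner x y = (\<integral>u. rep_L2 x u * rep_L2 y u \<partial>I01)"
  by (simp add: inner_L2_def)

lemma rep_diff_L2: "AE u in I01. rep_L2 (x - y) u = rep_L2 x u - rep_L2 y u"
  unfolding minus_L2_def map_fun_def comp_def
  by (intro rep_abs_L2 square_integrable_diff square_integrable_rep)

lemma norm_diff_L2: "(norm (x - y))\<^sup>2 = (\<integral>u. (rep_L2 x u - rep_L2 y u)\<^sup>2 \<partial>I01)"
proof -
  have "(norm (x - y))\<^sup>2 = (\<integral>u. (rep_L2 (x - y) u)\<^sup>2 \<partial>I01)"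
    unfolding power2_norm_eq_inner inner_L2_eq by (simp add: power2_eq_square)
  also have "\<dots> = (\<integral>u. (rep_L2 x u - rep_L2 y u)\<^sup>2 \<partial>I01)"
    using rep_diff_L2[of x y] by (intro integral_cong_AE) auto
  finally show ?thesis .
qed

lemma nn_integral_diff_L2:
  "(\<integral>\<^sup>+u. ennreal ((rep_L2 x u - rep_L2 y u)\<^sup>2) \<partial>I01) = ennreal ((norm (x - y))\<^sup>2)"
  unfolding norm_diff_L2
  using square_integrable_diff[OF square_integrable_rep[of x] square_integrable_rep[of y]]
  by (intro nn_integral_eq_integral) (auto simp: square_integrable_def)

lemma nn_integral_L1_diff_L2:
  assumes "norm (x - y) \<le> c" "0 < c"
  shows "(\<integral>\<^sup>+u. ennreal \<bar>rep_L2 x u - rep_L2 y u\<bar> \<partial>I01) \<le> ennreal c"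
proof -
  let ?d = "\<lambda>u. rep_L2 x u - rep_L2 y u"
  have "\<bar>d\<bar> \<le> c / 2 + d\<^sup>2 * (1 / (2 * c))" for d :: real
  proof -
    have "0 \<le> (\<bar>d\<bar> - c)\<^sup>2" by simp
    then have "2 * c * \<bar>d\<bar> \<le> c\<^sup>2 + d\<^sup>2"
      by (simp add: power2_diff algebra_simps)
    then show ?thesis
      using assms(2) by (simp add: field_simps power2_eq_square)
  qed
  then have "(\<integral>\<^sup>+u. ennreal \<bar>?d u\<bar> \<partial>I01)
      \<le> (\<integral>\<^sup>+u. ennreal (c / 2) + ennreal ((?d u)\<^sup>2) * ennreal (1 / (2 * c)) \<partial>I01)"
    using assms(2)
    by (intro nn_integral_mono)
      (simp add: ennreal_mult[symmetric] ennreal_plus[symmetric] del: ennreal_plus)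
  also have "\<dots> = ennreal (c / 2) + ennreal ((norm (x - y))\<^sup>2) * ennreal (1 / (2 * c))"
    by (simp add: nn_integral_add nn_integral_multc nn_integral_diff_L2 emeasure_restrict_space)
  also have "\<dots> = ennreal (c / 2 + (norm (x - y))\<^sup>2 * (1 / (2 * c)))"
    using assms(2) by (simp add: ennreal_mult[symmetric] ennreal_plus[symmetric] del: ennreal_plus)
  also have "\<dots> \<le> ennreal c"
  proof (rule ennreal_leI)
    have "(norm (x - y))\<^sup>2 \<le> c\<^sup>2"
      using assms by (intro power_mono) auto
    then show "c / 2 + (norm (x - y))\<^sup>2 * (1 / (2 * c)) \<le> c"
      using assms(2) by (simp add: field_simps power2_eq_square)
  qed
  finally show ?thesis .
qed

instance L2 :: banach
proof
  fix X :: "nat \<Rightarrow> L2" assume X: "Cauchy X"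
  have "\<exists>N. \<forall>m\<ge>N. \<forall>n\<ge>N. norm (X m - X n) < (1/2)^k" for k
    using CauchyD[OF X, of "(1/2)^k"] by simp
  then obtain N where N: "\<And>k m n. N k \<le> m \<Longrightarrow> N k \<le> n \<Longrightarrow> norm (X m - X n) < (1/2)^k"
    by metis
  define r where "r k = (\<Sum>i\<le>k. N i)" for k
  have r_ge: "N k \<le> r k" and r_Suc: "r k \<le> r (Suc k)" for k
    unfolding r_def by (auto intro: member_le_sum)
  define f where "f k = rep_L2 (X (r k))" for k
  have f_meas [measurable]: "f k \<in> borel_measurable I01" for k
    by (simp add: f_def)
  have "(\<integral>\<^sup>+u. (\<Sum>k. ennreal \<bar>f (Suc k) u - f k u\<bar>) \<partial>I01)
      = (\<Sum>k. \<integral>\<^sup>+u. ennreal \<bar>f (Suc k) u - f k u\<bar> \<partial>I01)"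
    by (intro nn_integral_suminf) auto
  also have "\<dots> \<le> (\<Sum>k. ennreal ((1/2)^k))"
  proof (intro suminf_le)
    fix k
    have "norm (X (r (Suc k)) - X (r k)) < (1/2)^k"
      using r_ge[of k] r_Suc[of k] by (intro N) auto
    then show "(\<integral>\<^sup>+u. ennreal \<bar>f (Suc k) u - f k u\<bar> \<partial>I01) \<le> ennreal ((1/2)^k)"
      unfolding f_def by (intro nn_integral_L1_diff_L2) auto
  qed auto
  also have "\<dots> = ennreal 2"
    using suminf_geometric[of "1/2 :: real"]
    by (subst suminf_ennreal2) (auto intro: summable_geometric)
  finally have fin: "(\<integral>\<^sup>+u. (\<Sum>k. ennreal \<bar>f (Suc k) u - f k u\<bar>) \<partial>I01) \<noteq> \<infinity>"
    by (auto simp: top_unique)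
  have "AE u in I01. (\<Sum>k. ennreal \<bar>f (Suc k) u - f k u\<bar>) \<noteq> \<infinity>"
    by (rule nn_integral_PInf_AE[OF _ fin]) measurable
  then have conv: "AE u in I01. convergent (\<lambda>k. f k u)"
  proof (rule AE_mp, intro AE_I2 impI)
    fix u assume "(\<Sum>k. ennreal \<bar>f (Suc k) u - f k u\<bar>) \<noteq> \<infinity>"
    then have "summable (\<lambda>k. \<bar>f (Suc k) u - f k u\<bar>)"
      by (intro summable_suminf_not_top) auto
    then have "summable (\<lambda>k. f (Suc k) u - f k u)"
      by (rule summable_rabs_cancel)
    then have "convergent (\<lambda>n. (\<Sum>k<n. f (Suc k) u - f k u) + f 0 u)"
      by (intro convergent_add convergent_const) (simp add: summable_iff_convergent)
    then show "convergent (\<lambda>k. f k u)"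
      by (simp only: sum_lessThan_telescope[of "\<lambda>k. f k u"] diff_add_cancel)
  qed
  define F where "F u = lim (\<lambda>k. f k u)" for u
  have F_meas [measurable]: "F \<in> borel_measurable I01"
    unfolding F_def by measurable
  have lim: "AE u in I01. (\<lambda>k. f k u) \<longlonglongrightarrow> F u"
    using conv by (rule AE_mp) (auto intro!: AE_I2 simp: F_def convergent_LIMSEQ_iff)
  have fatou: "(\<integral>\<^sup>+u. ennreal ((F u - rep_L2 (X n) u)\<^sup>2) \<partial>I01) \<le> ennreal (((1/2)^k)\<^sup>2)"
    if n: "N k \<le> n" for n k
  proof -
    have "(\<integral>\<^sup>+u. ennreal ((F u - rep_L2 (X n) u)\<^sup>2) \<partial>I01)
        = (\<integral>\<^sup>+u. liminf (\<lambda>m. ennreal ((f m u - rep_L2 (X n) u)\<^sup>2)) \<partial>I01)"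
    proof (intro nn_integral_cong_AE, use lim in \<open>rule AE_mp\<close>, intro AE_I2 impI)
      fix u assume "(\<lambda>k. f k u) \<longlonglongrightarrow> F u"
      then have "(\<lambda>m. ennreal ((f m u - rep_L2 (X n) u)\<^sup>2))
          \<longlonglongrightarrow> ennreal ((F u - rep_L2 (X n) u)\<^sup>2)"
        by (intro tendsto_ennrealI tendsto_intros)
      then show "ennreal ((F u - rep_L2 (X n) u)\<^sup>2)
          = liminf (\<lambda>m. ennreal ((f m u - rep_L2 (X n) u)\<^sup>2))"
        by (rule lim_imp_Liminf[OF sequentially_bot, symmetric])
    qed
    also have "\<dots> \<le> liminf (\<lambda>m. \<integral>\<^sup>+u. ennreal ((f m u - rep_L2 (X n) u)\<^sup>2) \<partial>I01)"
      by (intro nn_integral_liminf) auto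
    also have "\<dots> \<le> limsup (\<lambda>m. \<integral>\<^sup>+u. ennreal ((f m u - rep_L2 (X n) u)\<^sup>2) \<partial>I01)"
      by (intro Liminf_le_Limsup) auto
    also have "\<dots> \<le> ennreal (((1/2)^k)\<^sup>2)"
    proof (rule Limsup_bounded, rule eventually_sequentiallyI[of k])
      fix m assume "k \<le> m"
      then have "N k \<le> r m"
        using r_ge[of k] lift_Suc_mono_le[of r k m] r_Suc by (meson le_trans)
      then have "norm (X (r m) - X n) < (1/2)^k"
        using n by (rule N)
      then show "(\<integral>\<^sup>+u. ennreal ((f m u - rep_L2 (X n) u)\<^sup>2) \<partial>I01) \<le> ennreal (((1/2)^k)\<^sup>2)"
        unfolding f_def nn_integral_diff_L2 by (intro ennreal_leI power_mono) auto
    qed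
    finally show ?thesis .
  qed
  have sq: "square_integrable (\<lambda>u. F u - rep_L2 (X n) u)" if "N k \<le> n" for n k
    using fatou[OF that] unfolding square_integrable_def
    by (auto intro!: integrableI_bounded elim!: order.strict_trans1)
  have "square_integrable F"
    using square_integrable_add[OF sq[of 0 "N 0"] square_integrable_rep[of "X (N 0)"]] by simp
  then have rep: "AE u in I01. rep_L2 (abs_L2 F) u = F u"
    by (rule rep_abs_L2)
  have le: "norm (X n - abs_L2 F) \<le> (1/2)^k" if "N k \<le> n" for n k
  proof -
    have "ennreal ((norm (abs_L2 F - X n))\<^sup>2) = (\<integral>\<^sup>+u. ennreal ((F u - rep_L2 (X n) u)\<^sup>2) \<partial>I01)"
      unfolding nn_integral_diff_L2[symmetric] using rep by (intro nn_integral_cong_AE) auto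
    also have "\<dots> \<le> ennreal (((1/2)^k)\<^sup>2)"
      using that by (rule fatou)
    finally have "(norm (abs_L2 F - X n))\<^sup>2 \<le> ((1/2)^k)\<^sup>2"
      by (simp add: ennreal_le_iff del: power_divide)
    then have "norm (abs_L2 F - X n) \<le> (1/2)^k"
      by (rule power2_le_imp_le) simp
    then show ?thesis
      by (simp only: norm_minus_commute)
  qed
  have "X \<longlonglongrightarrow> abs_L2 F"
  proof (rule LIMSEQ_I)
    fix e :: real assume "0 < e"
    then obtain k where "(1/2)^k < e"
      using real_arch_pow_inv[of e "1/2"] by auto
    then show "\<exists>no. \<forall>n\<ge>no. norm (X n - abs_L2 F) < e"
      using le by (intro exI[of _ "N k"]) (auto intro: le_less_trans)
  qed
  then show "convergent X"
    by (rule convergentI)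
qed

section \<open>Stieltjes measures on the open unit interval\<close>

text \<open>
  The function \<^term>\<open>f\<close> need only be monotone on \<open>(0,1)\<close>: it may be unbounded at both
  ends, so that the measure may be infinite, and it need not be right-continuous, since the
  mass of \<open>(a,b]\<close> is \<open>f(b+) - f(a+)\<close>.
\<close>

definition right_limit :: "(real \<Rightarrow> real) \<Rightarrow> real \<Rightarrow> real" where
  "right_limit f x = Lim (at_right x) f"

definition stieltjes :: "(real \<Rightarrow> real) \<Rightarrow> real measure" where
  "stieltjes f = extend_measure {0<..<1} {(a, b). 0 < a \<and> a \<le> b \<and> b < 1}
     (\<lambda>(a, b). {a<..b}) (\<lambda>(a, b). ennreal (right_limit f b - right_limit f a))"

lemma tendsto_right_Inf:
  fixes f :: "real \<Rightarrow> real"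
  assumes "mono_on {0<..<1} f" "0 < x" "x < 1"
  shows "(f \<longlongrightarrow> (INF y\<in>{x<..<1}. f y)) (at_right x)"
proof -
  have bdd: "bdd_below (f ` {x<..<1})"
    using assms by (intro bdd_belowI[of _ "f x"]) (auto elim!: mono_onD)
  show ?thesis
  proof (rule order_tendstoI)
    fix c assume c: "c < (INF y\<in>{x<..<1}. f y)"
    have "c < f y" if "y \<in> {x<..<1}" for y
      using c cINF_lower[OF bdd that] by linarith
    then show "\<forall>\<^sub>F y in at_right x. c < f y"
      using assms(3) by (intro eventually_at_rightI[of x 1]) auto
  next
    fix c assume "(INF y\<in>{x<..<1}. f y) < c"
    then obtain y where y: "x < y" "y < 1" "f y < c"
      using bdd assms(3) by (subst (asm) cINF_less_iff) auto
    have "f z < c" if "z \<in> {x<..<y}" for z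
      using mono_onD[OF assms(1), of z y] that y assms(2) by auto
    then show "\<forall>\<^sub>F z in at_right x. f z < c"
      using y(1) by (intro eventually_at_rightI[of x y]) auto
  qed
qed

lemma right_limit_eq_Inf:
  assumes "mono_on {0<..<1} f" "0 < x" "x < 1"
  shows "right_limit f x = (INF y\<in>{x<..<1}. f y)"
  unfolding right_limit_def
  by (rule tendsto_Lim[OF _ tendsto_right_Inf[OF assms]]) simp

lemma space_stieltjes [simp]: "space (stieltjes f) = {0<..<1}"
  unfolding stieltjes_def by (rule space_extend_measure) auto

lemma sets_stieltjes [simp, measurable_cong]:
  "sets (stieltjes f) = sets (restrict_space borel {0<..<1})"
proof -
  let ?O = "{0<..<1::real}"
  let ?G = "(\<lambda>(a, b). {a<..b}) ` {(a, b). 0 < a \<and> a \<le> b \<and> b < (1::real)}"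
  let ?B = "range (\<lambda>(a, b). {a<..b::real})"
  have borel: "sets borel = sigma_sets UNIV ?B"
    by (simp add: borel_sigma_sets_Ioc)
  have "sets (stieltjes f) = sigma_sets ?O ?G"
    unfolding stieltjes_def by (rule sets_extend_measure) auto
  also have "\<dots> = sigma_sets ?O ((\<inter>) ?O ` ?B)"
  proof (rule sigma_sets_eqI)
    fix A assume "A \<in> ?G"
    then obtain a b where "A = {a<..b}" "0 < a" "a \<le> b" "b < 1" by auto
    then have "A = ?O \<inter> {a<..b}" by auto
    then show "A \<in> sigma_sets ?O ((\<inter>) ?O ` ?B)" by blast
  next
    fix A assume "A \<in> (\<inter>) ?O ` ?B"
    then obtain a b where A: "A = ?O \<inter> {a<..b}" by auto
    define l where "l n = max a (1 / real (n + 2))" for n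
    define h where "h n = min b (1 - 1 / real (n + 2))" for n
    have lim: "(\<lambda>n. 1 / real (n + 2)) \<longlonglongrightarrow> 0"
      using LIMSEQ_ignore_initial_segment[OF lim_inverse_n', of 2] by simp
    have "A = (\<Union>n. if l n \<le> h n then {l n<..h n} else {})"
    proof (intro equalityI subsetI)
      fix x assume x: "x \<in> A"
      then have "0 < min x (1 - x)" using A by auto
      then have "\<forall>\<^sub>F n in sequentially. 1 / real (n + 2) < min x (1 - x)"
        using lim by (rule order_tendstoD(2)[rotated])
      then obtain n where "1 / real (n + 2) < min x (1 - x)"
        by (auto simp: eventually_sequentially)
      then have "l n < x" "x \<le> h n"
        using x A by (auto simp: l_def h_def)
      then show "x \<in> (\<Union>n. if l n \<le> h n then {l n<..h n} else {})"
        by (intro UN_I[of n]) auto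
    next
      fix x assume "x \<in> (\<Union>n. if l n \<le> h n then {l n<..h n} else {})"
      then obtain n where n: "l n < x" "x \<le> h n" by (auto split: if_splits)
      have "0 < 1 / real (n + 2)" by simp
      then have "0 < x" "x < 1"
        using n unfolding l_def h_def by linarith+
      then show "x \<in> A"
        using n A by (auto simp: l_def h_def)
    qed
    also have "\<dots> \<in> sigma_sets ?O ?G"
    proof (rule sigma_sets.Union)
      fix n
      have "0 < 1 / real (n + 2)" by simp
      then have "0 < l n" "h n < 1" unfolding l_def h_def by linarith+
      then show "(if l n \<le> h n then {l n<..h n} else {}) \<in> sigma_sets ?O ?G"
        by (auto intro!: sigma_sets.Basic sigma_sets.Empty)
    qed
    finally show "A \<in> sigma_sets ?O ?G" .
  qed
  also have "\<dots> = (\<inter>) ?O ` sigma_sets UNIV ?B"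
    by (rule sigma_sets_Int[symmetric]) (simp_all add: borel[symmetric])
  also have "\<dots> = sets (restrict_space borel ?O)"
    by (simp add: sets_restrict_space borel[symmetric])
  finally show ?thesis .
qed

text \<open>
  The extension exists: it is the image of Lebesgue measure under the generalised inverse
  of \<^term>\<open>f\<close>.
\<close>

lemma emeasure_stieltjes_Ioc:
  assumes mono: "mono_on {0<..<1} f" and ab: "0 < a" "a \<le> b" "b < 1"
  shows "emeasure (stieltjes f) {a<..b} = ennreal (right_limit f b - right_limit f a)"
proof -
  let ?O = "{0<..<1::real}"
  define D where "D = {y. \<exists>x\<in>?O. \<exists>x'\<in>?O. f x < y \<and> y \<le> f x'}"
  define S where "S y = {x\<in>?O. y \<le> f x}" for y
  define G where "G y = Inf (S y)" for y
  have bdd: "bdd_below (S y)" for y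
    by (intro bdd_belowI[of _ 0]) (auto simp: S_def)
  have G_ge: "x \<le> G y" if "x \<in> ?O" "f x < y" "S y \<noteq> {}" for x y
    unfolding G_def
  proof (rule cInf_greatest[OF that(3)])
    fix z assume "z \<in> S y"
    then have "z \<in> ?O" "f x < f z" using that(2) by (auto simp: S_def)
    then show "x \<le> z"
      using mono_onD[OF mono, of z x] that(1) by force
  qed
  have G_le: "G y \<le> x" if "x \<in> ?O" "y \<le> f x" for x y
    unfolding G_def using that by (intro cInf_lower bdd) (auto simp: S_def)
  have G_O: "G y \<in> ?O" if "y \<in> D" for y
  proof -
    from that obtain x x' where x: "x \<in> ?O" "x' \<in> ?O" "f x < y" "y \<le> f x'"
      by (auto simp: D_def)
    then have "S y \<noteq> {}" by (auto simp: S_def)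
    then show ?thesis using G_ge[of x y] G_le[of x' y] x by auto
  qed
  have "is_interval D"
    unfolding is_interval_1
  proof (intro ballI allI impI)
    fix v w y assume "v \<in> D" "w \<in> D" "v \<le> y \<and> y \<le> w"
    then obtain x x' where "x \<in> ?O" "x' \<in> ?O" "f x < v" "w \<le> f x'" "v \<le> y" "y \<le> w"
      by (auto simp: D_def)
    then show "y \<in> D"
      unfolding D_def by (intro CollectI bexI[of _ x] bexI[of _ x']) auto
  qed
  then have D: "D \<in> sets borel" by (rule real_interval_borel_measurable)
  have "mono_on D G"
  proof (rule mono_onI)
    fix y y' assume "y \<in> D" "y' \<in> D" "y \<le> y'"
    then have "S y' \<noteq> {}" "S y' \<subseteq> S y" by (auto simp: D_def S_def)
    then show "G y \<le> G y'"
      unfolding G_def by (intro cInf_superset_mono bdd) auto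
  qed
  then have "G \<in> borel_measurable (restrict_space borel D)"
    by (rule borel_measurable_mono_on_fnc)
  then have "G \<in> restrict_space lborel D \<rightarrow>\<^sub>M restrict_space borel ?O"
    using G_O by (intro measurable_restrict_space2)
      (auto simp: space_restrict_space cong: measurable_cong_sets sets_restrict_space_cong)
  then have G_meas: "G \<in> restrict_space lborel D \<rightarrow>\<^sub>M stieltjes f"
    by (simp cong: measurable_cong_sets)
  define N where "N = distr (restrict_space lborel D) (stieltjes f) G"
  have N: "emeasure N {c<..d} = ennreal (right_limit f d - right_limit f c)"
    if cd: "0 < c" "c \<le> d" "d < 1" for c d
  proof -
    let ?A = "{y\<in>D. c < G y \<and> G y \<le> d}"
    let ?c = "right_limit f c" and ?d = "right_limit f d"
    have lim: "right_limit f x \<le> f y" if "0 < x" "x < y" "y < 1" for x y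
    proof -
      have "bdd_below (f ` {x<..<1})"
        using mono that(1) by (intro bdd_belowI[of _ "f x"]) (auto elim!: mono_onD)
      then show ?thesis
        using that right_limit_eq_Inf[OF mono, of x] by (auto intro: cINF_lower)
    qed
    have lim': "\<exists>x. c < x \<and> x < 1 \<and> f x < y" if "right_limit f c < y" "0 < c" "c < 1" for c y
    proof -
      have "bdd_below (f ` {c<..<1})"
        using mono that(2) by (intro bdd_belowI[of _ "f c"]) (auto elim!: mono_onD)
      then show ?thesis
        using that cINF_less_iff[of "{c<..<1}" f y]
        by (auto simp: right_limit_eq_Inf[OF mono that(2,3)])
    qed
    have "?c \<le> ?d"
    proof (rule ccontr)
      assume "\<not> ?c \<le> ?d"
      then obtain x where "d < x" "x < 1" "f x < ?c" using lim'[of d "?c"] cd by auto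
      then show False using lim[of c x] cd by auto
    qed
    have vim: "G -` {c<..d} \<inter> space (restrict_space lborel D) = ?A"
      by (auto simp: space_restrict_space)
    have "{c<..d} = ?O \<inter> {c<..d}" using cd by auto
    then have Ioc: "{c<..d} \<in> sets (stieltjes f)"
      by (auto simp: sets_restrict_space)
    then have "?A \<in> sets (restrict_space lborel D)"
      using measurable_sets[OF G_meas Ioc] vim by simp
    then have A: "?A \<in> sets lborel"
      using D by (simp add: sets_restrict_space_iff)
    have sub1: "{?c<..<?d} \<subseteq> ?A"
    proof
      fix y assume y: "y \<in> {?c<..<?d}"
      obtain x where x: "c < x" "x < 1" "f x < y" using lim'[of c y] cd y by auto
      have le: "y \<le> f z" if "d < z" "z < 1" for z
        using lim[of d z] that cd y by auto
      have mid: "d < (d + 1) / 2" "(d + 1) / 2 < 1" using cd by auto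
      have "S y \<noteq> {}" using le[OF mid] mid cd unfolding S_def
        by (intro ex_in_conv[THEN iffD1] exI[of _ "(d + 1) / 2"]) auto
      then have "x \<le> G y" using x cd by (intro G_ge) auto
      moreover have "G y \<le> d"
      proof (rule dense_ge_bounded[OF cd(3)])
        fix z assume "d < z" "z < 1"
        then show "G y \<le> z" using le cd by (intro G_le) auto
      qed
      moreover have "y \<in> D"
        unfolding D_def using x le[OF mid] mid cd
        by (intro CollectI bexI[of _ x] bexI[of _ "(d + 1) / 2"]) auto
      ultimately show "y \<in> ?A" using x by auto
    qed
    have sub2: "?A \<subseteq> {?c..?d}"
    proof
      fix y assume y: "y \<in> ?A"
      then have S: "S y \<noteq> {}" by (auto simp: D_def S_def)
      have "?c \<le> y"
      proof (rule ccontr)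
        assume "\<not> ?c \<le> y"
        have "G y \<le> c"
        proof (rule dense_ge_bounded[of c 1])
          fix z assume "c < z" "z < 1"
          then show "G y \<le> z"
            using lim[of c z] cd \<open>\<not> ?c \<le> y\<close> by (intro G_le) auto
        qed (use cd in auto)
        then show False using y by auto
      qed
      moreover have "y \<le> ?d"
      proof (rule ccontr)
        assume "\<not> y \<le> ?d"
        then obtain x where "d < x" "x < 1" "f x < y" using lim'[of d y] cd by auto
        then have "x \<le> G y" using cd S by (intro G_ge) auto
        then show False using y \<open>d < x\<close> by auto
      qed
      ultimately show "y \<in> {?c..?d}" by auto
    qed
    have "emeasure N {c<..d} = emeasure lborel ?A"
      unfolding N_def using G_meas Ioc vim D A
      by (simp add: emeasure_distr emeasure_restrict_space)
    also have "\<dots> = ennreal (?d - ?c)"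
    proof (rule antisym)
      have "emeasure lborel ?A \<le> emeasure lborel {?c..?d}"
        using sub2 by (intro emeasure_mono) auto
      then show "emeasure lborel ?A \<le> ennreal (?d - ?c)" using \<open>?c \<le> ?d\<close> by simp
      have "emeasure lborel {?c<..<?d} \<le> emeasure lborel ?A"
        using sub1 A by (intro emeasure_mono) auto
      then show "ennreal (?d - ?c) \<le> emeasure lborel ?A" using \<open>?c \<le> ?d\<close> by simp
    qed
    finally show ?thesis .
  qed
  have sets_N: "sets N = sets (stieltjes f)" by (simp add: N_def)
  have "emeasure (stieltjes f) ((\<lambda>(a, b). {a<..b}) (a, b))
      = (\<lambda>(a, b). ennreal (right_limit f b - right_limit f a)) (a, b)"
  proof (rule emeasure_extend_measure[OF stieltjes_def, where \<mu>' = "emeasure N"])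
    show "positive (sets (stieltjes f)) (emeasure N)"
      unfolding sets_N[symmetric] by (rule emeasure_positive)
    show "countably_additive (sets (stieltjes f)) (emeasure N)"
      unfolding sets_N[symmetric] by (rule emeasure_countably_additive)
  qed (use ab N in auto)
  then show ?thesis by simp
qed

section \<open>Clarke subdifferential\<close>

definition locally_lipschitz :: "('a::metric_space \<Rightarrow> 'b::metric_space) \<Rightarrow> bool" where
  "locally_lipschitz f \<longleftrightarrow> (\<forall>x. \<exists>u>0. \<exists>L. L-lipschitz_on (cball x u) f)"

definition clarke_dd :: "('a::banach \<Rightarrow> real) \<Rightarrow> 'a \<Rightarrow> 'a \<Rightarrow> ereal" where
  "clarke_dd f x h =
     Limsup (nhds x \<times>\<^sub>F at_right 0) (\<lambda>(y, t). ereal ((f (y + t *\<^sub>R h) - f y) / t))"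

definition clarke_subdifferential :: "('a::banach \<Rightarrow> real) \<Rightarrow> 'a \<Rightarrow> ('a \<Rightarrow>\<^sub>L real) set" where
  "clarke_subdifferential f x = {v. \<forall>h. ereal (blinfun_apply v h) \<le> clarke_dd f x h}"

text \<open>In a Hilbert space the dual is identified with the space itself by Riesz.\<close>

definition clarke_gradient :: "('a::{real_inner, banach} \<Rightarrow> real) \<Rightarrow> 'a \<Rightarrow> 'a set" where
  "clarke_gradient f x = {v. blinfun_inner_left v \<in> clarke_subdifferential f x}"

lemma mem_clarke_gradient_iff:
  "v \<in> clarke_gradient f x \<longleftrightarrow> (\<forall>h. ereal (inner v h) \<le> clarke_dd f x h)"
  by (simp add: clarke_gradient_def clarke_subdifferential_def inner_commute)

section \<open>The optimisation problem\<close>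

definition distortion_functions :: "(real \<Rightarrow> real) set" where
  "distortion_functions =
     {\<phi>. \<phi> ` {0..1} \<subseteq> {0..1} \<and> \<phi> 0 = 0 \<and> \<phi> 1 = 1 \<and> mono_on {0..1} \<phi> \<and>
         (\<forall>u\<in>{0..<1}. continuous (at_right u) \<phi>)}"

definition absolutely_continuous_01 :: "(real \<Rightarrow> real) \<Rightarrow> bool" where
  "absolutely_continuous_01 \<phi> \<longleftrightarrow>
     (\<forall>\<epsilon>>0. \<exists>\<delta>>0. \<forall>P. finite P \<and> (\<forall>(a, b)\<in>P. 0 \<le> a \<and> a \<le> b \<and> b \<le> 1) \<and>
        pairwise (\<lambda>(a, b) (c, d). {a<..<b} \<inter> {c<..<d} = {}) P \<and>
        (\<Sum>(a, b)\<in>P. b - a) < \<delta> \<longrightarrow> (\<Sum>(a, b)\<in>P. \<bar>\<phi> b - \<phi> a\<bar>) < \<epsilon>)"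

definition L_infinity :: "(real \<Rightarrow> real) set" where
  "L_infinity = {g. g \<in> borel_measurable I01 \<and> (\<exists>C. AE u in I01. \<bar>g u\<bar> \<le> C)}"

text \<open>
  The integral is over the open interval. This agrees with integration over \<open>[0,1]\<close>
  whenever \<^term>\<open>\<phi>\<close> is continuous at \<open>1\<close>. For absolutely continuous \<^term>\<open>\<phi>\<close> the measure
  \<^term>\<open>stieltjes \<phi>\<close> has a density, so the value does not depend on the representative.
\<close>

definition Psi :: "(real \<Rightarrow> real) \<Rightarrow> (real \<Rightarrow> real) \<Rightarrow> L2 \<Rightarrow> real" where
  "Psi \<phi> U q = (\<integral>u. U (rep_L2 q u) \<partial>stieltjes \<phi>)"

definition monotone_cone :: "L2 set" where
  "monotone_cone = {q. \<exists>f. mono_on {0<..<1} f \<and> (AE u in I01. rep_L2 q u = f u)}"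

text \<open>
  Any two monotone representatives have the same right limits, hence the same Stieltjes
  measure.
\<close>

definition mono_rep :: "L2 \<Rightarrow> real \<Rightarrow> real" where
  "mono_rep q = (SOME f. mono_on {0<..<1} f \<and> (AE u in I01. rep_L2 q u = f u))"

definition moment_set :: "real \<Rightarrow> real \<Rightarrow> L2 set" where
  "moment_set \<mu> \<sigma> = {q. inner (L2_const 1) q = \<mu> \<and> inner q q = \<mu>\<^sup>2 + \<sigma>\<^sup>2}"

definition normal_cone :: "'a::real_inner set \<Rightarrow> 'a \<Rightarrow> 'a set" where
  "normal_cone K q = {z. \<forall>h\<in>K. inner z (h - q) \<le> 0}"

definition primitive :: "L2 \<Rightarrow> real \<Rightarrow> real" where
  "primitive z t = (LINT s:{0<..<t}|lborel. rep_L2 z s)"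

definition local_minimizer_on :: "('a::metric_space \<Rightarrow> real) \<Rightarrow> 'a set \<Rightarrow> 'a \<Rightarrow> bool" where
  "local_minimizer_on f S x \<longleftrightarrow> x \<in> S \<and> (\<exists>e>0. \<forall>y\<in>S. dist y x < e \<longrightarrow> f x \<le> f y)"

text \<open>
  Linear independence is stated for the family \<open>1, 2 q\<close>: as a set, \<open>{1, 2 q}\<close> is
  independent even if both elements coincide.
\<close>

definition LICQ :: "L2 \<Rightarrow> bool" where
  "LICQ q \<longleftrightarrow> (\<forall>c d. c *\<^sub>R L2_const 1 + d *\<^sub>R (2 *\<^sub>R q) = 0 \<longrightarrow> c = 0 \<and> d = 0)"

lemma inner_L2_const_1: "inner (L2_const 1) (L2_const 1) = 1"
  by transfer (simp add: measure_restrict_space)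

lemma LICQ_iff:
  assumes "q \<in> moment_set \<mu> \<sigma>"
  shows "LICQ q \<longleftrightarrow> \<sigma>\<^sup>2 > 0"
proof
  assume L: "LICQ q"
  show "\<sigma>\<^sup>2 > 0"
  proof (rule ccontr)
    assume "\<not> \<sigma>\<^sup>2 > 0"
    then have "\<sigma> = 0" by simp
    then have "inner (\<mu> *\<^sub>R L2_const 1 - q) (\<mu> *\<^sub>R L2_const 1 - q) = 0"
      using assms inner_L2_const_1
      by (simp add: moment_set_def inner_diff_left inner_diff_right inner_commute[of q "L2_const 1"]
          power2_eq_square)
    then have "q = \<mu> *\<^sub>R L2_const 1"
      by simp
    then have "(2 * \<mu>) *\<^sub>R L2_const 1 + (-1) *\<^sub>R (2 *\<^sub>R q) = 0"
      by simp
    then show False using L unfolding LICQ_def by fastforce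
  qed
next
  assume \<sigma>: "\<sigma>\<^sup>2 > 0"
  show "LICQ q"
    unfolding LICQ_def
  proof (intro allI impI)
    fix c d assume eq: "c *\<^sub>R L2_const 1 + d *\<^sub>R (2 *\<^sub>R q) = 0"
    have "inner (L2_const 1) (c *\<^sub>R L2_const 1 + d *\<^sub>R (2 *\<^sub>R q)) = 0"
      "inner q (c *\<^sub>R L2_const 1 + d *\<^sub>R (2 *\<^sub>R q)) = 0"
      unfolding eq by simp_all
    then have 1: "c + 2 * d * \<mu> = 0" and 2: "c * \<mu> + 2 * d * (\<mu>\<^sup>2 + \<sigma>\<^sup>2) = 0"
      using assms inner_L2_const_1
      by (simp_all add: moment_set_def inner_add_right inner_commute[of q "L2_const 1"])
    have "2 * d * \<sigma>\<^sup>2 = (c * \<mu> + 2 * d * (\<mu>\<^sup>2 + \<sigma>\<^sup>2)) - \<mu> * (c + 2 * d * \<mu>)"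
      by (simp add: algebra_simps power2_eq_square)
    then have "d = 0" using \<sigma> 1 2 by simp
    then show "c = 0 \<and> d = 0" using 1 by simp
  qed
qed

definition selector_stationarity ::
    "(real \<Rightarrow> real) \<Rightarrow> (real \<Rightarrow> real) \<Rightarrow> L2 \<Rightarrow> real \<Rightarrow> real \<Rightarrow> bool" where
  "selector_stationarity \<phi> U q l1 l2 \<longleftrightarrow>
     (\<exists>\<xi> z. \<xi> \<in> borel_measurable I01 \<and>
        (AE u in I01. \<xi> u \<in> clarke_gradient U (rep_L2 q u)) \<and>
        z \<in> normal_cone monotone_cone q \<and>
        (AE u in I01. 0 = deriv \<phi> u * \<xi> u + l1 + 2 * l2 * rep_L2 q u + rep_L2 z u))"

definition strictly_increasing_on :: "real set \<Rightarrow> L2 \<Rightarrow> bool" where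
  "strictly_increasing_on I q \<longleftrightarrow>
     (\<exists>f. strict_mono_on I f \<and> (AE u in I01. u \<in> I \<longrightarrow> rep_L2 q u = f u))"

end

theory Submission
  imports Defs
begin

text \<open>
Write \<open>e\<close> for the constant function \<open>1\<close> and \<open>\<Psi>\<close> for the functional. The monotone cone is a
convex cone that contains \<open>e\<close>, \<open>- e\<close> and \<open>q\<close>, and the moment set is the sphere of radius \<open>\<sigma>\<close>
around \<open>\<mu> e\<close> in the hyperplane of functions with mean \<open>\<mu>\<close>, where \<open>\<sigma> > 0\<close> by LICQ. The multiplier
rule rests on this geometry.
For \<open>h\<close> in the cone let \<open>P h\<close> be its projection onto the orthogonal complement of \<open>e\<close> and \<open>q\<close>.
The point \<open>q + t P h\<close> differs by a multiple of \<open>e\<close> from a nonnegative combination of \<open>q\<close> and \<open>h\<close>,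
so it stays in the cone for small \<open>t > 0\<close>; it leaves the sphere only to second order in \<open>t\<close>, and
rescaling about \<open>\<mu> e\<close> brings it back. Local minimality and the Lipschitz property give
\<open>\<Psi>\<^sup>o(q; P h) \<ge> 0\<close>. Since \<open>\<Psi>\<^sup>o(q; \<cdot>)\<close> is sublinear and Lipschitz, a separation argument in
\<open>L\<^sup>2 \<times> \<real>\<close> by projection onto a closed convex cone yields
\<open>\<zeta> \<in> \<partial>\<Psi>(q)\<close> with \<open>\<langle>\<zeta>, P h\<rangle> \<ge> 0\<close> for all \<open>h\<close> in the cone. Then \<open>z = - P \<zeta>\<close> is normal to the
cone, and \<open>\<zeta> + z\<close> lies in the span of \<open>e\<close> and \<open>q\<close>; its coordinates give the multipliers
(\<open>multiplier_rule_on_convex_cone\<close>).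

The rest is analysis on the unit interval. An absolutely continuous \<open>\<phi>\<close> has a Stieltjes measure
with density \<open>\<phi>'\<close> (\<open>distortion_density\<close>), so \<open>\<Psi>\<close> is an integral against Lebesgue measure. The
growth condition turns into a Lipschitz estimate for \<open>U\<close> through a mean value inequality, and then
Cauchy-Schwarz makes \<open>\<Psi>\<close> locally Lipschitz.
Testing \<open>\<zeta> \<in> \<partial>\<Psi>(q)\<close> against indicator functions and their negatives, and passing to the limit in
the difference quotients by Fatou's lemma, confines \<open>\<zeta>\<close> pointwise to \<open>\<phi>' \<partial>U(q)\<close>
(\<open>clarke_gradient_Psi_selector\<close>). Parts (a) and (b) therefore hold with the same multipliers and
the same normal vector.

The description of the normal cone is integration by parts: if \<open>z\<close> has mean zero, then
\<open>\<langle>z, h\<rangle> = - \<integral> Jz dh\<close> for every \<open>h\<close> in the cone, also when \<open>h\<close> is unbounded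
(\<open>integral_primitive_stieltjes\<close>). On an interval where \<open>q\<close> increases strictly, \<open>dq\<close> charges every
subinterval; the continuous nonnegative function \<open>Jz\<close> has \<open>dq\<close>-integral zero and so vanishes
there, and with it its derivative \<open>z\<close>. This gives (c).
\<close>

section \<open>Separating a point from a convex cone in a Hilbert space\<close>

text \<open>
First-order optimality of a minimal norm: divide the expanded inequality
\<open>\<parallel>w\<parallel>\<^sup>2 \<le> \<parallel>w + t e\<parallel>\<^sup>2\<close> by \<open>2 t\<close> and let \<open>t\<close> tend to \<open>0\<close>.
\<close>

lemma inner_nonneg_of_norm_minimal:
  fixes w e :: "'a::real_inner"
  assumes "\<And>t. 0 < t \<Longrightarrow> t \<le> 1 \<Longrightarrow> norm w \<le> norm (w + t *\<^sub>R e)"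
  shows "0 \<le> inner w e"
proof -
  let ?F = "\<lambda>t. (2 * inner w e + t * (norm e)\<^sup>2) / 2"
  have "(?F \<longlongrightarrow> (2 * inner w e + 0 * (norm e)\<^sup>2) / 2) (at_right 0)"
    by (intro tendsto_intros) simp_all
  then have lim: "(?F \<longlongrightarrow> inner w e) (at_right 0)"
    by simp
  have "\<forall>\<^sub>F t in at_right 0. 0 \<le> ?F t"
  proof (rule eventually_at_rightI[of 0 1])
    fix t :: real assume t: "t \<in> {0<..<1}"
    then have "(norm w)\<^sup>2 \<le> (norm (w + t *\<^sub>R e))\<^sup>2"
      using assms[of t] by (intro power_mono) auto
    then have "0 \<le> t * (2 * inner w e + t * (norm e)\<^sup>2)"
      unfolding power2_norm_eq_inner
      by (simp add: inner_add_left inner_add_right inner_commute[of e w] algebra_simps)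
    then show "0 \<le> ?F t"
      using t by (simp add: zero_le_mult_iff)
  qed simp
  with lim show ?thesis
    by (rule tendsto_lowerbound) simp
qed

text \<open>
The normal vector is \<open>x0 - p\<close>, where \<open>x0\<close> is the point of the closure of \<open>E\<close> nearest to \<open>p\<close>.
A minimising sequence is Cauchy by the parallelogram law, so completeness does what
compactness does in finite dimension, and the separating functional comes out as a vector.
\<close>

lemma separate_point_from_convex_cone:
  fixes E :: "'a::{real_inner, banach} set"
  assumes zero: "0 \<in> E" and add: "\<And>x y. x \<in> E \<Longrightarrow> y \<in> E \<Longrightarrow> x + y \<in> E"
    and scale: "\<And>c x. 0 \<le> c \<Longrightarrow> x \<in> E \<Longrightarrow> c *\<^sub>R x \<in> E"
    and \<delta>: "0 < \<delta>" "\<And>x. x \<in> E \<Longrightarrow> \<delta> \<le> norm (x - p)"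
  obtains n where "\<And>x. x \<in> E \<Longrightarrow> 0 \<le> inner n x" "inner n p < 0"
proof -
  define D where "D = (INF x\<in>E. norm (x - p))"
  have bdd: "bdd_below ((\<lambda>x. norm (x - p)) ` E)"
    by (intro bdd_belowI[of _ 0]) auto
  have D_le: "D \<le> norm (x - p)" if "x \<in> E" for x
    unfolding D_def using bdd that by (rule cINF_lower)
  have "\<delta> \<le> D"
    unfolding D_def using zero \<delta>(2) by (intro cINF_greatest) auto
  then have "0 < D" using \<delta>(1) by simp
  have "\<exists>x\<in>E. norm (x - p) < D + 1 / real (Suc n)" for n
    using cINF_less_iff[OF _ bdd, of "D + 1 / real (Suc n)"] zero unfolding D_def by auto
  then obtain X where X: "\<And>n. X n \<in> E" "\<And>n. norm (X n - p) < D + 1 / real (Suc n)"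
    by metis
  \<comment> \<open>The parallelogram law, as the midpoint of X m and X n has distance at least D from p.
    The constant is 8 D + 4 e with e at most 1.\<close>
  have close: "(norm (X m - X n))\<^sup>2 \<le> (8 * D + 4) / real (Suc N)" if "N \<le> m" "N \<le> n" for m n N
  proof -
    define e where "e = 1 / real (Suc N)"
    have e: "0 < e" "e \<le> 1" by (auto simp: e_def)
    have near: "(norm (X k - p))\<^sup>2 \<le> (D + e)\<^sup>2" if "N \<le> k" for k
    proof (intro power_mono)
      have "1 / real (Suc k) \<le> e" unfolding e_def using that by (intro divide_left_mono) auto
      then show "norm (X k - p) \<le> D + e" using X(2)[of k] by linarith
    qed simp
    have "(1/2) *\<^sub>R (X m + X n) \<in> E" using X(1) by (intro scale add) auto
    then have mid: "D\<^sup>2 \<le> (norm ((1/2) *\<^sub>R (X m + X n) - p))\<^sup>2"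
      using D_le \<open>0 < D\<close> by (intro power_mono) auto
    have "(norm (X m - X n))\<^sup>2
        = 2 * (norm (X m - p))\<^sup>2 + 2 * (norm (X n - p))\<^sup>2 - 4 * (norm ((1/2) *\<^sub>R (X m + X n) - p))\<^sup>2"
      unfolding power2_norm_eq_inner
      by (simp add: inner_diff_left inner_diff_right inner_add_left inner_add_right inner_commute algebra_simps)
    also have "\<dots> \<le> 2 * (D + e)\<^sup>2 + 2 * (D + e)\<^sup>2 - 4 * D\<^sup>2"
      using near[OF that(1)] near[OF that(2)] mid by linarith
    also have "\<dots> = e * (8 * D + 4 * e)"
      by (simp add: power2_eq_square algebra_simps)
    also have "\<dots> \<le> e * (8 * D + 4)"
      using e by (intro mult_left_mono) auto
    finally show ?thesis by (simp add: e_def)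
  qed
  have "Cauchy X"
  proof (rule CauchyI)
    fix \<epsilon> :: real assume "0 < \<epsilon>"
    then have "0 < \<epsilon>\<^sup>2 / (8 * D + 4)" using \<open>0 < D\<close> by simp
    then obtain N where "1 / real (Suc N) < \<epsilon>\<^sup>2 / (8 * D + 4)"
      using reals_Archimedean by (auto simp: inverse_eq_divide)
    then have N: "(8 * D + 4) / real (Suc N) < \<epsilon>\<^sup>2"
      using \<open>0 < D\<close> by (simp add: field_simps)
    have "norm (X m - X n) < \<epsilon>" if "N \<le> m" "N \<le> n" for m n
      using close[OF that] N \<open>0 < \<epsilon>\<close> by (intro power2_less_imp_less[of _ \<epsilon>]) auto
    then show "\<exists>M. \<forall>m\<ge>M. \<forall>n\<ge>M. norm (X m - X n) < \<epsilon>" by blast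
  qed
  then obtain x0 where x0: "X \<longlonglongrightarrow> x0"
    using Cauchy_convergent convergent_def by blast
  define w where "w = x0 - p"
  have "(\<lambda>n. D + 1 / real (Suc n)) \<longlonglongrightarrow> D + 0"
    using LIMSEQ_Suc[OF lim_const_over_n[of "1::real"]] by (intro tendsto_intros) simp
  moreover have "(\<lambda>n. norm (X n - p)) \<longlonglongrightarrow> norm w"
    unfolding w_def using x0 by (intro tendsto_intros)
  ultimately have "norm w \<le> D"
    using X(2) by (intro LIMSEQ_le[of "\<lambda>n. norm (X n - p)" "norm w" "\<lambda>n. D + 1 / real (Suc n)" D]) (auto intro: less_imp_le)
  have minimal: "norm w \<le> norm (l - p)" if "Y \<longlonglongrightarrow> l" "\<And>n. Y n \<in> E" for Y l
  proof -
    have "D \<le> norm (l - p)"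
      using that by (intro LIMSEQ_le_const[of "\<lambda>n. norm (Y n - p)"] tendsto_intros) (auto intro: D_le)
    then show ?thesis using \<open>norm w \<le> D\<close> by simp
  qed
  have "0 \<le> inner w x" if "x \<in> E" for x
  proof (rule inner_nonneg_of_norm_minimal)
    fix t :: real assume "0 < t"
    then have "norm w \<le> norm (x0 + t *\<^sub>R x - p)"
      using x0 X(1) that
      by (intro minimal[of "\<lambda>n. X n + t *\<^sub>R x"] tendsto_intros add scale) auto
    then show "norm w \<le> norm (w + t *\<^sub>R x)" by (simp add: w_def algebra_simps)
  qed
  \<comment> \<open>The closure of the cone contains the segment from x0 towards the origin, so moving in direction - x0 is
    admissible for t at most 1.\<close>
  moreover have "0 \<le> inner w (- x0)"
  proof (rule inner_nonneg_of_norm_minimal)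
    fix t :: real assume "0 < t" "t \<le> 1"
    then have "norm w \<le> norm ((1 - t) *\<^sub>R x0 - p)"
      using x0 X(1) by (intro minimal[of "\<lambda>n. (1 - t) *\<^sub>R X n"] tendsto_intros scale) auto
    then show "norm w \<le> norm (w + t *\<^sub>R (- x0))" by (simp add: w_def algebra_simps)
  qed
  moreover have "D \<le> norm w"
    unfolding w_def using x0 X(1)
    by (intro LIMSEQ_le_const[of "\<lambda>n. norm (X n - p)"] tendsto_intros) (auto intro: D_le)
  then have "0 < inner w w" using \<open>0 < D\<close> by (auto simp: inner_gt_zero_iff)
  then have "inner w p < inner w x0" by (simp add: w_def inner_diff_right inner_diff_left algebra_simps)
  ultimately show ?thesis by (intro that[of w]) auto
qed

section \<open>The Clarke directional derivative\<close>

lemma clarke_dd_less_eventually: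
  assumes "clarke_dd f x h < ereal c"
  shows "\<forall>\<^sub>F (y, t) in nhds x \<times>\<^sub>F at_right 0. (f (y + t *\<^sub>R h) - f y) / t < c"
  using Limsup_lessD[OF assms[unfolded clarke_dd_def]] by (simp add: case_prod_unfold)

lemma clarke_dd_le:
  assumes "\<forall>\<^sub>F (y, t) in nhds x \<times>\<^sub>F at_right 0. (f (y + t *\<^sub>R h) - f y) / t \<le> c"
  shows "clarke_dd f x h \<le> ereal c"
  unfolding clarke_dd_def using assms by (intro Limsup_bounded) (simp add: case_prod_unfold)

text \<open>
Contrapositive form: a lower bound on the upper limit follows if no smaller number is an
eventual upper bound of the difference quotients.
\<close>

lemma clarke_dd_ge_frequently:
  fixes f :: "'a::banach \<Rightarrow> real"
  assumes "\<And>c'. c' < c \<Longrightarrow> \<not> (\<forall>\<^sub>F (y, t) in nhds x \<times>\<^sub>F at_right 0. (f (y + t *\<^sub>R h) - f y) / t < c')"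
  shows "ereal c \<le> clarke_dd f x h"
proof (rule ccontr)
  assume "\<not> ereal c \<le> clarke_dd f x h"
  then obtain c' where "clarke_dd f x h < ereal c'" "c' < c"
    by (metis ereal_dense2 less_ereal.simps(1) not_le)
  then show False
    using clarke_dd_less_eventually assms by blast
qed

text \<open>
Moving the base point from \<open>y\<close> to \<open>y + t h\<close> does not leave the limit regime. This is why the
Clarke derivative, whose base point varies, is subadditive although an ordinary
directional derivative is not.
\<close>

lemma filterlim_base_shift:
  fixes x h :: "'a::real_normed_vector"
  shows "filterlim (\<lambda>(y, t). (y + t *\<^sub>R h, t)) (nhds x \<times>\<^sub>F at_right 0) (nhds x \<times>\<^sub>F at_right (0::real))"
proof -
  have "filterlim (\<lambda>p. fst p + snd p *\<^sub>R h) (nhds (x + 0 *\<^sub>R h)) (nhds x \<times>\<^sub>F at_right (0::real))"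
    by (intro tendsto_intros filterlim_fst filterlim_compose[OF _ filterlim_snd])
  then show ?thesis
    by (auto simp: case_prod_unfold intro!: filterlim_Pair filterlim_snd)
qed

lemma clarke_dd_add_less:
  assumes "clarke_dd f x h < ereal c" "clarke_dd f x k < ereal d"
  shows "clarke_dd f x (h + k) \<le> ereal (c + d)"
proof (rule clarke_dd_le)
  have "\<forall>\<^sub>F (y, t) in nhds x \<times>\<^sub>F at_right 0. (f (y + t *\<^sub>R h + t *\<^sub>R k) - f (y + t *\<^sub>R h)) / t < d"
    using eventually_compose_filterlim[OF clarke_dd_less_eventually[OF assms(2)] filterlim_base_shift[of h x]]
    by (simp add: case_prod_unfold)
  with clarke_dd_less_eventually[OF assms(1)]
  show "\<forall>\<^sub>F (y, t) in nhds x \<times>\<^sub>F at_right 0. (f (y + t *\<^sub>R (h + k)) - f y) / t \<le> c + d"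
    by eventually_elim (auto simp: scaleR_add_right add.assoc diff_divide_distrib)
qed

lemma clarke_dd_scale_less:
  assumes "clarke_dd f x h < ereal c" "0 < s"
  shows "clarke_dd f x (s *\<^sub>R h) \<le> ereal (s * c)"
proof (rule clarke_dd_le)
  have "filterlim (\<lambda>t. s * t) (at_right (s * 0)) (at_right 0)"
    using assms(2) by (intro filterlim_times_pos) (auto simp: filterlim_ident)
  then have "filterlim (\<lambda>p. (fst p, snd p * s)) (nhds x \<times>\<^sub>F at_right 0) (nhds x \<times>\<^sub>F at_right (0::real))"
    by (intro filterlim_Pair filterlim_fst filterlim_compose[OF _ filterlim_snd])
      (simp add: mult.commute)
  from eventually_compose_filterlim[OF clarke_dd_less_eventually[OF assms(1)] this]
  have "\<forall>\<^sub>F p in nhds x \<times>\<^sub>F at_right 0.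
      (f (fst p + (snd p * s) *\<^sub>R h) - f (fst p)) / (snd p * s) < c"
    by (simp add: case_prod_unfold)
  then show "\<forall>\<^sub>F (y, t) in nhds x \<times>\<^sub>F at_right 0. (f (y + t *\<^sub>R s *\<^sub>R h) - f y) / t \<le> s * c"
  proof eventually_elim
    case (elim p)
    then have "(f (fst p + (snd p * s) *\<^sub>R h) - f (fst p)) / snd p < c * s"
      using assms(2) by (simp add: pos_divide_less_eq flip: divide_divide_eq_left)
    then show ?case by (simp add: case_prod_unfold mult.commute)
  qed
qed

lemma clarke_dd_bounds_of_lipschitz:
  assumes "L-lipschitz_on (cball x r) f" "0 < r"
  shows "clarke_dd f x h \<le> ereal (L * norm h)" "ereal (- L * norm h) \<le> clarke_dd f x h"
proof -
  have "\<forall>\<^sub>F p in nhds x \<times>\<^sub>F at_right (0::real). fst p \<in> ball x r"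
    using assms(2) eventually_nhds_in_open[of "ball x r" x]
    by (intro eventually_compose_filterlim[OF _ filterlim_fst]) auto
  moreover from eventually_compose_filterlim[OF this filterlim_base_shift[of h x]]
  have "\<forall>\<^sub>F p in nhds x \<times>\<^sub>F at_right (0::real). fst p + snd p *\<^sub>R h \<in> ball x r"
    by (simp add: case_prod_unfold)
  moreover have "\<forall>\<^sub>F p in nhds x \<times>\<^sub>F at_right (0::real). 0 < snd p"
    by (intro eventually_compose_filterlim[OF _ filterlim_snd] eventually_at_right_less)
  ultimately have ev: "\<forall>\<^sub>F p in nhds x \<times>\<^sub>F at_right (0::real).
      \<bar>(f (fst p + snd p *\<^sub>R h) - f (fst p)) / snd p\<bar> \<le> L * norm h"
  proof eventually_elim
    case (elim p)
    then have "dist (f (fst p + snd p *\<^sub>R h)) (f (fst p)) \<le> L * dist (fst p + snd p *\<^sub>R h) (fst p)"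
      by (intro lipschitz_onD[OF assms(1)]) auto
    then show ?case using elim(3) by (simp add: dist_norm field_simps)
  qed
  then show "clarke_dd f x h \<le> ereal (L * norm h)"
    by (intro clarke_dd_le) (auto elim!: eventually_mono simp: case_prod_unfold simp del: abs_divide)
  have nb: "nhds x \<times>\<^sub>F at_right (0::real) \<noteq> bot"
    by (simp add: prod_filter_eq_bot)
  show "ereal (- L * norm h) \<le> clarke_dd f x h"
    unfolding clarke_dd_def using ev
    by (intro le_Limsup[OF nb]) (auto elim!: eventually_mono simp: case_prod_unfold abs_le_iff simp del: abs_divide)
qed

text \<open>
Near a point where \<open>f\<close> is Lipschitz the extended-real derivative is finite, and the conversion
loses nothing; an infinite derivative becomes \<open>0\<close>.
\<close>

definition clarke_deriv :: "('a::banach \<Rightarrow> real) \<Rightarrow> 'a \<Rightarrow> 'a \<Rightarrow> real" where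
  "clarke_deriv f x h = real_of_ereal (clarke_dd f x h)"

context
  fixes f :: "'a::banach \<Rightarrow> real" and x L r
  assumes lip: "L-lipschitz_on (cball x r) f" and r: "0 < r"
begin

lemma ereal_clarke_deriv: "ereal (clarke_deriv f x h) = clarke_dd f x h"
  using clarke_dd_bounds_of_lipschitz[OF lip r, of h] unfolding clarke_deriv_def
  by (cases "clarke_dd f x h") auto

lemma clarke_deriv_abs_le: "\<bar>clarke_deriv f x h\<bar> \<le> L * norm h"
  using clarke_dd_bounds_of_lipschitz[OF lip r, of h]
  unfolding ereal_clarke_deriv[symmetric] by auto

lemma clarke_deriv_add: "clarke_deriv f x (h + k) \<le> clarke_deriv f x h + clarke_deriv f x k"
proof (rule field_le_epsilon)
  fix e :: real assume "0 < e"
  then show "clarke_deriv f x (h + k) \<le> clarke_deriv f x h + clarke_deriv f x k + e"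
    using clarke_dd_add_less[of f x h "clarke_deriv f x h + e / 2" k "clarke_deriv f x k + e / 2"]
    unfolding ereal_clarke_deriv[symmetric] by simp
qed

lemma clarke_deriv_zero [simp]: "clarke_deriv f x 0 = 0"
  using clarke_deriv_abs_le[of 0] by simp

lemma clarke_deriv_scale_le:
  assumes "0 \<le> c" shows "clarke_deriv f x (c *\<^sub>R h) \<le> c * clarke_deriv f x h"
proof (cases "c = 0")
  case False
  then have "0 < c" using assms by simp
  show ?thesis
  proof (rule field_le_epsilon)
    fix e :: real assume "0 < e"
    then show "clarke_deriv f x (c *\<^sub>R h) \<le> c * clarke_deriv f x h + e"
      using clarke_dd_scale_less[of f x h "clarke_deriv f x h + e / c" c] \<open>0 < c\<close>
      unfolding ereal_clarke_deriv[symmetric] by (simp add: distrib_left)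
  qed
qed simp

lemma clarke_deriv_scale:
  assumes "0 \<le> c" shows "clarke_deriv f x (c *\<^sub>R h) = c * clarke_deriv f x h"
proof (cases "c = 0")
  case False
  then have "0 < c" using assms by simp
  then have "clarke_deriv f x h \<le> (1 / c) * clarke_deriv f x (c *\<^sub>R h)"
    using clarke_deriv_scale_le[of "1 / c" "c *\<^sub>R h"] by simp
  then show ?thesis
    using clarke_deriv_scale_le[OF assms, of h] \<open>0 < c\<close> by (simp add: field_simps)
qed simp

end

section \<open>A multiplier rule on the intersection of a convex cone with a sphere\<close>

text \<open>
Rescaling a tangential perturbation \<open>v + w\<close> back to the sphere through \<open>v\<close> moves it by
\<open>sqrt (s\<^sup>2 + \<parallel>w\<parallel>\<^sup>2) - s\<close>, which is of second order in \<open>w\<close>.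
\<close>

lemma norm_rescale_to_sphere_le:
  fixes v w :: "'a::real_inner"
  assumes orth: "inner v w = 0" and s: "0 < s" "norm v = s"
  defines "c \<equiv> s / norm (v + w)"
  shows "norm (v + w) > 0" "norm (c *\<^sub>R (v + w)) = s"
    "norm (c *\<^sub>R (v + w) - (v + w)) \<le> (norm w)\<^sup>2 / (2 * s)"
proof -
  have sq: "(norm (v + w))\<^sup>2 = s\<^sup>2 + (norm w)\<^sup>2"
    using orth s(2) by (simp add: norm_add_Pythagorean orthogonal_def)
  have ge: "s \<le> norm (v + w)"
    by (rule power2_le_imp_le) (auto simp: sq)
  then show pos: "norm (v + w) > 0" using s(1) by linarith
  then show "norm (c *\<^sub>R (v + w)) = s" using s(1) by (simp add: c_def)
  have "c *\<^sub>R (v + w) - (v + w) = (c - 1) *\<^sub>R (v + w)"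
    by (simp add: algebra_simps)
  then have "norm (c *\<^sub>R (v + w) - (v + w)) = \<bar>c - 1\<bar> * norm (v + w)"
    by simp
  also have "\<dots> = norm (v + w) - s"
    using ge pos by (simp add: c_def abs_if field_simps)
  also have "\<dots> \<le> (norm w)\<^sup>2 / (2 * s)"
  proof -
    have "0 \<le> (norm (v + w) - s)\<^sup>2" by simp
    then have "2 * s * (norm (v + w) - s) \<le> (norm w)\<^sup>2"
      using sq by (simp add: power2_eq_square algebra_simps)
    then show ?thesis using s(1) by (simp add: field_simps)
  qed
  finally show "norm (c *\<^sub>R (v + w) - (v + w)) \<le> (norm w)\<^sup>2 / (2 * s)" .
qed

text \<open>
Here \<open>P\<close> is the orthogonal projection along the span of \<open>e\<close> and \<open>q\<close>. Directions \<open>P h\<close> with \<open>h \<in> K\<close>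
are tangent to the constraint set, so \<open>f\<close> cannot descend along them. The subgradient is then
separated off from the cone of these directions, and projecting it yields the normal vector.
Both \<open>e\<close> and \<open>- e\<close> must lie in \<open>K\<close>: the curve through \<open>q\<close> needs multiples of \<open>e\<close> of either sign.
\<close>

theorem multiplier_rule_on_convex_cone:
  fixes f :: "'a::{real_inner, banach} \<Rightarrow> real" and K :: "'a set" and e q :: 'a
  assumes K_add: "\<And>x y. x \<in> K \<Longrightarrow> y \<in> K \<Longrightarrow> x + y \<in> K"
    and K_scale: "\<And>c x. 0 \<le> c \<Longrightarrow> x \<in> K \<Longrightarrow> c *\<^sub>R x \<in> K"
    and e: "e \<in> K" "- e \<in> K" "inner e e = 1"
    and q: "q \<in> K" "inner e q = \<mu>" "inner q q = \<mu>\<^sup>2 + \<sigma>\<^sup>2" and \<sigma>: "0 < \<sigma>"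
    and lip: "L-lipschitz_on (cball q r) f" and r: "0 < r"
    and min: "local_minimizer_on f ({x. inner e x = \<mu> \<and> inner x x = \<mu>\<^sup>2 + \<sigma>\<^sup>2} \<inter> K) q"
  shows "\<exists>l1 l2. \<exists>z\<in>normal_cone K q. \<exists>\<zeta>\<in>clarke_gradient f q.
      0 = \<zeta> + l1 *\<^sub>R e + (2 * l2) *\<^sub>R q + z"
proof -
  define q0 where "q0 = q - \<mu> *\<^sub>R e"
  define \<kappa> where "\<kappa> h = inner q0 h / \<sigma>\<^sup>2" for h
  define P where "P h = h - inner e h *\<^sub>R e - \<kappa> h *\<^sub>R q0" for h
  have "0 \<le> L" using lip by (rule lipschitz_on_nonneg)
  have q0: "inner e q0 = 0" "inner q0 e = 0" "inner q0 q0 = \<sigma>\<^sup>2" "inner q0 q = \<sigma>\<^sup>2"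
    using q e by (auto simp: q0_def inner_diff_left inner_diff_right inner_commute[of q e]
        power2_eq_square algebra_simps)
  have norm_q0: "norm q0 = \<sigma>"
    using q0(3) \<sigma> by (simp add: norm_eq_sqrt_inner)
  have P_orth: "inner e (P h) = 0" "inner q0 (P h) = 0" for h
    using \<sigma> q0 e by (auto simp: P_def \<kappa>_def inner_diff_right)
  have P_add: "P (h + k) = P h + P k" for h k
    by (simp add: P_def \<kappa>_def inner_add_right add_divide_distrib algebra_simps)
  have P_scale: "P (c *\<^sub>R h) = c *\<^sub>R P h" for c h
    by (simp add: P_def \<kappa>_def algebra_simps)
  have P_q: "P q = 0"
    using \<sigma> q q0 by (simp add: P_def \<kappa>_def) (simp add: q0_def)
  have P_sym: "inner (P h) k = inner h (P k)" for h k
    by (simp add: P_def \<kappa>_def inner_diff_left inner_diff_right inner_commute)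
  have K_e: "c *\<^sub>R e \<in> K" for c
    using K_scale[of c e] K_scale[of "- c" "- e"] e by (cases "0 \<le> c") auto
  have K_0: "0 \<in> K" using K_e[of 0] by simp
  obtain \<epsilon> where \<epsilon>: "0 < \<epsilon>"
    "\<And>y. \<lbrakk>inner e y = \<mu>; inner y y = \<mu>\<^sup>2 + \<sigma>\<^sup>2; y \<in> K; dist y q < \<epsilon>\<rbrakk> \<Longrightarrow> f q \<le> f y"
    using min unfolding local_minimizer_on_def by auto
  have descent: "0 \<le> clarke_dd f q (P h)" if h: "h \<in> K" for h
  proof -
    define w where "w = P h"
    define C where "C = (norm w)\<^sup>2 / (2 * \<sigma>)"
    have "0 \<le> C" using \<sigma> by (simp add: C_def)
    have "ereal 0 \<le> clarke_dd f q w"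
    proof (rule clarke_dd_ge_frequently, rule notI)
      fix c' :: real assume "c' < 0"
      assume ev: "\<forall>\<^sub>F (y, t) in nhds q \<times>\<^sub>F at_right 0. (f (y + t *\<^sub>R w) - f y) / t < c'"
      have "filterlim (\<lambda>t. (q, t)) (nhds q \<times>\<^sub>F at_right 0) (at_right (0::real))"
        by (intro filterlim_Pair tendsto_const filterlim_ident)
      from eventually_compose_filterlim[OF ev this]
      have ev1: "\<forall>\<^sub>F t in at_right 0. (f (q + t *\<^sub>R w) - f q) / t < c'" by simp
      have small: "\<forall>\<^sub>F t in at_right 0. g t < b" if "isCont g 0" "g 0 < b" for g :: "real \<Rightarrow> real" and b
      proof -
        have "(g \<longlongrightarrow> g 0) (at_right 0)"
          using that(1) by (simp add: continuous_within filterlim_at_split)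
        then show ?thesis using that(2) by (rule order_tendstoD)
      qed
      have ev2: "\<forall>\<^sub>F t in at_right 0. t * \<kappa> h < 1"
        "\<forall>\<^sub>F t in at_right 0. t\<^sup>2 * C + t * norm w < min \<epsilon> r"
        "\<forall>\<^sub>F t in at_right 0. L * (t * C) < - c'"
        "\<forall>\<^sub>F t in at_right 0. t < (1::real)"
        using \<epsilon>(1) r \<open>c' < 0\<close> by (intro small continuous_intros; simp)+
      have "\<forall>\<^sub>F t in at_right (0::real). False"
        using ev1 ev2 eventually_at_right_less[of 0]
      proof eventually_elim
        case (elim t)
        define c where "c = \<sigma> / norm (q0 + t *\<^sub>R w)"
        \<comment> \<open>The comparison point: the tangential step from q, rescaled about the centre of the sphere.\<close>
        define v where "v = \<mu> *\<^sub>R e + c *\<^sub>R (q0 + t *\<^sub>R w)"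
        have orth: "inner q0 (t *\<^sub>R w) = 0" using P_orth by (simp add: w_def)
        note sphere = norm_rescale_to_sphere_le[OF orth \<sigma> norm_q0, folded c_def]
        have "0 < c" using sphere(1) \<sigma> by (simp add: c_def)
        have diff: "v - (q + t *\<^sub>R w) = c *\<^sub>R (q0 + t *\<^sub>R w) - (q0 + t *\<^sub>R w)"
          by (simp add: v_def q0_def)
        have v_near: "norm (v - (q + t *\<^sub>R w)) \<le> t\<^sup>2 * C"
          unfolding diff using sphere(3) by (simp add: C_def power_mult_distrib)
        have "norm (v - q) \<le> norm (v - (q + t *\<^sub>R w)) + norm (t *\<^sub>R w)"
          using norm_triangle_ineq[of "v - (q + t *\<^sub>R w)" "t *\<^sub>R w"] by simp
        then have v_q: "norm (v - q) < min \<epsilon> r" using v_near elim by simp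
        have orth_e: "inner e (c *\<^sub>R (q0 + t *\<^sub>R w)) = 0"
          using P_orth q0 by (simp add: w_def inner_add_right)
        have "inner e v = \<mu>"
          using orth_e e by (simp add: v_def inner_add_right)
        moreover have "inner v v = \<mu>\<^sup>2 + \<sigma>\<^sup>2"
        proof -
          define y where "y = c *\<^sub>R (q0 + t *\<^sub>R w)"
          have y: "inner e y = 0" "inner y y = \<sigma>\<^sup>2" "v = \<mu> *\<^sub>R e + y"
            using orth_e sphere(2) by (simp_all add: y_def v_def flip: power2_norm_eq_inner)
          show ?thesis
            using y(1,2) e(3) unfolding y(3)
            by (simp add: inner_add_right inner_add_left inner_commute[of y e] power2_eq_square)
        qed
        moreover have "v \<in> K"
        proof -
          \<comment> \<open>The coefficients of q and h are nonnegative for small t; only e gets a coefficient of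
            unknown sign.\<close>
          have "v = (c * (1 - t * \<kappa> h)) *\<^sub>R q + (c * t) *\<^sub>R h
              + (\<mu> - c * (1 - t * \<kappa> h) * \<mu> - c * t * inner e h) *\<^sub>R e"
            by (simp add: v_def w_def P_def q0_def algebra_simps)
          also have "\<dots> \<in> K"
            using \<open>0 < c\<close> elim q(1) h by (intro K_add K_scale K_e) auto
          finally show ?thesis .
        qed
        ultimately have "f q \<le> f v"
          using v_q by (intro \<epsilon>(2)) (auto simp: dist_norm)
        moreover have "dist (f v) (f (q + t *\<^sub>R w)) \<le> L * dist v (q + t *\<^sub>R w)"
        proof (rule lipschitz_onD[OF lip])
          show "v \<in> cball q r" using v_q by (simp add: dist_norm norm_minus_commute)
          have "0 \<le> t\<^sup>2 * C" using \<open>0 \<le> C\<close> by simp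
          then show "q + t *\<^sub>R w \<in> cball q r" using elim by (simp add: dist_norm)
        qed
        then have "\<bar>f v - f (q + t *\<^sub>R w)\<bar> \<le> L * (t\<^sup>2 * C)"
          using mult_left_mono[OF v_near \<open>0 \<le> L\<close>] by (simp add: dist_norm)
        moreover have "f (q + t *\<^sub>R w) - f q < c' * t"
          using elim by (simp add: pos_divide_less_eq)
        ultimately have "0 < t * (c' + L * (t * C))"
          by (simp add: power2_eq_square algebra_simps)
        then show False using elim by (simp add: zero_less_mult_iff)
      qed
      then show False by simp
    qed
    then show ?thesis by (simp add: w_def zero_ereal_def)
  qed
  define s where "s = clarke_deriv f q"
  note s = ereal_clarke_deriv[OF lip r, folded s_def]
  note s_le = clarke_deriv_abs_le[OF lip r, folded s_def]
  note s_add = clarke_deriv_add[OF lip r, folded s_def]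
  note s_scale = clarke_deriv_scale[OF lip r, folded s_def]
  have s_0: "s 0 = 0" using s_le[of 0] by simp
  have s_P: "0 \<le> s (P h)" if "h \<in> K" for h
    using descent[OF that] unfolding s[symmetric] by simp
  \<comment> \<open>Up to closure, the epigraph of the sublinear function that takes d to the infimum of s (d + P h) over h in K.
    It misses the point (0, -1) since s is nonnegative on the directions P h.\<close>
  define E where "E = {(d, \<rho>). \<exists>h\<in>K. s (d + P h) \<le> \<rho>}"
  have E_I: "(d, \<rho>) \<in> E" if "h \<in> K" "s (d + P h) \<le> \<rho>" for d \<rho> h
    using that by (auto simp: E_def)
  \<comment> \<open>Every (d, \<rho>) in E has \<rho> \<ge> - L * norm d, whence its distance from (0, -1) is at
    least 1 / (1 + L).\<close>
  obtain n where n: "\<And>x. x \<in> E \<Longrightarrow> 0 \<le> inner n x" "inner n (0, - 1) < 0"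
  proof (rule separate_point_from_convex_cone[of E "1 / (1 + L)" "(0, - 1)"])
    show "0 \<in> E"
      using K_0 P_scale[of 0 0] s_0 by (auto simp: zero_prod_def intro!: E_I[of 0])
    fix x y assume "x \<in> E" "y \<in> E"
    then obtain d \<rho> h d' \<rho>' h' where xy: "x = (d, \<rho>)" "y = (d', \<rho>')"
      and h: "h \<in> K" "s (d + P h) \<le> \<rho>" "h' \<in> K" "s (d' + P h') \<le> \<rho>'"
      by (auto simp: E_def)
    have "s ((d + d') + P (h + h')) \<le> \<rho> + \<rho>'"
      using s_add[of "d + P h" "d' + P h'"] h by (simp add: P_add algebra_simps)
    then show "x + y \<in> E" unfolding xy using h by (auto intro: E_I[of "h + h'"] K_add)
  next
    fix c x assume c: "(0::real) \<le> c" and "x \<in> E"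
    then obtain d \<rho> h where x: "x = (d, \<rho>)" and h: "h \<in> K" "s (d + P h) \<le> \<rho>"
      by (auto simp: E_def)
    have "s (c *\<^sub>R d + P (c *\<^sub>R h)) = c * s (d + P h)"
      using s_scale[OF c, of "d + P h"] by (simp add: P_scale scaleR_add_right)
    then show "c *\<^sub>R x \<in> E"
      unfolding x using h c by (auto intro!: E_I[of "c *\<^sub>R h"] K_scale mult_left_mono)
  next
    show "0 < 1 / (1 + L)" using \<open>0 \<le> L\<close> by simp
  next
    fix x assume "x \<in> E"
    then obtain d \<rho> h where x: "x = (d, \<rho>)" and h: "h \<in> K" "s (d + P h) \<le> \<rho>"
      by (auto simp: E_def)
    have "0 \<le> s (d + P h) + s (- d)"
      using s_P[OF h(1)] s_add[of "d + P h" "- d"] by simp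
    then have "1 \<le> \<bar>\<rho> + 1\<bar> + L * norm d"
      using h(2) abs_le_D1[OF s_le[of "- d"]] unfolding norm_minus_cancel by linarith
    also have "\<dots> \<le> norm (x - (0, - 1)) + L * norm (x - (0, - 1))"
      using norm_fst_le[of d "\<rho> + 1"] norm_snd_le[of "\<rho> + 1" d] \<open>0 \<le> L\<close>
      by (intro add_mono mult_left_mono) (auto simp: x)
    finally have "1 \<le> norm (x - (0, - 1)) * (1 + L)" by (simp add: algebra_simps)
    then show "1 / (1 + L) \<le> norm (x - (0, - 1))"
      using \<open>0 \<le> L\<close> by (simp add: pos_divide_le_eq)
  qed blast
  define k where "k = snd n"
  have k: "0 < k" using n(2) by (simp add: k_def inner_prod_def)
  \<comment> \<open>Normalising the last component of n turns the half-space into the epigraph of a linear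
    functional below s.\<close>
  define \<zeta> where "\<zeta> = (- 1 / k) *\<^sub>R fst n"
  have \<zeta>_le: "inner \<zeta> d \<le> \<rho>" if "(d, \<rho>) \<in> E" for d \<rho>
    using n(1)[OF that] k by (simp add: \<zeta>_def k_def inner_prod_def field_simps)
  have "\<zeta> \<in> clarke_gradient f q"
    unfolding mem_clarke_gradient_iff
  proof
    fix d
    have "P 0 = 0" using P_scale[of 0 0] by simp
    then show "ereal (inner \<zeta> d) \<le> clarke_dd f q d"
      unfolding s[symmetric] using K_0 by (auto intro!: \<zeta>_le E_I[of 0])
  qed
  moreover have "- P \<zeta> \<in> normal_cone K q"
    unfolding normal_cone_def
  proof (intro CollectI ballI)
    fix h assume "h \<in> K"
    then have "inner \<zeta> (- P h) \<le> 0"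
      using s_0 by (intro \<zeta>_le E_I[of h]) auto
    then show "inner (- P \<zeta>) (h - q) \<le> 0"
      by (simp add: inner_diff_right P_sym P_q)
  qed
  moreover have "0 = \<zeta> + (- inner e \<zeta> + \<kappa> \<zeta> * \<mu>) *\<^sub>R e + (2 * (- \<kappa> \<zeta> / 2)) *\<^sub>R q + (- P \<zeta>)"
    by (simp add: P_def q0_def algebra_simps)
  ultimately show ?thesis by blast
qed

section \<open>Clarke derivatives of functions of one real variable\<close>

text \<open>
Upper semicontinuity in the base point: a bound for difference quotients based near \<open>x\<close> is at the
same time a bound for those based near any close \<open>y\<close>.
\<close>

lemma clarke_dd_less_nearby:
  fixes f :: "'a::banach \<Rightarrow> real"
  assumes "clarke_dd f x h < ereal c"
  shows "\<forall>\<^sub>F y in nhds x. clarke_dd f y h < ereal c"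
proof -
  obtain c' where c': "clarke_dd f x h < ereal c'" "c' < c"
    using ereal_dense2[OF assms] by auto
  obtain Q R where QR: "\<forall>\<^sub>F y in nhds x. Q y" "\<forall>\<^sub>F t in at_right 0. R t"
    "\<And>y t. Q y \<Longrightarrow> R t \<Longrightarrow> (f (y + t *\<^sub>R h) - f y) / t < c'"
    using clarke_dd_less_eventually[OF c'(1)] unfolding eventually_prod_filter by auto
  from QR(1) have "\<forall>\<^sub>F y in nhds x. \<forall>\<^sub>F z in nhds y. Q z"
    by (simp add: eventually_eventually)
  then show ?thesis
  proof eventually_elim
    case (elim y)
    have "clarke_dd f y h \<le> ereal c'"
      using elim QR(2,3) unfolding eventually_prod_filter
      by (intro clarke_dd_le) (auto simp: eventually_prod_filter intro!: less_imp_le)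
    then show ?case using c'(2) by (metis ereal_less_eq(3) less_ereal.simps(1) order.strict_trans1)
  qed
qed

lemma clarke_quotient_less_sequentially:
  fixes f :: "'a::banach \<Rightarrow> real"
  assumes "clarke_dd f x h < ereal c" "y \<longlonglongrightarrow> x" "t \<longlonglongrightarrow> 0" "\<And>n. 0 < t n"
  shows "\<forall>\<^sub>F n in sequentially. (f (y n + t n *\<^sub>R h) - f (y n)) / t n < c"
proof -
  have "t n \<noteq> 0" for n using assms(4)[of n] by simp
  then have "filterlim (\<lambda>n. (y n, t n)) (nhds x \<times>\<^sub>F at_right 0) sequentially"
    using assms(2-4) by (intro filterlim_Pair) (auto simp: filterlim_at intro!: always_eventually)
  from eventually_compose_filterlim[OF clarke_dd_less_eventually[OF assms(1)] this]
  show ?thesis by simp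
qed

lemma locally_lipschitz_ereal_clarke_deriv:
  fixes f :: "'a::banach \<Rightarrow> real"
  assumes "locally_lipschitz f"
  shows "ereal (clarke_deriv f x h) = clarke_dd f x h"
  using assms ereal_clarke_deriv[of _ x _ f h] unfolding locally_lipschitz_def by metis

lemma borel_measurable_clarke_deriv:
  fixes f :: "'a::banach \<Rightarrow> real"
  assumes "locally_lipschitz f"
  shows "(\<lambda>x. clarke_deriv f x h) \<in> borel_measurable borel"
proof (rule borel_measurableI_less)
  fix c
  have "open {x. clarke_deriv f x h < c}"
    unfolding open_subopen[of "{x. clarke_deriv f x h < c}"]
  proof
    fix x assume "x \<in> {x. clarke_deriv f x h < c}"
    then have "clarke_dd f x h < ereal c"
      by (simp flip: locally_lipschitz_ereal_clarke_deriv[OF assms])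
    from clarke_dd_less_nearby[OF this]
    show "\<exists>T. open T \<and> x \<in> T \<and> T \<subseteq> {x. clarke_deriv f x h < c}"
      unfolding eventually_nhds
      by (auto simp flip: locally_lipschitz_ereal_clarke_deriv[OF assms])
  qed
  then show "{x \<in> space borel. clarke_deriv f x h < c} \<in> sets borel" by simp
qed

text \<open>
On the line the directional derivative is positively homogeneous on each half-axis, so only the
directions \<open>1\<close> and \<open>- 1\<close> have to be tested.
\<close>

lemma clarke_gradient_real:
  fixes U :: "real \<Rightarrow> real"
  assumes "locally_lipschitz U"
  shows "clarke_gradient U x = {- clarke_deriv U x (- 1) .. clarke_deriv U x 1}"
proof -
  obtain L r where "L-lipschitz_on (cball x r) U" "0 < r"
    using assms unfolding locally_lipschitz_def by metis
  note scale = clarke_deriv_scale[OF this]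
  have pos: "clarke_deriv U x h = h * clarke_deriv U x 1" if "0 \<le> h" for h
    using scale[OF that, of 1] by simp
  have neg: "clarke_deriv U x h = - h * clarke_deriv U x (- 1)" if "h \<le> 0" for h
    using scale[of "- h" "- 1"] that by simp
  have "v \<in> clarke_gradient U x \<longleftrightarrow> (\<forall>h. v * h \<le> clarke_deriv U x h)" for v
    by (simp add: mem_clarke_gradient_iff flip: locally_lipschitz_ereal_clarke_deriv[OF assms])
  moreover have "(\<forall>h. v * h \<le> clarke_deriv U x h) \<longleftrightarrow>
      - clarke_deriv U x (- 1) \<le> v \<and> v \<le> clarke_deriv U x 1" for v
  proof
    assume *: "\<forall>h. v * h \<le> clarke_deriv U x h"
    show "- clarke_deriv U x (- 1) \<le> v \<and> v \<le> clarke_deriv U x 1"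
      using *[rule_format, of 1] *[rule_format, of "- 1"] by simp
  next
    assume *: "- clarke_deriv U x (- 1) \<le> v \<and> v \<le> clarke_deriv U x 1"
    show "\<forall>h. v * h \<le> clarke_deriv U x h"
    proof
      fix h :: real
      show "v * h \<le> clarke_deriv U x h"
      proof (cases "0 \<le> h")
        case True
        then have "h * v \<le> h * clarke_deriv U x 1" using * by (intro mult_left_mono) auto
        then show ?thesis using pos[OF True] by (simp add: mult.commute)
      next
        case False
        then have "(- h) * (- v) \<le> (- h) * clarke_deriv U x (- 1)"
          using * by (intro mult_left_mono) auto
        then show ?thesis using neg[of h] False by (simp add: mult.commute)
      qed
    qed
  qed
  ultimately show ?thesis by auto
qed

lemma clarke_deriv_real_nonempty:
  fixes U :: "real \<Rightarrow> real"
  assumes "locally_lipschitz U"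
  shows "- clarke_deriv U x (- 1) \<le> clarke_deriv U x 1"
proof -
  obtain L r where "L-lipschitz_on (cball x r) U" "0 < r"
    using assms unfolding locally_lipschitz_def by metis
  from clarke_deriv_add[OF this, of 1 "- 1"] clarke_deriv_zero[OF this] show ?thesis by simp
qed

lemma clarke_deriv_mono_nonneg:
  fixes U :: "real \<Rightarrow> real"
  assumes "locally_lipschitz U" "mono U"
  shows "0 \<le> - clarke_deriv U x (- 1)"
proof -
  have "clarke_dd U x (- 1) \<le> ereal 0"
  proof (rule clarke_dd_le)
    have "\<forall>\<^sub>F p in nhds x \<times>\<^sub>F at_right (0::real). 0 < snd p"
      by (intro eventually_compose_filterlim[OF _ filterlim_snd] eventually_at_right_less)
    then show "\<forall>\<^sub>F (y, t) in nhds x \<times>\<^sub>F at_right 0. (U (y + t *\<^sub>R - 1) - U y) / t \<le> 0"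
      using monoD[OF assms(2)]
      by (auto elim!: eventually_mono simp: case_prod_unfold divide_nonpos_pos)
  qed
  then show ?thesis
    unfolding locally_lipschitz_ereal_clarke_deriv[OF assms(1), symmetric] by simp
qed

text \<open>
A mean value inequality: near each point the difference quotients
are below \<open>M + e'\<close>, and bisection of the interval makes this local estimate global.
\<close>

lemma diff_le_of_clarke_deriv_le:
  fixes U :: "real \<Rightarrow> real"
  assumes "locally_lipschitz U" "x \<le> y" "\<And>z. x \<le> z \<Longrightarrow> z \<le> y \<Longrightarrow> clarke_deriv U z 1 \<le> M"
  shows "U y - U x \<le> M * (y - x)"
proof (rule field_le_epsilon)
  fix e :: real assume "0 < e"
  \<comment> \<open>The summand 1 avoids a division by zero when x = y.\<close>
  define e' where "e' = e / (y - x + 1)"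
  have "0 < e'" using \<open>0 < e\<close> assms(2) by (simp add: e'_def)
  have "x \<le> y \<longrightarrow> U y - U x \<le> (M + e') * (y - x)"
    using assms(2)
  proof (induct rule: Bolzano[of x y])
    case (trans a b c)
    then show ?case by (auto simp: algebra_simps)
  next
    case (local z)
    have "clarke_dd U z 1 < ereal (M + e')"
      using assms(3)[OF local] \<open>0 < e'\<close>
      unfolding locally_lipschitz_ereal_clarke_deriv[OF assms(1), symmetric] by simp
    from clarke_dd_less_eventually[OF this]
    obtain Q R where QR: "\<forall>\<^sub>F w in nhds z. Q w" "\<forall>\<^sub>F t in at_right 0. R t"
      "\<And>w t. Q w \<Longrightarrow> R t \<Longrightarrow> (U (w + t) - U w) / t < M + e'"
      unfolding eventually_prod_filter by auto
    obtain d1 where d1: "0 < d1" "\<And>w. dist w z < d1 \<Longrightarrow> Q w"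
      using QR(1) unfolding eventually_nhds_metric by auto
    obtain d2 where d2: "0 < d2" "\<And>t. 0 < t \<Longrightarrow> t < d2 \<Longrightarrow> R t"
      using QR(2) unfolding eventually_at_right_field by auto
    have "U v - U u \<le> (M + e') * (v - u)"
      if uv: "u \<le> z" "z \<le> v" "v - u < min d1 d2" "u < v" for u v
    proof -
      have "Q u" "R (v - u)" using uv by (auto intro!: d1 d2 simp: dist_real_def)
      from QR(3)[OF this] show ?thesis using uv(4) by (simp add: pos_divide_less_eq less_imp_le)
    qed
    then show ?case
      using d1(1) d2(1) by (intro exI[of _ "min d1 d2"]) (force simp: le_less)
  qed
  then have "U y - U x \<le> M * (y - x) + e' * (y - x)"
    using assms(2) by (simp add: algebra_simps)
  also have "e' * (y - x) \<le> e"
    using \<open>0 < e\<close> assms(2) by (simp add: e'_def field_simps)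
  finally show "U y - U x \<le> M * (y - x) + e" by simp
qed

text \<open>
For a monotone function the upper end of the Clarke gradient bounds its absolute values, so linear
growth of the gradient controls \<open>U\<close> by a modulus that is itself linear in the arguments.
\<close>

lemma mono_diff_le_of_clarke_growth:
  fixes U :: "real \<Rightarrow> real"
  assumes "locally_lipschitz U" "mono U" "0 \<le> b" "\<And>z. clarke_deriv U z 1 \<le> a + b * \<bar>z\<bar>"
  shows "\<bar>U y - U x\<bar> \<le> (a + b * (\<bar>x\<bar> + \<bar>y\<bar>)) * \<bar>y - x\<bar>"
proof -
  have *: "U y - U x \<le> (a + b * (\<bar>x\<bar> + \<bar>y\<bar>)) * (y - x)" if "x \<le> y" for x y
  proof (rule diff_le_of_clarke_deriv_le[OF assms(1) that])
    fix z assume "x \<le> z" "z \<le> y"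
    then have "b * \<bar>z\<bar> \<le> b * (\<bar>x\<bar> + \<bar>y\<bar>)" using assms(3) by (intro mult_left_mono) auto
    then show "clarke_deriv U z 1 \<le> a + b * (\<bar>x\<bar> + \<bar>y\<bar>)" using assms(4)[of z] by simp
  qed
  show ?thesis
    using *[of x y] *[of y x] monoD[OF assms(2), of x y] monoD[OF assms(2), of y x]
    by (cases "x \<le> y") (auto simp: add.commute)
qed

section \<open>Primitives and Lebesgue differentiation on the unit interval\<close>

text \<open>
The primitive of a function rather than of an equivalence class. The integral starts at \<open>0\<close>, and
for \<open>t \<le> 1\<close> only values on \<open>(0,1)\<close> enter.
\<close>

definition primitive_of :: "(real \<Rightarrow> real) \<Rightarrow> real \<Rightarrow> real" where
  "primitive_of g t = (LINT s:{0<..<t}|lborel. g s)"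

lemma I01_integral_eq: 
  "integrable I01 (g :: real \<Rightarrow> real) \<longleftrightarrow> integrable lborel (\<lambda>u. indicator {0<..<1} u * g u)"
  "(\<integral>u. g u \<partial>I01) = (\<integral>u. indicator {0<..<1} u * g u \<partial>lborel)"
  by (simp_all add: integrable_restrict_space integral_restrict_space)

lemma primitive_of_eq:
  assumes "t \<le> 1" shows "primitive_of g t = (\<integral>u. indicator {0<..<t} u * g u \<partial>I01)"
  unfolding primitive_of_def set_lebesgue_integral_def I01_integral_eq
  using assms by (intro Bochner_Integration.integral_cong) (auto simp: indicator_def)

lemma integrable_I01_indicator:
  fixes g :: "real \<Rightarrow> real"
  assumes "integrable I01 g" "A \<in> sets borel"
  shows "integrable I01 (\<lambda>u. indicator A u * g u)"
  using assms integrable_mult_indicator[of A lborel "\<lambda>u. indicator {0<..<1} u * g u"]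
  by (simp add: I01_integral_eq mult.left_commute)

lemma primitive_of_diff:
  assumes "integrable I01 g" "0 \<le> s" "s \<le> t" "t \<le> 1"
  shows "primitive_of g t - primitive_of g s = (\<integral>u. indicator {s..<t} u * g u \<partial>I01)"
proof -
  have "primitive_of g t - primitive_of g s = (\<integral>u. indicator {0<..<t} u * g u - indicator {0<..<s} u * g u \<partial>I01)"
    using assms by (simp add: primitive_of_eq integrable_I01_indicator)
  also have "\<dots> = (\<integral>u. indicator {s..<t} u * g u \<partial>I01)"
    using assms by (intro Bochner_Integration.integral_cong) (auto simp: indicator_def space_restrict_space)
  finally show ?thesis .
qed

text \<open>
Extension of \<open>g\<close> by zero makes the primitive an indefinite Henstock-Kurzweil integral, the form in
which continuity and almost everywhere differentiability are accessible.
\<close>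

lemma primitive_of_Henstock_Kurzweil:
  assumes "integrable I01 g"
  defines "f \<equiv> \<lambda>u. indicator {0<..<1} u * g u"
  shows "f integrable_on {a..b}" "0 \<le> t \<Longrightarrow> t \<le> 1 \<Longrightarrow> primitive_of g t = integral {0..t} f"
proof -
  have f: "integrable lborel f" using assms by (simp add: I01_integral_eq)
  have int: "set_integrable lborel A f" if "A \<in> sets borel" for A
    unfolding set_integrable_def using f that integrable_mult_indicator[of A lborel f] by simp
  show "f integrable_on {a..b}"
    using int by (intro set_borel_integral_eq_integral(1)) auto
  assume t: "0 \<le> t" "t \<le> 1"
  have "primitive_of g t = (LINT s:{0<..<t}|lborel. f s)"
    unfolding primitive_of_def set_lebesgue_integral_def f_def
    using t by (intro Bochner_Integration.integral_cong) (auto simp: indicator_def)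
  also have "\<dots> = integral {0<..<t} f"
    using int by (intro set_borel_integral_eq_integral(2)) auto
  also have "\<dots> = integral {0..t} f"
    by (simp add: integral_open_interval_real)
  finally show "primitive_of g t = integral {0..t} f" .
qed

lemma continuous_on_primitive:
  assumes "integrable I01 g" shows "continuous_on {0..1} (primitive_of g)"
proof (rule continuous_on_eq)
  show "continuous_on {0..1} (\<lambda>t. integral {0..t} (\<lambda>u. indicator {0<..<1} u * g u))"
    by (intro indefinite_integral_continuous_1 primitive_of_Henstock_Kurzweil assms)
qed (use primitive_of_Henstock_Kurzweil(2)[OF assms] in auto)

text \<open>
The differentiation theorem for cubes with \<open>x\<close> as lower corner, specialised to the line, where it
speaks about right difference quotients only.
\<close>

lemma AE_right_difference_quotient:
  fixes f :: "real \<Rightarrow> real"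
  assumes "\<And>a b. f integrable_on {a..b}"
  shows "AE x in lborel. \<forall>e>0. \<exists>d>0. \<forall>h. 0 < h \<and> h < d \<longrightarrow> \<bar>integral {x..x + h} f / h - f x\<bar> < e"
proof -
  obtain N where N: "negligible N"
    "\<And>x e. \<lbrakk>x \<notin> N; 0 < e\<rbrakk> \<Longrightarrow> \<exists>d>0. \<forall>h. 0 < h \<and> h < d \<longrightarrow>
       norm (integral (cbox x (x + h *\<^sub>R One)) f /\<^sub>R h ^ DIM(real) - f x) < e"
    using integrable_ccontinuous_explicit[of f] assms by auto
  have "N \<in> null_sets lebesgue" using N(1) by (simp add: negligible_iff_null_sets)
  then obtain N' where N': "N' \<in> null_sets lborel" "N \<subseteq> N'"
    by (auto simp: null_sets_completion_iff2)
  show ?thesis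
  proof (rule AE_I'[OF N'(1)], rule subsetI, rule ccontr)
    fix x assume x: "x \<in> {x \<in> space lborel. \<not> (\<forall>e>0. \<exists>d>0. \<forall>h. 0 < h \<and> h < d \<longrightarrow> \<bar>integral {x..x + h} f / h - f x\<bar> < e)}"
      and "x \<notin> N'"
    then have "x \<notin> N" using N'(2) by auto
    then have "\<exists>d>0. \<forall>h. 0 < h \<and> h < d \<longrightarrow> \<bar>integral {x..x + h} f / h - f x\<bar> < e" if "0 < e" for e
      using N(2)[OF _ that, of x] by (simp add: divide_inverse mult.commute)
    with x show False by blast
  qed
qed

text \<open>
Lebesgue's differentiation theorem. The left difference quotients come from the right ones of
the reflected function \<open>u \<mapsto> f (- u)\<close>, since reflection preserves null sets.
\<close>

theorem AE_primitive_has_derivative: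
  assumes g: "integrable I01 g"
  shows "AE u in I01. (primitive_of g has_real_derivative g u) (at u)"
proof -
  define f where "f = (\<lambda>u. indicator {0<..<1} u * g u)"
  note HK = primitive_of_Henstock_Kurzweil[OF g, folded f_def]
  have reflect: "integral {x..y} (\<lambda>x. f (- x)) = integral {- y..- x} f"
    "(\<lambda>x. f (- x)) integrable_on {x..y}" for x y
    using Henstock_Kurzweil_Integration.integral_reflect_real[of "- x" "- y" f] HK(1)[of "- y" "- x"]
      Henstock_Kurzweil_Integration.integrable_reflect_real[of f "- x" "- y"]
    by simp_all
  have "AE x in lborel. \<forall>e>0. \<exists>d>0. \<forall>h. 0 < h \<and> h < d \<longrightarrow>
      \<bar>integral {x..x + h} (\<lambda>x. f (- x)) / h - f (- x)\<bar> < e" (is "AE x in lborel. ?P x")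
    by (intro AE_right_difference_quotient reflect)
  then have "AE x in distr lborel borel uminus. ?P x"
    unfolding lborel_distr_uminus .
  then have "AE x in lborel. ?P (- x)"
    by (rule AE_distrD[rotated]) simp
  with AE_right_difference_quotient[OF HK(1)]
  have "AE x in lborel. x \<in> {0<..<1} \<longrightarrow> (primitive_of g has_real_derivative g x) (at x)"
  proof eventually_elim
    case (elim u)
    show ?case
      unfolding DERIV_def LIM_def
    proof (intro impI allI)
      fix e :: real assume u: "u \<in> {0<..<1}" and "0 < e"
      then obtain d1 d2 where d: "0 < d1" "0 < d2"
        "\<And>h. 0 < h \<Longrightarrow> h < d1 \<Longrightarrow> \<bar>integral {u..u + h} f / h - f u\<bar> < e"
        "\<And>h. 0 < h \<Longrightarrow> h < d2 \<Longrightarrow> \<bar>integral {u - h..u} f / h - f u\<bar> < e"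
        using elim[THEN spec, of e] by (auto simp: reflect)
      define d where "d = Min {d1, d2, u, 1 - u}"
      have "\<bar>(primitive_of g (u + h) - primitive_of g u) / h - g u\<bar> < e" if h: "h \<noteq> 0" "\<bar>h\<bar> < d" for h
      proof -
        have bounds: "\<bar>h\<bar> < d1" "\<bar>h\<bar> < d2" "0 \<le> u + h" "u + h \<le> 1" "0 \<le> u" "u \<le> 1"
          using h u by (auto simp: d_def)
        have fu: "f u = g u" using u by (simp add: f_def)
        show ?thesis
        proof (cases "0 < h")
          case True
          have "integral {0..u} f + integral {u..u + h} f = integral {0..u + h} f"
            using bounds True by (intro Henstock_Kurzweil_Integration.integral_combine HK) auto
          then have "primitive_of g (u + h) - primitive_of g u = integral {u..u + h} f"
            using bounds HK(2)[of u] HK(2)[of "u + h"] by simp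
          then show ?thesis using d(3)[OF True] bounds True by (simp add: fu)
        next
          case False
          then have "0 < - h" using h by simp
          have "integral {0..u + h} f + integral {u + h..u} f = integral {0..u} f"
            using bounds False by (intro Henstock_Kurzweil_Integration.integral_combine HK) auto
          then have "primitive_of g (u + h) - primitive_of g u = - integral {u + h..u} f"
            using bounds HK(2)[of u] HK(2)[of "u + h"] by simp
          then show ?thesis using d(4)[OF \<open>0 < - h\<close>] bounds \<open>0 < - h\<close> by (simp add: fu)
        qed
      qed
      moreover have "0 < d" using d u by (simp add: d_def)
      ultimately show "\<exists>s>0. \<forall>h. h \<noteq> 0 \<and> dist h 0 < s \<longrightarrow> dist ((primitive_of g (u + h) - primitive_of g u) / h) (g u) < e"
        by (intro exI[of _ d]) (auto simp: dist_real_def)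
    qed
  qed
  then show ?thesis by (simp add: AE_restrict_space_iff)
qed

lemma AE_eq_0_of_primitive_eq_0:
  assumes "integrable I01 g" "\<And>t. t \<in> {c<..<d} \<Longrightarrow> primitive_of g t = 0"
  shows "AE u in I01. u \<in> {c<..<d} \<longrightarrow> g u = 0"
  using AE_primitive_has_derivative[OF assms(1)]
proof eventually_elim
  case (elim u)
  show ?case
  proof
    assume u: "u \<in> {c<..<d}"
    have "((\<lambda>_. 0) has_real_derivative g u) (at u)"
      using elim u assms(2) by (intro DERIV_cong_ev[THEN iffD1, rotated -1, OF elim])
        (auto simp: eventually_nhds_in_open intro!: eventually_mono[OF eventually_nhds_in_open[of "{c<..<d}" u]])
    then show "g u = 0" using DERIV_const DERIV_unique by blast
  qed
qed

section \<open>The density of an absolutely continuous distortion function\<close>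

lemma right_limit_distortion:
  assumes "\<phi> \<in> distortion_functions" "0 < x" "x < 1"
  shows "right_limit \<phi> x = \<phi> x"
proof -
  have "(\<phi> \<longlongrightarrow> \<phi> x) (at_right x)"
    using assms by (auto simp: distortion_functions_def continuous_within)
  then show ?thesis unfolding right_limit_def by (intro tendsto_Lim) auto
qed

lemma emeasure_stieltjes_distortion_Ioc:
  assumes "\<phi> \<in> distortion_functions" "0 < x" "x \<le> y" "y < 1"
  shows "emeasure (stieltjes \<phi>) {x<..y} = ennreal (\<phi> y - \<phi> x)"
proof -
  have "mono_on {0<..<1} \<phi>"
    using assms(1) by (auto simp: distortion_functions_def intro: mono_on_subset)
  from emeasure_stieltjes_Ioc[OF this assms(2-4)] show ?thesis
    using assms by (simp add: right_limit_distortion)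
qed

text \<open>
The offset \<open>3\<close> keeps every interval nonempty and inside \<open>(0,1)\<close>.
\<close>

lemma open_unit_interval_eq_UN_Ioc:
  "{0<..<1::real} = (\<Union>n. {1 / real (n + 3)<..1 - 1 / real (n + 3)})"
proof (intro equalityI subsetI)
  fix x :: real assume "x \<in> {0<..<1}"
  then have "0 < min x (1 - x)" by simp
  then obtain n where "inverse (real (Suc n)) < min x (1 - x)"
    using reals_Archimedean by blast
  moreover have "1 / real (n + 3) \<le> inverse (real (Suc n))"
    by (simp add: inverse_eq_divide frac_le)
  ultimately have "1 / real (n + 3) < min x (1 - x)" by linarith
  then show "x \<in> (\<Union>n. {1 / real (n + 3)<..1 - 1 / real (n + 3)})"
    by (intro UN_I[of n]) auto
next
  fix x :: real assume "x \<in> (\<Union>n. {1 / real (n + 3)<..1 - 1 / real (n + 3)})"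
  then obtain n where "1 / real (n + 3) < x" "x \<le> 1 - 1 / real (n + 3)" by auto
  moreover have "0 < 1 / real (n + 3)" by simp
  ultimately have "0 < x" "x < 1" by linarith+
  then show "x \<in> {0<..<1}" by simp
qed

text \<open>
As a rewrite rule this is more useful than the equation \<open>sets_stieltjes\<close>, which would expose
\<open>restrict_space\<close> in every membership goal.
\<close>

lemma sets_stieltjes_iff [simp]: "A \<in> sets (stieltjes f) \<longleftrightarrow> A \<in> sets borel \<and> A \<subseteq> {0<..<1}"
  by (auto simp: sets_restrict_space_iff)

declare sets_stieltjes [simp del]

text \<open>
The interval systems over which absolute continuity quantifies.
\<close>

definition short_interval_family :: "real \<Rightarrow> (real \<times> real) set \<Rightarrow> bool" where
  "short_interval_family \<delta> P \<longleftrightarrow> finite P \<and> (\<forall>(a, b)\<in>P. 0 \<le> a \<and> a \<le> b \<and> b \<le> 1) \<and>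
     pairwise (\<lambda>(a, b) (c, d). {a<..<b} \<inter> {c<..<d} = {}) P \<and> (\<Sum>(a, b)\<in>P. b - a) < \<delta>"

lemma absolutely_continuous_01D:
  assumes "absolutely_continuous_01 \<phi>" "0 < \<epsilon>"
  shows "\<exists>\<delta>>0. \<forall>P. short_interval_family \<delta> P \<longrightarrow> (\<Sum>(a, b)\<in>P. \<bar>\<phi> b - \<phi> a\<bar>) < \<epsilon>"
  by (rule assms(1)[unfolded absolutely_continuous_01_def, folded short_interval_family_def, THEN spec, THEN mp, OF assms(2)])

lemma emeasure_stieltjes_distortion_space_le:
  assumes "\<phi> \<in> distortion_functions"
  shows "emeasure (stieltjes \<phi>) {0<..<1} \<le> 1"
proof -
  define A where "A n = {1 / real (n + 3)<..1 - 1 / real (n + 3)}" for n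
  have bounds: "0 < 1 / real (n + 3)" "1 / real (n + 3) \<le> 1 - 1 / real (n + 3)" "1 - 1 / real (n + 3) < 1" for n
    by (auto simp: field_simps)
  have borel_A: "A n \<in> sets borel" for n by (simp add: A_def)
  have sub: "A n \<subseteq> {0<..<1}" for n
    unfolding open_unit_interval_eq_UN_Ioc A_def by blast
  have "incseq A"
  proof (rule incseq_SucI)
    fix n
    have "1 / real (Suc n + 3) \<le> 1 / real (n + 3)" by (simp add: frac_le)
    then show "A n \<le> A (Suc n)" unfolding A_def by (intro subsetI) (auto simp del: of_nat_add of_nat_Suc)
  qed
  then have "emeasure (stieltjes \<phi>) (\<Union>n. A n) = (SUP n. emeasure (stieltjes \<phi>) (A n))"
    using sub by (intro SUP_emeasure_incseq[symmetric]) (auto simp: borel_A)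
  also have "\<dots> \<le> 1"
  proof (rule SUP_least)
    fix n
    have "\<phi> ` {0..1} \<subseteq> {0..1}" using assms by (simp add: distortion_functions_def)
    moreover have "1 / real (n + 3) \<in> {0..1}" "1 - 1 / real (n + 3) \<in> {0..1}"
      using bounds[of n] by auto
    ultimately have "\<phi> (1 - 1 / real (n + 3)) \<le> 1" "0 \<le> \<phi> (1 / real (n + 3))"
      by (meson atLeastAtMost_iff image_subset_iff)+
    then show "emeasure (stieltjes \<phi>) (A n) \<le> 1"
      unfolding A_def using bounds[of n] assms
      by (simp add: emeasure_stieltjes_distortion_Ioc ennreal_le_1 del: of_nat_add)
  qed
  finally show ?thesis unfolding A_def open_unit_interval_eq_UN_Ioc[symmetric] .
qed

text \<open>
A one-element family \<open>(y, x)\<close> with \<open>y\<close> slightly to the left of \<open>x\<close> shows that there are no atoms.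
This is needed because the intervals of a division are closed.
\<close>

lemma emeasure_stieltjes_point_eq_0:
  assumes \<phi>: "\<phi> \<in> distortion_functions" and ac: "absolutely_continuous_01 \<phi>" and x: "0 < x" "x < 1"
  shows "emeasure (stieltjes \<phi>) {x} = 0"
proof -
  have "emeasure (stieltjes \<phi>) {x} \<le> 0 + ennreal e" if "0 < e" for e
  proof -
    obtain \<delta> where \<delta>: "0 < \<delta> \<and> (\<forall>P. short_interval_family \<delta> P \<longrightarrow> (\<Sum>(a, b)\<in>P. \<bar>\<phi> b - \<phi> a\<bar>) < e)"
      using absolutely_continuous_01D[OF ac \<open>0 < e\<close>] ..
    define y where "y = max (x / 2) (x - \<delta> / 2)"
    have y: "0 < y" "y < x" "x - y < \<delta>" using x conjunct1[OF \<delta>] by (auto simp: y_def)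
    have "\<bar>\<phi> x - \<phi> y\<bar> < e" using \<delta>[THEN conjunct2, THEN spec, of "{(y, x)}"] x y by (simp add: short_interval_family_def)
    then have "ennreal (\<phi> x - \<phi> y) \<le> ennreal e" by (intro ennreal_leI) simp
    moreover have "emeasure (stieltjes \<phi>) {x} \<le> emeasure (stieltjes \<phi>) {y<..x}"
      using x y by (intro emeasure_mono) auto
    ultimately show ?thesis
      using emeasure_stieltjes_distortion_Ioc[OF \<phi>, of y x] x y by simp
  qed
  then have "emeasure (stieltjes \<phi>) {x} \<le> 0"
    by (rule ennreal_le_epsilon)
  then show ?thesis by simp
qed

lemma emeasure_stieltjes_distortion_Icc:
  assumes \<phi>: "\<phi> \<in> distortion_functions" and ac: "absolutely_continuous_01 \<phi>"
    and "0 < x" "x \<le> y" "y < 1"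
  shows "emeasure (stieltjes \<phi>) {x..y} \<le> ennreal \<bar>\<phi> y - \<phi> x\<bar>"
proof -
  have "{x..y} = {x} \<union> {x<..y}" using assms by auto
  also have "emeasure (stieltjes \<phi>) ({x} \<union> {x<..y})
      \<le> emeasure (stieltjes \<phi>) {x} + emeasure (stieltjes \<phi>) {x<..y}"
    using assms by (intro emeasure_subadditive) auto
  also have "\<dots> = ennreal (\<phi> y - \<phi> x)"
    using assms by (simp add: emeasure_stieltjes_distortion_Ioc emeasure_stieltjes_point_eq_0)
  also have "\<dots> \<le> ennreal \<bar>\<phi> y - \<phi> x\<bar>" by (intro ennreal_leI) simp
  finally show ?thesis .
qed

text \<open>
A compact set inside an open set \<open>V\<close> is covered by finitely many closed intervals in \<open>V\<close>. Their
union has a division into intervals with disjoint interiors, whose total length is at most the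
measure of \<open>V\<close>. The endpoints of the division form a family to which absolute continuity applies.
\<close>

lemma emeasure_stieltjes_compact_le:
  assumes \<phi>: "\<phi> \<in> distortion_functions" and ac: "absolutely_continuous_01 \<phi>" and "0 < \<epsilon>"
  shows "\<exists>\<delta>>0. \<forall>K V. compact K \<and> open V \<and> K \<subseteq> V \<and> V \<subseteq> {0<..<1} \<and> emeasure lborel V < ennreal \<delta>
     \<longrightarrow> emeasure (stieltjes \<phi>) K \<le> ennreal \<epsilon>"
proof -
  obtain \<delta> where \<delta>: "0 < \<delta> \<and> (\<forall>P. short_interval_family \<delta> P \<longrightarrow> (\<Sum>(a, b)\<in>P. \<bar>\<phi> b - \<phi> a\<bar>) < \<epsilon>)"
      using absolutely_continuous_01D[OF ac \<open>0 < \<epsilon>\<close>] ..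
  have "emeasure (stieltjes \<phi>) K \<le> ennreal \<epsilon>"
    if K: "compact K" and V: "open V" "K \<subseteq> V" "V \<subseteq> {0<..<1}" "emeasure lborel V < ennreal \<delta>" for K V
  proof -
    have "\<exists>e>0. cball x e \<subseteq> V" if "x \<in> V" for x
      using V(1) that by (simp add: open_contains_cball)
    then obtain e where e: "\<And>x. x \<in> V \<Longrightarrow> 0 < e x" "\<And>x. x \<in> V \<Longrightarrow> cball x (e x) \<subseteq> V"
      by metis
    obtain F where F: "F \<subseteq> K" "finite F" "K \<subseteq> (\<Union>x\<in>F. ball x (e x))"
    proof (rule compactE_image[OF K, of K "\<lambda>x. ball x (e x)"])
      show "K \<subseteq> (\<Union>x\<in>K. ball x (e x))"
        using e(1) V(2) by (auto simp: subset_iff intro!: bexI)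
    qed (auto intro: that)
    define W where "W = \<Union>((\<lambda>x. cball x (e x)) ` F)"
    have "W \<subseteq> V" unfolding W_def using F(1) V(2) e(2) by blast
    moreover have "K \<subseteq> W"
      unfolding W_def using F(3) ball_subset_cball by blast
    ultimately have W: "W \<subseteq> V" "K \<subseteq> W" by auto
    obtain D where D: "D division_of W"
    proof (rule elementary_unions_intervals[of "(\<lambda>x. cball x (e x)) ` F"])
      fix S assume "S \<in> (\<lambda>x. cball x (e x)) ` F"
      then obtain x where "S = cball x (e x)" by blast
      then show "\<exists>a b. S = cbox a b" by (auto simp: cball_eq_atLeastAtMost)
    qed (use F(2) that in \<open>auto simp: W_def\<close>)
    define lo hi where "lo k = Inf k" and "hi k = Sup k" for k :: "real set"
    have D_Icc: "k = {lo k..hi k}" "k \<subseteq> V" and bounds: "0 < lo k" "lo k \<le> hi k" "hi k < 1"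
      if kD: "k \<in> D" for k
    proof -
      obtain a b where "k = cbox a b" using division_ofD(4)[OF D kD] by blast
      then have k: "k = {a..b}" "a \<le> b" "k \<subseteq> V"
        using division_ofD(2,3)[OF D kD] W(1) by auto
      then have "lo k = a" "hi k = b" by (simp_all add: lo_def hi_def)
      moreover have "a \<in> V" "b \<in> V" using k by auto
      then have "0 < a" "b < 1" using V(3) by auto
      ultimately show "k = {lo k..hi k}" "k \<subseteq> V" "0 < lo k" "lo k \<le> hi k" "hi k < 1"
        using k by simp_all
    qed
    have int: "interior k = {lo k<..<hi k}" if "k \<in> D" for k
      using interior_atLeastAtMost_real[of "lo k" "hi k"] unfolding D_Icc(1)[OF that, symmetric] .
    define ends where "ends k = (lo k, hi k)" for k
    have inj: "inj_on ends D"
    proof (rule inj_onI)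
      fix k l assume kl: "k \<in> D" "l \<in> D" "ends k = ends l"
      then have "{lo k..hi k} = {lo l..hi l}" by (simp add: ends_def)
      then show "k = l" unfolding D_Icc(1)[OF kl(1), symmetric] D_Icc(1)[OF kl(2), symmetric] .
    qed
    have fin: "finite D" using D by (rule division_of_finite)
    have "(\<Sum>(a, b)\<in>ends ` D. \<bar>\<phi> b - \<phi> a\<bar>) < \<epsilon>"
    proof (rule \<delta>[THEN conjunct2, THEN spec, THEN mp], unfold short_interval_family_def, intro conjI)
      show "finite (ends ` D)" using fin by simp
      show "\<forall>(a, b)\<in>ends ` D. 0 \<le> a \<and> a \<le> b \<and> b \<le> 1"
        using bounds by (auto simp: ends_def less_imp_le)
      show "pairwise (\<lambda>(a, b) (c, d). {a<..<b} \<inter> {c<..<d} = {}) (ends ` D)"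
      proof (rule pairwise_imageI)
        fix k l assume kl: "k \<in> D" "l \<in> D" "k \<noteq> l"
        then have "interior k \<inter> interior l = {}" by (rule division_ofD(5)[OF D])
        then show "(\<lambda>(a, b) (c, d). {a<..<b} \<inter> {c<..<d} = {}) (ends k) (ends l)"
          unfolding int[OF kl(1)] int[OF kl(2)] ends_def by simp
      qed
      have "ennreal (\<Sum>(a, b)\<in>ends ` D. b - a) = (\<Sum>k\<in>D. ennreal (hi k - lo k))"
        unfolding sum.reindex[OF inj] using bounds(2) by (simp add: ends_def sum_ennreal)
      also have "\<dots> = (\<Sum>k\<in>D. emeasure lborel (interior k))"
        using bounds(2) by (intro sum.cong) (simp_all add: int)
      also have "\<dots> = emeasure lborel (\<Union>k\<in>D. interior k)"
        using fin division_ofD(5)[OF D] by (intro sum_emeasure) (auto simp: disjoint_family_on_def)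
      also have "\<dots> \<le> emeasure lborel V"
      proof (rule emeasure_mono)
        show "(\<Union>k\<in>D. interior k) \<subseteq> V" using D_Icc(2) interior_subset by blast
      qed (use V(1) in simp)
      also have "\<dots> < ennreal \<delta>" by (fact V(4))
      finally have lt: "ennreal (\<Sum>(a, b)\<in>ends ` D. b - a) < ennreal \<delta>" .
      show "(\<Sum>(a, b)\<in>ends ` D. b - a) < \<delta>"
        using ennreal_leI[of \<delta> "\<Sum>(a, b)\<in>ends ` D. b - a"] lt by (meson not_le)
    qed
    then have sum: "(\<Sum>k\<in>D. \<bar>\<phi> (hi k) - \<phi> (lo k)\<bar>) < \<epsilon>"
      unfolding sum.reindex[OF inj] by (simp add: ends_def)
    have borel_D: "k \<in> sets (stieltjes \<phi>)" if "k \<in> D" for k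
    proof -
      have "{lo k..hi k} \<subseteq> {0<..<1}" using bounds[OF that] by auto
      then have "{lo k..hi k} \<in> sets (stieltjes \<phi>)" by simp
      then show ?thesis unfolding D_Icc(1)[OF that, symmetric] .
    qed
    have "emeasure (stieltjes \<phi>) K \<le> emeasure (stieltjes \<phi>) (\<Union>k\<in>D. k)"
    proof (rule emeasure_mono)
      show "K \<subseteq> (\<Union>k\<in>D. k)" using W(2) division_ofD(6)[OF D] by simp
      show "(\<Union>k\<in>D. k) \<in> sets (stieltjes \<phi>)"
        by (rule sets.finite_UN[OF fin]) (rule borel_D)
    qed
    also have "\<dots> \<le> (\<Sum>k\<in>D. emeasure (stieltjes \<phi>) k)"
    proof (rule emeasure_subadditive_finite[OF fin])
      show "(\<lambda>k. k) ` D \<subseteq> sets (stieltjes \<phi>)"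
        by (rule image_subsetI) (rule borel_D)
    qed
    also have "\<dots> \<le> (\<Sum>k\<in>D. ennreal \<bar>\<phi> (hi k) - \<phi> (lo k)\<bar>)"
    proof (rule sum_mono)
      fix k assume k: "k \<in> D"
      show "emeasure (stieltjes \<phi>) k \<le> ennreal \<bar>\<phi> (hi k) - \<phi> (lo k)\<bar>"
        using emeasure_stieltjes_distortion_Icc[OF \<phi> ac bounds[OF k]]
        unfolding D_Icc(1)[OF k, symmetric] .
    qed
    also have "\<dots> = ennreal (\<Sum>k\<in>D. \<bar>\<phi> (hi k) - \<phi> (lo k)\<bar>)"
      by (intro sum_ennreal) simp
    also have "\<dots> \<le> ennreal \<epsilon>" using sum by (intro ennreal_leI) simp
    finally show ?thesis .
  qed
  with conjunct1[OF \<delta>] show ?thesis by blast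
qed

text \<open>
The Stieltjes measure is finite, hence inner regular, so a Lebesgue null set only has to be tested
through its compact subsets; outer regularity of Lebesgue measure encloses the null set in open
sets of small measure.
\<close>

lemma absolutely_continuous_stieltjes:
  assumes \<phi>: "\<phi> \<in> distortion_functions" and ac: "absolutely_continuous_01 \<phi>"
  shows "absolutely_continuous I01 (stieltjes \<phi>)"
  unfolding absolutely_continuous_def
proof
  fix A assume "A \<in> null_sets I01"
  then have A: "A \<in> sets borel" "A \<subseteq> {0<..<1}" "emeasure lborel A = 0"
    by (auto simp: null_sets_def sets_restrict_space_iff emeasure_restrict_space)
  define \<nu> where "\<nu> = distr (stieltjes \<phi>) borel (\<lambda>x. x)"
  have id: "(\<lambda>x. x) \<in> stieltjes \<phi> \<rightarrow>\<^sub>M borel"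
    by (auto simp: measurable_def)
  have \<nu>: "emeasure \<nu> B = emeasure (stieltjes \<phi>) B" if "B \<in> sets borel" "B \<subseteq> {0<..<1}" for B
    using that id by (simp add: \<nu>_def emeasure_distr Int_absorb2)
  have "emeasure \<nu> A = (SUP K \<in> {K. K \<subseteq> A \<and> compact K}. emeasure \<nu> K)"
  proof (rule inner_regular)
    have "emeasure \<nu> (space \<nu>) = emeasure (stieltjes \<phi>) {0<..<1}"
      using id by (simp add: \<nu>_def emeasure_distr)
    then show "emeasure \<nu> (space \<nu>) \<noteq> \<infinity>"
      using emeasure_stieltjes_distortion_space_le[OF \<phi>] by (auto simp: top_unique)
  qed (use A in \<open>simp_all add: \<nu>_def\<close>)
  also have "\<dots> \<le> 0"
  proof (rule SUP_least)
    fix K assume "K \<in> {K. K \<subseteq> A \<and> compact K}"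
    then have K: "K \<subseteq> A" "compact K" by auto
    have "emeasure \<nu> K \<le> 0 + ennreal \<epsilon>" if eps: "0 < \<epsilon>" for \<epsilon>
    proof -
      obtain \<delta> where \<delta>: "0 < \<delta>" "\<forall>K V. compact K \<and> open V \<and> K \<subseteq> V \<and> V \<subseteq> {0<..<1} \<and>
          emeasure lborel V < ennreal \<delta> \<longrightarrow> emeasure (stieltjes \<phi>) K \<le> ennreal \<epsilon>"
        using emeasure_stieltjes_compact_le[OF \<phi> ac eps] by blast
      obtain V where V: "open V" "A \<subseteq> V" "emeasure lborel (V - A) < ennreal \<delta>"
        using outer_regular_lborel[OF A(1) \<delta>(1)] by blast
      have "emeasure lborel (V \<inter> {0<..<1}) \<le> emeasure lborel ((V - A) \<union> A)"
        using V A by (intro emeasure_mono) auto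
      also have "\<dots> \<le> emeasure lborel (V - A) + emeasure lborel A"
        using V A by (intro emeasure_subadditive) auto
      also have "\<dots> < ennreal \<delta>" using V A by simp
      finally have "emeasure (stieltjes \<phi>) K \<le> ennreal \<epsilon>"
        using K V A by (intro \<delta>(2)[THEN spec, THEN spec, THEN mp, of K "V \<inter> {0<..<1}"]) auto
      then show ?thesis using K A \<nu>[of K] by (auto simp: borel_compact)
    qed
    then show "emeasure \<nu> K \<le> 0" by (rule ennreal_le_epsilon)
  qed
  finally show "A \<in> null_sets (stieltjes \<phi>)"
    using A \<nu>[of A] by (auto simp: null_sets_def)
qed

lemma sets_stieltjes_eq_sets_I01: "sets (stieltjes f) = sets I01"
  unfolding sets_stieltjes by (rule sets_restrict_space_cong) simp

text \<open>
The Radon-Nikodym theorem gives some density \<open>g\<close>, of which \<open>\<phi>\<close> is a primitive up to a constant.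
Lebesgue's differentiation theorem identifies \<open>g\<close> with \<open>deriv \<phi>\<close> almost everywhere.
\<close>

theorem distortion_density:
  assumes \<phi>: "\<phi> \<in> distortion_functions" and ac: "absolutely_continuous_01 \<phi>"
  shows "AE u in I01. 0 \<le> deriv \<phi> u"
    and "deriv \<phi> \<in> borel_measurable I01 \<Longrightarrow> stieltjes \<phi> = density I01 (\<lambda>u. ennreal (deriv \<phi> u))"
proof -
  interpret finite_measure I01 by (rule finite_measure_I01)
  obtain f where f[measurable]: "f \<in> borel_measurable I01" and dens: "density I01 f = stieltjes \<phi>"
    using Radon_Nikodym[OF absolutely_continuous_stieltjes[OF \<phi> ac] sets_stieltjes_eq_sets_I01] by blast
  have "(\<integral>\<^sup>+u. f u \<partial>I01) = emeasure (density I01 f) (space I01)"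
    by (subst emeasure_density[OF f sets.top]) (auto intro!: nn_integral_cong)
  also have "\<dots> \<le> 1"
    unfolding dens using emeasure_stieltjes_distortion_space_le[OF \<phi>]
    by (simp add: space_restrict_space)
  finally have fin: "(\<integral>\<^sup>+u. f u \<partial>I01) \<noteq> \<infinity>" by (auto simp: top_unique)
  define g where "g u = enn2real (f u)" for u
  have g[measurable]: "g \<in> borel_measurable I01" by (simp add: g_def[abs_def])
  have "AE u in I01. f u \<noteq> \<infinity>" using fin by (rule nn_integral_PInf_AE[OF f])
  then have fg: "AE u in I01. f u = ennreal (g u)"
    by eventually_elim (simp add: g_def less_top)
  have "(\<integral>\<^sup>+u. ennreal (g u) \<partial>I01) = (\<integral>\<^sup>+u. f u \<partial>I01)"
    using fg by (intro nn_integral_cong_AE) auto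
  then have int_g: "integrable I01 g"
    using fin by (intro integrableI_nonneg) (auto simp: g_def less_top)
  have incr: "\<phi> t - \<phi> s = primitive_of g t - primitive_of g s" if st: "0 < s" "s \<le> t" "t < 1" for s t
  proof -
    have int: "integrable I01 (\<lambda>u. indicator {s..<t} u * g u)"
      using int_g by (rule integrable_I01_indicator) simp
    have ne: "AE u in I01. u \<noteq> s \<and> u \<noteq> t"
      using AE_lborel_singleton[of s] AE_lborel_singleton[of t] by (auto simp: AE_restrict_space_iff)
    have "{s<..t} \<in> sets I01" using st by (auto simp: sets_restrict_space_iff)
    then have "emeasure (stieltjes \<phi>) {s<..t} = (\<integral>\<^sup>+u. f u * indicator {s<..t} u \<partial>I01)"
      unfolding dens[symmetric] by (rule emeasure_density[OF f])
    also have "\<dots> = (\<integral>\<^sup>+u. ennreal (indicator {s..<t} u * g u) \<partial>I01)"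
    proof (rule nn_integral_cong_AE)
      show "AE u in I01. f u * indicator {s<..t} u = ennreal (indicator {s..<t} u * g u)"
        using fg ne by eventually_elim (auto simp: indicator_def)
    qed
    also have "\<dots> = ennreal (\<integral>u. indicator {s..<t} u * g u \<partial>I01)"
      using int by (rule nn_integral_eq_integral) (simp add: g_def)
    also have "(\<integral>u. indicator {s..<t} u * g u \<partial>I01) = primitive_of g t - primitive_of g s"
      using st int_g by (simp add: primitive_of_diff)
    finally have eq: "ennreal (\<phi> t - \<phi> s) = ennreal (primitive_of g t - primitive_of g s)"
      using emeasure_stieltjes_distortion_Ioc[OF \<phi> st] by simp
    have "0 \<le> (\<integral>u. indicator {s..<t} u * g u \<partial>I01)"
      by (intro integral_nonneg_AE) (simp add: g_def)
    then have "0 \<le> primitive_of g t - primitive_of g s"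
      using st int_g by (simp add: primitive_of_diff)
    moreover have "0 \<le> \<phi> t - \<phi> s"
      using \<phi> st by (auto simp: distortion_functions_def intro: mono_onD)
    ultimately show ?thesis using eq by simp
  qed
  \<comment> \<open>The constant of integration is read off at an interior point, since the measure determines
    increments inside the open interval only.\<close>
  have \<phi>_eq: "primitive_of g t + (\<phi> (1/2) - primitive_of g (1/2)) = \<phi> t" if "t \<in> {0<..<1}" for t
    using incr[of t "1/2"] incr[of "1/2" t] that by (cases "t \<le> 1/2") auto
  have "AE u in I01. u \<in> {0<..<1}" by (auto simp: AE_restrict_space_iff)
  with AE_primitive_has_derivative[OF int_g] have deriv: "AE u in I01. deriv \<phi> u = g u"
  proof eventually_elim
    case (elim u)
    have "((\<lambda>t. primitive_of g t + (\<phi> (1/2) - primitive_of g (1/2))) has_real_derivative g u + 0) (at u)"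
      by (intro DERIV_add elim DERIV_const)
    then have "(\<phi> has_real_derivative g u) (at u)"
      using elim(2) \<phi>_eq by (auto intro: has_field_derivative_transform_within_open[of _ _ _ "{0<..<1}"])
    then show ?case by (rule DERIV_imp_deriv)
  qed
  then show "AE u in I01. 0 \<le> deriv \<phi> u"
    by eventually_elim (simp add: g_def)
  assume [measurable]: "deriv \<phi> \<in> borel_measurable I01"
  show "stieltjes \<phi> = density I01 (\<lambda>u. ennreal (deriv \<phi> u))"
    unfolding dens[symmetric] using fg deriv
    by (intro density_cong) (auto elim!: eventually_elim2)
qed

section \<open>Integration by parts against a monotone function\<close>

lemma right_limit_mono_on:
  assumes mono: "mono_on {0<..<1} f" and x: "0 < x" "x < 1"
  shows "f x \<le> right_limit f x" "\<And>y. y < 1 \<Longrightarrow> x < y \<Longrightarrow> right_limit f x \<le> f y"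
    "\<And>y. y < 1 \<Longrightarrow> x \<le> y \<Longrightarrow> right_limit f x \<le> right_limit f y"
proof -
  have bdd: "bdd_below (f ` {x<..<1})"
    using assms by (intro bdd_belowI[of _ "f x"]) (auto elim!: mono_onD)
  have ge: "f x \<le> right_limit f x" if "0 < x" "x < 1" for x
    unfolding right_limit_eq_Inf[OF mono that] using that
    by (intro cINF_greatest) (auto intro!: mono_onD[OF mono])
  have le: "right_limit f x \<le> f y" if "x < y" "y < 1" for y
    unfolding right_limit_eq_Inf[OF mono x] using bdd that by (intro cINF_lower) auto
  show "f x \<le> right_limit f x" using x by (rule ge)
  fix y :: real assume "y < 1"
  show "right_limit f x \<le> f y" if "x < y" using that \<open>y < 1\<close> by (rule le)
  show "right_limit f x \<le> right_limit f y" if "x \<le> y"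
    using le[of y] ge[of y] x that \<open>y < 1\<close> by (cases "x = y") auto
qed

text \<open>
A monotone function has countably many discontinuities, so passing to the right-continuous version
seen by the Stieltjes measure changes it on a null set only.
\<close>

lemma AE_right_limit_eq:
  assumes mono: "mono_on {0<..<1} f"
  shows "AE u in I01. right_limit f u = f u"
proof -
  have "countable {x \<in> {0<..<1}. \<not> isCont f x}"
    using mono by (intro mono_on_ctble_discont_open) auto
  then have "AE u in lborel. u \<notin> {x \<in> {0<..<1}. \<not> isCont f x}"
    by (intro AE_not_in countable_imp_null_set_lborel)
  then have "AE u in lborel. u \<in> {0<..<1} \<longrightarrow> right_limit f u = f u"
  proof eventually_elim
    case (elim u)
    then show ?case
      unfolding right_limit_def
      by (auto intro!: tendsto_Lim simp: isCont_def filterlim_at_split)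
  qed
  then show ?thesis by (simp add: AE_restrict_space_iff)
qed

lemma sigma_finite_stieltjes:
  assumes "mono_on {0<..<1} f" shows "sigma_finite_measure (stieltjes f)"
proof
  show "\<exists>A. countable A \<and> A \<subseteq> sets (stieltjes f) \<and> \<Union>A = space (stieltjes f) \<and>
      (\<forall>a\<in>A. emeasure (stieltjes f) a \<noteq> \<infinity>)"
  proof (intro exI conjI)
    let ?A = "range (\<lambda>n. {1 / real (n + 3)<..1 - 1 / real (n + 3)})"
    have bounds: "0 < 1 / real (n + 3)" "1 / real (n + 3) \<le> 1 - 1 / real (n + 3)" "1 - 1 / real (n + 3) < 1" for n
      by (auto simp: field_simps)
    show "countable ?A" by simp
    show "\<Union>?A = space (stieltjes f)"
      using open_unit_interval_eq_UN_Ioc by simp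
    show "?A \<subseteq> sets (stieltjes f)"
    proof
      fix a assume "a \<in> ?A"
      then have "a \<in> sets borel" by auto
      moreover have "a \<subseteq> {0<..<1}"
        unfolding open_unit_interval_eq_UN_Ioc using \<open>a \<in> ?A\<close> by (rule Union_upper)
      ultimately show "a \<in> sets (stieltjes f)" by simp
    qed
    show "\<forall>a\<in>?A. emeasure (stieltjes f) a \<noteq> \<infinity>"
      using emeasure_stieltjes_Ioc[OF assms bounds] by auto
  qed
qed

text \<open>
Fubini's theorem for \<open>z u * k u t\<close>, where the kernel \<open>k u\<close> is the signed indicator of the interval
between \<open>1/2\<close> and \<open>u\<close>. Integrating over \<open>t\<close> gives the increment of \<open>f\<close> between \<open>1/2\<close> and \<open>u\<close>;
integrating over \<open>u\<close> gives \<open>- J z t\<close> on both halves, on the right half because \<open>z\<close> has mean zero.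
The interior anchor \<open>1/2\<close> admits monotone functions that are unbounded at the two ends.
\<close>

theorem integral_primitive_stieltjes:
  assumes mono: "mono_on {0<..<1} f" and z: "integrable I01 z" and zf: "integrable I01 (\<lambda>u. z u * f u)"
    and z0: "primitive_of z 1 = 0"
  shows "integrable (stieltjes f) (primitive_of z)"
    and "(\<integral>t. primitive_of z t \<partial>stieltjes f) = - (\<integral>u. z u * f u \<partial>I01)"
proof -
  let ?\<nu> = "stieltjes f"
  interpret I: finite_measure I01 by (rule finite_measure_I01)
  interpret N: sigma_finite_measure ?\<nu> by (rule sigma_finite_stieltjes[OF mono])
  interpret P: pair_sigma_finite I01 ?\<nu> ..
  have [measurable]: "z \<in> borel_measurable I01" using z by auto
  have id_I[measurable]: "(\<lambda>u. u) \<in> I01 \<rightarrow>\<^sub>M borel" "(\<lambda>u. u) \<in> ?\<nu> \<rightarrow>\<^sub>M borel"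
    by (auto simp: measurable_def sets_restrict_space_iff space_restrict_space)
  define r where "r = right_limit f"
  have r_f: "AE u in I01. r u = f u" unfolding r_def by (rule AE_right_limit_eq[OF mono])
  \<comment> \<open>One of the two indicators is always zero, so the absolute value of k u is again an indicator.\<close>
  define k :: "real \<Rightarrow> real \<Rightarrow> real" where
    "k u t = indicator {1/2<..u} t - indicator {u<..1/2} t" for u t
  have k_meas[measurable]: "(\<lambda>p. k (fst p) (snd p)) \<in> borel_measurable (I01 \<Otimes>\<^sub>M ?\<nu>)"
  proof -
    have "(\<lambda>p. k (fst p) (snd p)) = (\<lambda>p. (if 1/2 < snd p \<and> snd p \<le> fst p then 1 else 0) - (if fst p < snd p \<and> snd p \<le> 1/2 then 1 else 0))"
      by (auto simp: k_def fun_eq_iff indicator_def)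
    also have "\<dots> \<in> borel_measurable (I01 \<Otimes>\<^sub>M ?\<nu>)"
      by measurable
    finally show ?thesis .
  qed
  have Ioc: "has_bochner_integral ?\<nu> (indicator {x<..y}) (r y - r x)" if "0 < x" "x \<le> y" "y < 1" for x y
  proof -
    have le: "0 \<le> r y - r x" unfolding r_def using right_limit_mono_on(3)[OF mono, of x y] that by simp
    have "emeasure ?\<nu> {x<..y} = ennreal (r y - r x)"
      unfolding r_def by (rule emeasure_stieltjes_Ioc[OF mono that])
    moreover from this have "measure ?\<nu> {x<..y} = r y - r x"
      using le by (simp add: measure_def)
    moreover have "has_bochner_integral ?\<nu> (indicator {x<..y}) (measure ?\<nu> {x<..y})"
    proof (rule has_bochner_integral_real_indicator)
      have "{x<..y} \<subseteq> {0<..<1}" using that by auto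
      then show "{x<..y} \<in> sets ?\<nu>" by simp
    qed (simp add: calculation)
    ultimately show ?thesis by simp
  qed
  have k_int: "has_bochner_integral ?\<nu> (k u) (r u - r (1/2))"
    and k_abs: "(\<integral>t. \<bar>k u t\<bar> \<partial>?\<nu>) = \<bar>r u - r (1/2)\<bar>" if u: "u \<in> {0<..<1}" for u
  proof -
    have "has_bochner_integral ?\<nu> (k u) (r u - r (1/2)) \<and>
        has_bochner_integral ?\<nu> (\<lambda>t. \<bar>k u t\<bar>) \<bar>r u - r (1/2)\<bar>"
    proof (cases "1/2 \<le> u")
      case True
      then have "k u = indicator {1/2<..u}" "(\<lambda>t. \<bar>k u t\<bar>) = indicator {1/2<..u}"
        by (auto simp: k_def fun_eq_iff indicator_def)
      then show ?thesis
        using Ioc[of "1/2" u] right_limit_mono_on(3)[OF mono, of "1/2" u] True u by (simp add: r_def)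
    next
      case False
      then have "k u = (\<lambda>t. - indicator {u<..1/2} t)" "(\<lambda>t. \<bar>k u t\<bar>) = indicator {u<..1/2}"
        by (auto simp: k_def fun_eq_iff indicator_def)
      then show ?thesis
        using Ioc[of u "1/2"] has_bochner_integral_minus[OF Ioc[of u "1/2"]]
          right_limit_mono_on(3)[OF mono, of u "1/2"] False u by (simp add: r_def)
    qed
    then show "has_bochner_integral ?\<nu> (k u) (r u - r (1/2))"
      "(\<integral>t. \<bar>k u t\<bar> \<partial>?\<nu>) = \<bar>r u - r (1/2)\<bar>"
      by (auto dest: has_bochner_integral_integral_eq)
  qed
  have zr: "integrable I01 (\<lambda>u. z u * (f u - r (1/2)))"
    using z zf by (simp add: right_diff_distrib)
  have AE01: "AE u in I01. u \<in> {0<..<1}" by (auto simp: AE_restrict_space_iff)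
  have pair: "integrable (I01 \<Otimes>\<^sub>M ?\<nu>) (\<lambda>p. z (fst p) * k (fst p) (snd p))"
  proof (rule P.Fubini_integrable)
    show "(\<lambda>p. z (fst p) * k (fst p) (snd p)) \<in> borel_measurable (I01 \<Otimes>\<^sub>M ?\<nu>)" by measurable
    have eq: "AE u in I01. norm (z u * (f u - r (1/2))) = (\<integral>t. norm (z (fst (u, t)) * k (fst (u, t)) (snd (u, t))) \<partial>?\<nu>)"
      using r_f AE01 by eventually_elim (simp add: abs_mult k_abs)
    show "integrable I01 (\<lambda>u. \<integral>t. norm (z (fst (u, t)) * k (fst (u, t)) (snd (u, t))) \<partial>?\<nu>)"
      using integrable_norm[OF zr] 
    proof (rule integrable_cong_AE_imp)
      show "(\<lambda>u. \<integral>t. norm (z (fst (u, t)) * k (fst (u, t)) (snd (u, t))) \<partial>?\<nu>) \<in> borel_measurable I01"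
        by measurable
    qed (rule eq)
    show "AE u in I01. integrable ?\<nu> (\<lambda>t. z (fst (u, t)) * k (fst (u, t)) (snd (u, t)))"
      using AE01 
    proof eventually_elim
      case (elim u)
      then have "integrable ?\<nu> (k u)" using k_int has_bochner_integral_iff by blast
      then show ?case by simp
    qed
  qed
  have inner: "(\<integral>u. z u * k u t \<partial>I01) = - primitive_of z t" if t: "t \<in> {0<..<1}" for t
  proof (cases "t \<le> 1/2")
    case True
    have "(\<integral>u. z u * k u t \<partial>I01) = (\<integral>u. - (indicator {0<..<t} u * z u) \<partial>I01)"
      using True by (intro Bochner_Integration.integral_cong) (auto simp: k_def indicator_def space_restrict_space)
    then show ?thesis using t by (simp add: primitive_of_eq)
  next
    case False
    have "(\<integral>u. z u * k u t \<partial>I01) = (\<integral>u. indicator {t..<1} u * z u \<partial>I01)"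
      using False by (intro Bochner_Integration.integral_cong) (auto simp: k_def indicator_def space_restrict_space)
    also have "\<dots> = primitive_of z 1 - primitive_of z t" using z t by (simp add: primitive_of_diff)
    finally show ?thesis using z0 by simp
  qed
  have int1: "integrable ?\<nu> (\<lambda>t. \<integral>u. z u * k u t \<partial>I01)"
    using P.integrable_snd[of "\<lambda>u t. z u * k u t"] pair by (simp add: case_prod_unfold)
  moreover have "integrable ?\<nu> (\<lambda>t. - primitive_of z t) \<longleftrightarrow> integrable ?\<nu> (\<lambda>t. \<integral>u. z u * k u t \<partial>I01)"
    by (rule Bochner_Integration.integrable_cong) (simp_all add: inner)
  ultimately have "integrable ?\<nu> (\<lambda>t. - primitive_of z t)" by simp
  then show "integrable ?\<nu> (primitive_of z)" by simp
  have "(\<integral>t. primitive_of z t \<partial>?\<nu>) = - (\<integral>t. (\<integral>u. z u * k u t \<partial>I01) \<partial>?\<nu>)"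
  proof -
    have "(\<integral>t. (\<integral>u. z u * k u t \<partial>I01) \<partial>?\<nu>) = (\<integral>t. - primitive_of z t \<partial>?\<nu>)"
      by (intro Bochner_Integration.integral_cong) (simp_all add: inner)
    then show ?thesis by simp
  qed
  also have "(\<integral>t. (\<integral>u. z u * k u t \<partial>I01) \<partial>?\<nu>) = (\<integral>u. (\<integral>t. z u * k u t \<partial>?\<nu>) \<partial>I01)"
    using P.Fubini_integral[of "\<lambda>u t. z u * k u t"] pair by (simp add: case_prod_unfold)
  also have "\<dots> = (\<integral>u. z u * (f u - r (1/2)) \<partial>I01)"
  proof (rule integral_cong_AE)
    show "(\<lambda>u. z u * (f u - r (1/2))) \<in> borel_measurable I01" using zr by auto
    show "(\<lambda>u. \<integral>t. z u * k u t \<partial>?\<nu>) \<in> borel_measurable I01"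
      using P.integrable_fst[of "\<lambda>u t. z u * k u t"] pair by (auto simp: case_prod_unfold)
    show "AE u in I01. (\<integral>t. z u * k u t \<partial>?\<nu>) = z u * (f u - r (1/2))"
      using r_f AE01 
    proof eventually_elim
      case (elim u)
      then show ?case using has_bochner_integral_integral_eq[OF k_int[of u]] by simp
    qed
  qed
  also have "\<dots> = (\<integral>u. z u * f u \<partial>I01) - (\<integral>u. z u \<partial>I01) * r (1/2)"
    using z zf by (simp add: right_diff_distrib)
  also have "(\<integral>u. z u \<partial>I01) = primitive_of z 1"
    by (simp add: primitive_of_eq) (intro Bochner_Integration.integral_cong, auto simp: space_restrict_space)
  finally show "(\<integral>t. primitive_of z t \<partial>?\<nu>) = - (\<integral>u. z u * f u \<partial>I01)" using z0 by simp
qed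

section \<open>The normal cone of the monotone cone\<close>

lemma rep_add_L2: "AE u in I01. rep_L2 (x + y) u = rep_L2 x u + rep_L2 y u"
  unfolding plus_L2_def map_fun_def comp_def
  by (intro rep_abs_L2 square_integrable_add square_integrable_rep)

lemma rep_scaleR_L2: "AE u in I01. rep_L2 (c *\<^sub>R x) u = c * rep_L2 x u"
  unfolding scaleR_L2_def map_fun_def comp_def id_apply
  by (intro rep_abs_L2 square_integrable_scale square_integrable_rep)

lemma rep_const_L2: "AE u in I01. rep_L2 (L2_const c) u = c"
  unfolding L2_const_def map_fun_def comp_def id_apply
  by (intro rep_abs_L2 square_integrable_const)

lemma integrable_rep_L2: "integrable I01 (rep_L2 z)"
  using square_integrable_mult[OF square_integrable_rep square_integrable_const, of z 1] by simp

lemma integrable_rep_mult_L2: "integrable I01 (\<lambda>u. rep_L2 x u * rep_L2 y u)"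
  by (intro square_integrable_mult square_integrable_rep)

lemma square_integrable_indicator:
  assumes "A \<in> sets borel" shows "square_integrable (indicator A)"
  unfolding square_integrable_def
proof
  have [measurable]: "A \<in> sets borel" by fact
  have id[measurable]: "(\<lambda>u. u) \<in> I01 \<rightarrow>\<^sub>M borel"
    by (auto simp: measurable_def sets_restrict_space_iff space_restrict_space)
  have "(\<lambda>u. indicator A u :: real) \<in> borel_measurable I01"
    using measurable_compose[OF id, of "indicator A" borel] by simp
  then show "(indicator A :: real \<Rightarrow> real) \<in> borel_measurable I01" by simp
  have "integrable I01 (\<lambda>u. indicator A u * 1 :: real)"
    by (intro integrable_I01_indicator assms finite_measure.integrable_const finite_measure_I01)
  moreover have "(\<lambda>u. (indicator A u)\<^sup>2) = (\<lambda>u. indicator A u * 1 :: real)"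
    by (auto simp: fun_eq_iff indicator_def)
  ultimately show "integrable I01 (\<lambda>u. (indicator A u :: real)\<^sup>2)" by simp
qed

definition L2_indicator :: "real set \<Rightarrow> L2" where "L2_indicator A = abs_L2 (indicator A)"

lemma rep_L2_indicator:
  "A \<in> sets borel \<Longrightarrow> AE u in I01. rep_L2 (L2_indicator A) u = indicator A u"
  unfolding L2_indicator_def by (intro rep_abs_L2 square_integrable_indicator)

lemma inner_L2_indicator:
  assumes "A \<in> sets borel"
  shows "inner z (L2_indicator A) = (\<integral>u. indicator A u * rep_L2 z u \<partial>I01)"
  unfolding inner_L2_eq
proof (rule integral_cong_AE)
  show "(\<lambda>u. indicator A u * rep_L2 z u) \<in> borel_measurable I01"
    using integrable_I01_indicator[OF integrable_rep_L2 assms] by auto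
  show "AE u in I01. rep_L2 z u * rep_L2 (L2_indicator A) u = indicator A u * rep_L2 z u"
    using rep_L2_indicator[OF assms] by eventually_elim simp
qed measurable

lemma inner_L2_const: "inner z (L2_const c) = c * (\<integral>u. rep_L2 z u \<partial>I01)"
proof -
  have "inner z (L2_const c) = (\<integral>u. c * rep_L2 z u \<partial>I01)"
    unfolding inner_L2_eq
  proof (rule integral_cong_AE)
    show "AE u in I01. rep_L2 z u * rep_L2 (L2_const c) u = c * rep_L2 z u"
      using rep_const_L2[of c] by eventually_elim simp
  qed measurable
  then show ?thesis by simp
qed

lemma monotone_coneI: "mono_on {0<..<1} f \<Longrightarrow> AE u in I01. rep_L2 q u = f u \<Longrightarrow> q \<in> monotone_cone"
  unfolding monotone_cone_def by blast

lemma mono_rep: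
  assumes "q \<in> monotone_cone"
  shows "mono_on {0<..<1} (mono_rep q)" "AE u in I01. rep_L2 q u = mono_rep q u"
  using someI_ex[of "\<lambda>f. mono_on {0<..<1} f \<and> (AE u in I01. rep_L2 q u = f u)"] assms
  unfolding monotone_cone_def mono_rep_def by auto

lemma monotone_cone_add:
  assumes "x \<in> monotone_cone" "y \<in> monotone_cone" shows "x + y \<in> monotone_cone"
proof (rule monotone_coneI)
  show "mono_on {0<..<1} (\<lambda>u. mono_rep x u + mono_rep y u)"
    using mono_rep(1)[OF assms(1)] mono_rep(1)[OF assms(2)] by (auto intro!: mono_onI add_mono dest: mono_onD)
  show "AE u in I01. rep_L2 (x + y) u = mono_rep x u + mono_rep y u"
    using rep_add_L2[of x y] mono_rep(2)[OF assms(1)] mono_rep(2)[OF assms(2)]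
    by eventually_elim simp
qed

lemma monotone_cone_scale:
  assumes "0 \<le> c" "x \<in> monotone_cone" shows "c *\<^sub>R x \<in> monotone_cone"
proof (rule monotone_coneI)
  show "mono_on {0<..<1} (\<lambda>u. c * mono_rep x u)"
    using mono_rep(1)[OF assms(2)] assms(1) by (auto intro!: mono_onI mult_left_mono dest: mono_onD)
  show "AE u in I01. rep_L2 (c *\<^sub>R x) u = c * mono_rep x u"
    using rep_scaleR_L2[of c x] mono_rep(2)[OF assms(2)] by eventually_elim simp
qed

lemma monotone_cone_const: "L2_const c \<in> monotone_cone"
  by (rule monotone_coneI[OF _ rep_const_L2]) (auto intro: mono_onI)

text \<open>
Adding these step functions to \<open>q\<close> is what forces the primitive of a normal vector to be nonnegative.
\<close>

lemma monotone_cone_indicator: "L2_indicator {t..} \<in> monotone_cone"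
  by (rule monotone_coneI[OF _ rep_L2_indicator]) (auto intro!: mono_onI simp: indicator_def)

lemma primitive_eq_primitive_of: "primitive z = primitive_of (rep_L2 z)"
  by (simp add: fun_eq_iff primitive_def primitive_of_def)

lemma inner_eq_stieltjes_integral:
  assumes h: "h \<in> monotone_cone" and z: "primitive z 1 = 0"
  shows "integrable (stieltjes (mono_rep h)) (primitive z)"
    "inner z h = - (\<integral>t. primitive z t \<partial>stieltjes (mono_rep h))"
proof -
  note m = mono_rep[OF h]
  have "(\<lambda>u. mono_rep h u) \<in> borel_measurable (restrict_space borel {0<..<1})"
    by (rule borel_measurable_mono_on_fnc[OF m(1)])
  then have meas: "mono_rep h \<in> borel_measurable I01"
    by (simp cong: measurable_cong_sets sets_restrict_space_cong)
  have eq: "AE u in I01. rep_L2 z u * rep_L2 h u = rep_L2 z u * mono_rep h u"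
    using m(2) by eventually_elim simp
  have int: "integrable I01 (\<lambda>u. rep_L2 z u * mono_rep h u)"
    by (rule integrable_cong_AE_imp[OF integrable_rep_mult_L2 _ eq]) (use meas in measurable)
  note IBP = integral_primitive_stieltjes[OF m(1) integrable_rep_L2 int, folded primitive_eq_primitive_of, OF z]
  show "integrable (stieltjes (mono_rep h)) (primitive z)" by (rule IBP(1))
  have "inner z h = (\<integral>u. rep_L2 z u * mono_rep h u \<partial>I01)"
    unfolding inner_L2_eq using meas eq by (intro integral_cong_AE) auto
  then show "inner z h = - (\<integral>t. primitive z t \<partial>stieltjes (mono_rep h))"
    using IBP(2) by simp
qed

text \<open>
The cone contains \<open>h + q\<close> for \<open>h \<in> K\<close>, which yields the inequality, and \<open>0\<close>, which yields
orthogonality to \<open>q\<close>.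
\<close>

lemma mem_normal_cone_convex_cone_iff:
  fixes K :: "'a::real_inner set"
  assumes "\<And>x y. x \<in> K \<Longrightarrow> y \<in> K \<Longrightarrow> x + y \<in> K" "\<And>c x. 0 \<le> c \<Longrightarrow> x \<in> K \<Longrightarrow> c *\<^sub>R x \<in> K"
    and q: "q \<in> K"
  shows "z \<in> normal_cone K q \<longleftrightarrow> (\<forall>h\<in>K. inner z h \<le> 0) \<and> inner z q = 0"
proof
  assume z: "z \<in> normal_cone K q"
  have le: "inner z h \<le> 0" if "h \<in> K" for h
    using z assms(1)[OF that q] by (fastforce simp: normal_cone_def)
  moreover have "0 *\<^sub>R q \<in> K" using q by (intro assms(2)) auto
  then have "inner z (0 *\<^sub>R q - q) \<le> 0" using z by (auto simp only: normal_cone_def)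
  then have "0 \<le> inner z q" by simp
  ultimately show "(\<forall>h\<in>K. inner z h \<le> 0) \<and> inner z q = 0" using q by force
qed (simp add: normal_cone_def inner_diff_right)

text \<open>
Testing a normal vector with \<open>1\<close>, \<open>- 1\<close> and step functions gives the conditions on the primitive;
integration by parts turns orthogonality to \<open>q\<close> into the vanishing integral. Conversely, the same
formula shows that a vector with nonnegative primitive has nonpositive inner product with
every element of the cone.
\<close>

theorem normal_cone_monotone_cone:
  assumes q: "q \<in> monotone_cone"
  shows "normal_cone monotone_cone q =
    {z. (\<forall>t\<in>{0..1}. primitive z t \<ge> 0) \<and> primitive z 1 = 0 \<and>
        (\<integral>\<^sup>+t. ennreal (primitive z t) \<partial>stieltjes (mono_rep q)) = 0}"
proof (intro equalityI subsetI)
  note iff = mem_normal_cone_convex_cone_iff[OF monotone_cone_add monotone_cone_scale q]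
  have prim1: "primitive z 1 = (\<integral>u. rep_L2 z u \<partial>I01)" for z
    by (simp add: primitive_eq_primitive_of primitive_of_eq)
      (intro Bochner_Integration.integral_cong, auto simp: space_restrict_space)
  fix z
  {
    assume "z \<in> normal_cone monotone_cone q"
    then have z: "\<And>h. h \<in> monotone_cone \<Longrightarrow> inner z h \<le> 0" "inner z q = 0"
      using iff[of z] by auto
    have p1: "primitive z 1 = 0"
      using z(1)[OF monotone_cone_const[of 1]] z(1)[OF monotone_cone_const[of "- 1"]]
      by (simp add: inner_L2_const prim1)
    have nonneg: "0 \<le> primitive z t" if t: "t \<in> {0..1}" for t
    proof -
      have "(\<integral>u. indicator {t..} u * rep_L2 z u \<partial>I01) \<le> 0"
        using z(1)[OF monotone_cone_indicator[of t]] by (simp add: inner_L2_indicator)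
      also have "(\<integral>u. indicator {t..} u * rep_L2 z u \<partial>I01) = (\<integral>u. indicator {t..<1} u * rep_L2 z u \<partial>I01)"
        by (intro Bochner_Integration.integral_cong) (auto simp: space_restrict_space indicator_def)
      also have "\<dots> = primitive z 1 - primitive z t"
        unfolding primitive_eq_primitive_of using t by (intro primitive_of_diff[symmetric] integrable_rep_L2) auto
      finally show ?thesis using p1 by simp
    qed
    have "(\<integral>\<^sup>+t. ennreal (primitive z t) \<partial>stieltjes (mono_rep q))
        = ennreal (\<integral>t. primitive z t \<partial>stieltjes (mono_rep q))"
      using nonneg by (intro nn_integral_eq_integral inner_eq_stieltjes_integral q p1 AE_I2) simp
    also have "\<dots> = 0"
      using inner_eq_stieltjes_integral(2)[OF q p1] z(2) by simp
    finally show "z \<in> {z. (\<forall>t\<in>{0..1}. primitive z t \<ge> 0) \<and> primitive z 1 = 0 \<and>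
        (\<integral>\<^sup>+t. ennreal (primitive z t) \<partial>stieltjes (mono_rep q)) = 0}"
      using nonneg p1 by simp
  }
  {
    assume "z \<in> {z. (\<forall>t\<in>{0..1}. primitive z t \<ge> 0) \<and> primitive z 1 = 0 \<and>
        (\<integral>\<^sup>+t. ennreal (primitive z t) \<partial>stieltjes (mono_rep q)) = 0}"
    then have nonneg: "\<And>t. t \<in> {0..1} \<Longrightarrow> 0 \<le> primitive z t" and p1: "primitive z 1 = 0"
      and zero: "(\<integral>\<^sup>+t. ennreal (primitive z t) \<partial>stieltjes (mono_rep q)) = 0" by auto
    have int_nonneg: "0 \<le> (\<integral>t. primitive z t \<partial>stieltjes f)" for f
      using nonneg by (intro integral_nonneg_AE AE_I2) simp
    have "(\<integral>\<^sup>+t. ennreal (primitive z t) \<partial>stieltjes (mono_rep q))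
        = ennreal (\<integral>t. primitive z t \<partial>stieltjes (mono_rep q))"
      using nonneg by (intro nn_integral_eq_integral inner_eq_stieltjes_integral q p1 AE_I2) simp
    then have "(\<integral>t. primitive z t \<partial>stieltjes (mono_rep q)) = 0"
      using zero int_nonneg[of "mono_rep q"] by simp
    then have "inner z q = 0"
      using inner_eq_stieltjes_integral(2)[OF q p1] by simp
    moreover have "inner z h \<le> 0" if "h \<in> monotone_cone" for h
      using inner_eq_stieltjes_integral(2)[OF that p1] int_nonneg[of "mono_rep h"] by simp
    ultimately show "z \<in> normal_cone monotone_cone q" using iff[of z] by blast
  }
qed

text \<open>
Almost everywhere properties hold at some point of each interval, as intervals are not null sets.
\<close>

lemma AE_I01_obtain:
  assumes "AE u in I01. P u" "0 \<le> a" "a < b" "b \<le> 1"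
  obtains u where "a < u" "u < b" "P u"
proof (rule ccontr)
  assume "\<not> thesis"
  then have *: "\<And>u. a < u \<Longrightarrow> u < b \<Longrightarrow> \<not> P u" using that by blast
  have "AE u in lborel. u \<in> {0<..<1} \<longrightarrow> P u"
    using assms(1) by (simp add: AE_restrict_space_iff)
  then have "AE u in lborel. \<not> u \<in> {a<..<b}"
    by eventually_elim (use * assms(2-4) in force)
  then have "emeasure lborel {u \<in> space lborel. u \<in> {a<..<b}} = 0"
    by (rule emeasure_eq_0_AE)
  moreover have "{u \<in> space lborel. u \<in> {a<..<b}} = {a<..<b}" by auto
  ultimately show False using assms(3) by (simp del: greaterThanLessThan_iff)
qed

text \<open>
Complementarity: the measure of \<open>q\<close> charges every subinterval, so it would see any point where
the continuous primitive of \<open>z\<close> is positive. Hence the primitive vanishes on the interval, and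
so does its derivative \<open>z\<close>.
\<close>

theorem normal_cone_vanishes_where_strictly_increasing:
  assumes q: "q \<in> monotone_cone" and z: "z \<in> normal_cone monotone_cone q"
    and cd: "0 \<le> c" "d \<le> 1" and strict: "strictly_increasing_on {c<..<d} q"
  shows "AE u in I01. u \<in> {c<..<d} \<longrightarrow> rep_L2 z u = 0"
proof (rule AE_eq_0_of_primitive_eq_0[OF integrable_rep_L2])
  let ?g = "mono_rep q"
  note m = mono_rep[OF q]
  have nonneg: "\<And>t. t \<in> {0..1} \<Longrightarrow> 0 \<le> primitive z t" and p1: "primitive z 1 = 0"
    and zero: "(\<integral>\<^sup>+t. ennreal (primitive z t) \<partial>stieltjes ?g) = 0"
    using z unfolding normal_cone_monotone_cone[OF q] by auto
  have [measurable]: "primitive z \<in> borel_measurable (stieltjes ?g)"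
    using inner_eq_stieltjes_integral(1)[OF q p1] by auto
  have AE0: "AE t in stieltjes ?g. primitive z t \<le> 0"
    using zero by (subst (asm) nn_integral_0_iff_AE) (auto simp: ennreal_eq_0_iff)
  obtain f where f: "strict_mono_on {c<..<d} f" "AE u in I01. u \<in> {c<..<d} \<longrightarrow> rep_L2 q u = f u"
    using strict unfolding strictly_increasing_on_def by auto
  from f(2) m(2) have fg: "AE u in I01. u \<in> {c<..<d} \<longrightarrow> ?g u = f u"
    by eventually_elim auto
  fix t assume t: "t \<in> {c<..<d}"
  show "primitive_of (rep_L2 z) t = 0"
  proof (rule ccontr)
    assume "primitive_of (rep_L2 z) t \<noteq> 0"
    then have pos: "0 < primitive z t"
      using nonneg[of t] t cd by (simp add: primitive_eq_primitive_of)
    have "isCont (primitive z) t"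
      using continuous_on_primitive[OF integrable_rep_L2[of z]] t cd
      by (auto simp: primitive_eq_primitive_of intro: continuous_on_interior)
    then have "\<forall>\<^sub>F s in at t. 0 < primitive z s"
      using pos unfolding isCont_def by (rule order_tendstoD(1))
    then have "\<forall>\<^sub>F s in at_right t. 0 < primitive z s"
      by (rule eventually_at_split[THEN iffD1, THEN conjunct2])
    then obtain b where b: "t < b" "\<And>s. t < s \<Longrightarrow> s < b \<Longrightarrow> 0 < primitive z s"
      unfolding eventually_at_right_field by auto
    \<comment> \<open>The interval from t to t2 lies where the primitive is positive and q increases strictly.\<close>
    define t2 where "t2 = (t + min b d) / 2"
    have t2: "t < t2" "t2 < b" "t2 < d" "t2 < 1" using b t cd by (auto simp: t2_def)
    have "AE s in stieltjes ?g. \<not> s \<in> {t<..t2}"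
      using AE0 by eventually_elim (use b(2) t2 in force)
    then have "emeasure (stieltjes ?g) {s \<in> space (stieltjes ?g). s \<in> {t<..t2}} = 0"
      by (rule emeasure_eq_0_AE)
    moreover have "{s \<in> space (stieltjes ?g). s \<in> {t<..t2}} = {t<..t2}"
      using t t2 cd by auto
    ultimately have "ennreal (right_limit ?g t2 - right_limit ?g t) = 0"
      using emeasure_stieltjes_Ioc[OF m(1), of t t2] t t2 cd by simp
    then have le: "right_limit ?g t2 \<le> right_limit ?g t"
      by (simp add: ennreal_eq_0_iff)
    define mid where "mid = (t + t2) / 2"
    have mid: "t < mid" "mid < t2" using t2 by (auto simp: mid_def)
    obtain u where u: "t < u" "u < mid" "u \<in> {c<..<d} \<longrightarrow> ?g u = f u"
      by (rule AE_I01_obtain[OF fg, of t mid]) (use t t2 cd mid in auto)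
    obtain v where v: "mid < v" "v < t2" "v \<in> {c<..<d} \<longrightarrow> ?g v = f v"
      by (rule AE_I01_obtain[OF fg, of mid t2]) (use t t2 cd mid in auto)
    have "right_limit ?g t \<le> ?g u"
      using t u mid t2 cd by (intro right_limit_mono_on(2)[OF m(1)]) auto
    also have "\<dots> = f u" using u t mid t2 by auto
    also have "\<dots> < f v" using u v t t2 mid by (intro strict_mono_onD[OF f(1)]) auto
    also have "\<dots> = ?g v" using v t mid t2 by auto
    also have "\<dots> \<le> ?g t2" using v t t2 mid cd by (intro mono_onD[OF m(1)]) auto
    also have "\<dots> \<le> right_limit ?g t2" using t t2 cd by (intro right_limit_mono_on(1)[OF m(1)]) auto
    finally show False using le by simp
  qed
qed

section \<open>The Clarke gradient of the distortion functional\<close>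

lemma locally_lipschitz_continuous_on:
  assumes "locally_lipschitz f" shows "continuous_on UNIV f"
proof (rule continuous_at_imp_continuous_on, rule ballI)
  fix x
  obtain r L where "0 < r" "L-lipschitz_on (cball x r) f"
    using assms unfolding locally_lipschitz_def by blast
  then have "continuous_on (cball x r) f" by (auto intro: lipschitz_on_continuous_on)
  moreover have "x \<in> interior (cball x r)" using \<open>0 < r\<close> interior_maximal[OF ball_subset_cball open_ball, of x r] by auto
  ultimately show "isCont f x" by (rule continuous_on_interior)
qed

lemma norm_L2_const: "norm (L2_const c) = \<bar>c\<bar>"
proof -
  have "inner (L2_const c) (L2_const c) = c * c" by transfer (simp add: measure_restrict_space)
  then show ?thesis by (simp add: norm_eq_sqrt_inner)
qed

text \<open>
The pointwise absolute value, needed to phrase the local Lipschitz modulus of the functional inside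
\<open>L2\<close> and estimate it by the Cauchy-Schwarz inequality.
\<close>

definition L2_abs :: "L2 \<Rightarrow> L2" where "L2_abs x = abs_L2 (\<lambda>u. \<bar>rep_L2 x u\<bar>)"

lemma rep_L2_abs: "AE u in I01. rep_L2 (L2_abs x) u = \<bar>rep_L2 x u\<bar>"
  unfolding L2_abs_def using square_integrable_rep[of x]
  by (intro rep_abs_L2) (auto simp: square_integrable_def)

lemma norm_L2_abs: "norm (L2_abs x) = norm x"
proof -
  have "inner (L2_abs x) (L2_abs x) = inner x x"
    unfolding inner_L2_eq using rep_L2_abs[of x] by (intro integral_cong_AE) auto
  then show ?thesis by (simp add: norm_eq_sqrt_inner)
qed

text \<open>
Summable distances make the series of pointwise differences integrable. Its sum \<open>H\<close> serves both
purposes at once: where it is finite the differences tend to zero, and it dominates them all.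
\<close>

lemma L2_fast_convergence_dominated:
  assumes "\<And>n. norm (y n - q) \<le> (1/2)^n"
  obtains H where "integrable I01 H"
    "AE u in I01. (\<forall>n. \<bar>rep_L2 (y n) u - rep_L2 q u\<bar> \<le> H u) \<and> (\<lambda>n. rep_L2 (y n) u) \<longlonglongrightarrow> rep_L2 q u"
proof -
  define D where "D n u = \<bar>rep_L2 (y n) u - rep_L2 q u\<bar>" for n u
  have [measurable]: "D n \<in> borel_measurable I01" for n unfolding D_def by measurable
  define S where "S u = (\<Sum>n. ennreal (D n u))" for u
  have S_meas[measurable]: "S \<in> borel_measurable I01" unfolding S_def by measurable
  have "(\<integral>\<^sup>+u. S u \<partial>I01) = (\<Sum>n. \<integral>\<^sup>+u. ennreal (D n u) \<partial>I01)"
    unfolding S_def by (intro nn_integral_suminf) auto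
  also have "\<dots> \<le> (\<Sum>n. ennreal ((1/2)^n))"
    unfolding D_def using assms by (intro suminf_le nn_integral_L1_diff_L2) auto
  also have "\<dots> = ennreal 2"
    using suminf_geometric[of "1/2 :: real"]
    by (subst suminf_ennreal2) (auto intro: summable_geometric)
  finally have fin: "(\<integral>\<^sup>+u. S u \<partial>I01) \<noteq> \<infinity>" by (auto simp: top_unique)
  then have AE_fin: "AE u in I01. S u \<noteq> \<infinity>" by (intro nn_integral_PInf_AE) auto
  define H where "H u = enn2real (S u)" for u
  have "(\<integral>\<^sup>+u. ennreal (H u) \<partial>I01) = (\<integral>\<^sup>+u. S u \<partial>I01)"
  proof (rule nn_integral_cong_AE)
    show "AE u in I01. ennreal (H u) = S u"
      using AE_fin by eventually_elim (simp add: H_def less_top)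
  qed
  then have "integrable I01 H"
    using fin by (intro integrableI_nonneg) (auto simp: H_def[abs_def] less_top)
  moreover have "AE u in I01. (\<forall>n. D n u \<le> H u) \<and> (\<lambda>n. rep_L2 (y n) u) \<longlonglongrightarrow> rep_L2 q u"
    using AE_fin
  proof eventually_elim
    case (elim u)
    have "D n u \<le> H u" for n
    proof -
      have "ennreal (D n u) \<le> S u"
        unfolding S_def using sum_le_suminf[of "\<lambda>n. ennreal (D n u)" "{n}"] by simp
      also have "\<dots> = ennreal (H u)" using elim by (simp add: H_def less_top)
      finally show ?thesis by (simp add: H_def)
    qed
    moreover have "summable (\<lambda>n. D n u)"
      using elim unfolding S_def by (intro summable_suminf_not_top) (auto simp: D_def)
    then have "(\<lambda>n. D n u) \<longlonglongrightarrow> 0" by (rule summable_LIMSEQ_zero)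
    then have "(\<lambda>n. rep_L2 (y n) u - rep_L2 q u) \<longlonglongrightarrow> 0"
      unfolding D_def by (rule tendsto_rabs_zero_cancel)
    then have "(\<lambda>n. rep_L2 (y n) u) \<longlonglongrightarrow> rep_L2 q u" by (simp add: LIM_zero_iff)
    ultimately show ?case by blast
  qed
  ultimately show ?thesis by (intro that[of H]) (simp_all add: D_def)
qed

text \<open>
Take for \<open>A\<close> the set where the inequality fails.
\<close>

lemma AE_le_of_set_integrals_le:
  fixes f g :: "real \<Rightarrow> real"
  assumes f: "integrable I01 f" and g: "integrable I01 g"
    and le: "\<And>A. A \<in> sets borel \<Longrightarrow> (\<integral>u. indicator A u * f u \<partial>I01) \<le> (\<integral>u. indicator A u * g u \<partial>I01)"
  shows "AE u in I01. f u \<le> g u"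
proof -
  have [measurable]: "f \<in> borel_measurable I01" "g \<in> borel_measurable I01" using f g by auto
  define A where "A = {u \<in> space I01. g u < f u}"
  have "A \<in> sets I01" unfolding A_def by measurable
  then have A: "A \<in> sets borel" by (auto simp: sets_restrict_space_iff)
  have int: "integrable I01 (\<lambda>u. indicator A u * f u - indicator A u * g u)"
    using f g A by (intro Bochner_Integration.integrable_diff integrable_I01_indicator)
  have nonneg: "AE u in I01. 0 \<le> indicator A u * f u - indicator A u * g u"
    by (intro AE_I2) (auto simp: A_def indicator_def)
  have "(\<integral>u. indicator A u * f u - indicator A u * g u \<partial>I01) \<le> 0"
    using le[OF A] f g A by (simp add: integrable_I01_indicator)
  then have "(\<integral>u. indicator A u * f u - indicator A u * g u \<partial>I01) = 0"
    using integral_nonneg_AE[OF nonneg] by simp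
  then have "AE u in I01. indicator A u * f u - indicator A u * g u = 0"
    using integral_nonneg_eq_0_iff_AE[OF int nonneg] by simp
  moreover have "AE u in I01. u \<in> space I01" by (rule AE_space)
  ultimately show ?thesis
    by eventually_elim (auto simp: A_def indicator_def split: if_splits)
qed

text \<open>
The growth hypothesis is on the upper end of the Clarke gradient, which for monotone \<open>U\<close> is its
element of largest absolute value.
\<close>

locale distortion_functional =
  fixes \<phi> U :: "real \<Rightarrow> real" and a b :: real
  assumes \<phi>: "\<phi> \<in> distortion_functions" and ac: "absolutely_continuous_01 \<phi>"
    and bdd: "deriv \<phi> \<in> L_infinity"
    and U_mono: "mono U" and U_lip: "locally_lipschitz U"
    and ab: "0 \<le> a" "0 \<le> b" and growth: "\<And>x. clarke_deriv U x 1 \<le> a + b * \<bar>x\<bar>"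
begin

abbreviation "w \<equiv> deriv \<phi>"

lemma w_meas[measurable]: "w \<in> borel_measurable I01"
  using bdd by (simp add: L_infinity_def)

lemma U_meas[measurable]: "U \<in> borel_measurable borel"
  using locally_lipschitz_continuous_on[OF U_lip] by (rule borel_measurable_continuous_onI)

lemma w_nonneg: "AE u in I01. 0 \<le> w u"
  by (rule distortion_density(1)[OF \<phi> ac])

text \<open>
An essential bound of the density, chosen once so that later estimates can refer to it.
\<close>

definition W where "W = (SOME W. 0 \<le> W \<and> (AE u in I01. \<bar>w u\<bar> \<le> W))"

lemma W_bounds: "0 \<le> W" "AE u in I01. \<bar>w u\<bar> \<le> W"
proof -
  obtain C' where "AE u in I01. \<bar>w u\<bar> \<le> C'" using bdd by (auto simp: L_infinity_def)
  then have "AE u in I01. \<bar>w u\<bar> \<le> max 0 C'" by eventually_elim simp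
  then have "\<exists>W. 0 \<le> W \<and> (AE u in I01. \<bar>w u\<bar> \<le> W)" by (intro exI[of _ "max 0 C'"]) simp
  from someI_ex[OF this] show "0 \<le> W" "AE u in I01. \<bar>w u\<bar> \<le> W" by (simp_all add: W_def)
qed

lemma U_diff: "\<bar>U y - U x\<bar> \<le> (a + b * (\<bar>x\<bar> + \<bar>y\<bar>)) * \<bar>y - x\<bar>"
  by (rule mono_diff_le_of_clarke_growth[OF U_lip U_mono ab(2) growth])

text \<open>
Dominates the difference quotient of \<open>U\<close> between the values of \<open>x\<close> and \<open>y\<close>.
\<close>

definition modulus :: "L2 \<Rightarrow> L2 \<Rightarrow> L2" where
  "modulus x y = L2_const a + b *\<^sub>R (L2_abs x + L2_abs y)"

lemma rep_modulus:
  "AE u in I01. rep_L2 (modulus x y) u = a + b * (\<bar>rep_L2 x u\<bar> + \<bar>rep_L2 y u\<bar>)"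
  using rep_add_L2[of "L2_const a" "b *\<^sub>R (L2_abs x + L2_abs y)"] rep_const_L2[of a]
    rep_scaleR_L2[of b "L2_abs x + L2_abs y"] rep_add_L2[of "L2_abs x" "L2_abs y"]
    rep_L2_abs[of x] rep_L2_abs[of y]
  unfolding modulus_def by eventually_elim simp

lemma norm_modulus: "norm (modulus x y) \<le> a + b * (norm x + norm y)"
proof -
  have "norm (modulus x y) \<le> norm (L2_const a) + norm (b *\<^sub>R (L2_abs x + L2_abs y))"
    unfolding modulus_def by (rule norm_triangle_ineq)
  also have "\<dots> \<le> a + b * (norm x + norm y)"
    using ab norm_triangle_ineq[of "L2_abs x" "L2_abs y"]
    by (auto simp: norm_L2_const norm_L2_abs intro!: mult_left_mono)
  finally show ?thesis .
qed

lemma U_rep_diff_bound: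
  "AE u in I01. \<bar>w u * (U (rep_L2 x u) - U (rep_L2 y u))\<bar>
     \<le> W * (rep_L2 (modulus y x) u * rep_L2 (L2_abs (x - y)) u)"
  using W_bounds(2) rep_modulus[of y x] rep_L2_abs[of "x - y"] rep_diff_L2[of x y]
proof eventually_elim
  case (elim u)
  have "\<bar>w u\<bar> * \<bar>U (rep_L2 x u) - U (rep_L2 y u)\<bar>
      \<le> W * ((a + b * (\<bar>rep_L2 y u\<bar> + \<bar>rep_L2 x u\<bar>)) * \<bar>rep_L2 x u - rep_L2 y u\<bar>)"
    using elim(1) W_bounds(1) by (intro mult_mono U_diff) auto
  then show ?case using elim by (simp add: abs_mult)
qed

lemma integrable_U_rep: "integrable I01 (\<lambda>u. w u * U (rep_L2 x u))"
proof -
  have "integrable I01 (\<lambda>u. w u * (U (rep_L2 x u) - U (rep_L2 0 u)))"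
    by (rule Bochner_Integration.integrable_bound[OF integrable_mult_right[OF
          integrable_rep_mult_L2[of "modulus 0 x" "L2_abs (x - 0)"], of W]])
      (use U_rep_diff_bound[of x 0] in \<open>auto elim!: eventually_mono\<close>)
  moreover have "integrable I01 (\<lambda>u. w u * U (rep_L2 0 u))"
  proof (rule Bochner_Integration.integrable_bound[of _ "\<lambda>_. W * \<bar>U 0\<bar>"])
    have "AE u in I01. rep_L2 0 u = 0"
      using rep_scaleR_L2[of 0 0] by simp
    with W_bounds(2) show "AE u in I01. norm (w u * U (rep_L2 0 u)) \<le> norm (W * \<bar>U 0\<bar>)"
      by eventually_elim (use W_bounds(1) in \<open>auto simp: abs_mult intro!: mult_right_mono\<close>)
  qed (auto intro: finite_measure.integrable_const finite_measure_I01)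
  ultimately have "integrable I01 (\<lambda>u. w u * (U (rep_L2 x u) - U (rep_L2 0 u)) + w u * U (rep_L2 0 u))"
    by (rule Bochner_Integration.integrable_add)
  then show ?thesis by (simp add: algebra_simps)
qed

lemma Psi_eq: "Psi \<phi> U x = (\<integral>u. w u * U (rep_L2 x u) \<partial>I01)"
  unfolding Psi_def distortion_density(2)[OF \<phi> ac w_meas]
  by (rule integral_real_density[OF w_meas w_nonneg]) measurable

lemma Psi_diff_eq: "Psi \<phi> U x - Psi \<phi> U y = (\<integral>u. w u * (U (rep_L2 x u) - U (rep_L2 y u)) \<partial>I01)"
  by (simp add: Psi_eq integrable_U_rep right_diff_distrib)

lemma Psi_diff_le: "\<bar>Psi \<phi> U x - Psi \<phi> U y\<bar> \<le> W * (a + b * (norm y + norm x)) * norm (x - y)"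
proof -
  have "\<bar>Psi \<phi> U x - Psi \<phi> U y\<bar> \<le> (\<integral>u. W * (rep_L2 (modulus y x) u * rep_L2 (L2_abs (x - y)) u) \<partial>I01)"
  proof -
    have int: "integrable I01 (\<lambda>u. w u * (U (rep_L2 x u) - U (rep_L2 y u)))"
      using integrable_U_rep[of x] integrable_U_rep[of y] by (simp add: right_diff_distrib)
    have "\<bar>Psi \<phi> U x - Psi \<phi> U y\<bar> \<le> (\<integral>u. \<bar>w u * (U (rep_L2 x u) - U (rep_L2 y u))\<bar> \<partial>I01)"
      unfolding Psi_diff_eq by (rule integral_abs_bound)
    also have "\<dots> \<le> (\<integral>u. W * (rep_L2 (modulus y x) u * rep_L2 (L2_abs (x - y)) u) \<partial>I01)"
      using int U_rep_diff_bound[of x y]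
      by (intro integral_mono_AE integrable_abs integrable_mult_right integrable_rep_mult_L2)
    finally show ?thesis .
  qed
  also have "\<dots> = W * inner (modulus y x) (L2_abs (x - y))"
    by (simp add: inner_L2_eq)
  also have "\<dots> \<le> W * (norm (modulus y x) * norm (L2_abs (x - y)))"
    using W_bounds(1) norm_cauchy_schwarz by (intro mult_left_mono)
  also have "\<dots> \<le> W * ((a + b * (norm y + norm x)) * norm (x - y))"
    unfolding norm_L2_abs using W_bounds(1) norm_modulus by (intro mult_left_mono mult_right_mono) auto
  finally show ?thesis by (simp add: mult.assoc)
qed

lemma Psi_lipschitz:
  "(W * (a + b * (2 * (norm q + 1))))-lipschitz_on (cball q 1) (Psi \<phi> U)"
proof (rule lipschitz_onI)
  fix x y assume "x \<in> cball q 1" "y \<in> cball q 1"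
  then have "norm x \<le> norm q + 1" "norm y \<le> norm q + 1"
    using norm_triangle_ineq3[of x q] norm_triangle_ineq3[of y q]
    by (auto simp: dist_norm norm_minus_commute)
  then have "W * (a + b * (norm y + norm x)) * norm (x - y) \<le> W * (a + b * (2 * (norm q + 1))) * norm (x - y)"
    using W_bounds(1) ab by (intro mult_left_mono mult_right_mono add_left_mono) auto
  then show "dist (Psi \<phi> U x) (Psi \<phi> U y) \<le> W * (a + b * (2 * (norm q + 1))) * dist x y"
    using Psi_diff_le[of x y] by (simp add: dist_norm)
qed (use W_bounds(1) ab in simp)

lemma clarke_deriv_U_bound:
  assumes "\<bar>e\<bar> = 1" shows "\<bar>clarke_deriv U x e\<bar> \<le> a + b * \<bar>x\<bar>"
  using assms growth[of x] clarke_deriv_real_nonempty[OF U_lip, of x] clarke_deriv_mono_nonneg[OF U_lip U_mono, of x]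
  by (cases "e = 1") (auto simp: abs_if split: if_splits)

lemma clarke_deriv_U_rep_meas[measurable]: "(\<lambda>u. clarke_deriv U (rep_L2 q u) e) \<in> borel_measurable I01"
  using borel_measurable_clarke_deriv[OF U_lip, of e] rep_L2_measurable
  by (rule measurable_compose[rotated])

lemma integrable_w_clarke_deriv:
  assumes "\<bar>e\<bar> = 1" shows "integrable I01 (\<lambda>u. w u * clarke_deriv U (rep_L2 q u) e)"
proof (rule Bochner_Integration.integrable_bound)
  show "integrable I01 (\<lambda>u. W * (a + b * \<bar>rep_L2 q u\<bar>))"
    by (intro integrable_mult_right Bochner_Integration.integrable_add integrable_abs integrable_rep_L2
        finite_measure.integrable_const finite_measure_I01)
  show "AE u in I01. norm (w u * clarke_deriv U (rep_L2 q u) e) \<le> norm (W * (a + b * \<bar>rep_L2 q u\<bar>))"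
    using W_bounds(2)
  proof eventually_elim
    case (elim u)
    have "\<bar>w u\<bar> * \<bar>clarke_deriv U (rep_L2 q u) e\<bar> \<le> W * (a + b * \<bar>rep_L2 q u\<bar>)"
      using elim W_bounds(1) by (intro mult_mono clarke_deriv_U_bound assms) auto
    then show ?case using W_bounds(1) ab by (simp add: abs_mult)
  qed
qed measurable

text \<open>
If the inequality failed, there would be base points \<open>y n\<close> and steps \<open>t n\<close>, converging as fast as
\<open>(1/2)^n\<close>, with difference quotients above \<open>c\<close>. The quotients are integrals of functions \<open>Q n\<close> that
have a common integrable bound \<open>G\<close> and, by upper semicontinuity of the Clarke derivative, upper
limit at most the integrand \<open>v\<close>. Fatou's lemma for \<open>G - Q n\<close> then contradicts the choice of \<open>c\<close>.
\<close>

lemma clarke_dd_Psi_indicator_le: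
  assumes e: "\<bar>e\<bar> = 1" and A: "A \<in> sets borel"
    and c: "(\<integral>u. indicator A u * (w u * clarke_deriv U (rep_L2 q u) e) \<partial>I01) < c"
  shows "clarke_dd (Psi \<phi> U) q (e *\<^sub>R L2_indicator A) \<le> ereal c"
proof (rule clarke_dd_le, rule ccontr)
  define h where "h = e *\<^sub>R L2_indicator A"
  define D where "D u = clarke_deriv U (rep_L2 q u) e" for u
  define v where "v u = indicator A u * (w u * D u)" for u
  assume "\<not> (\<forall>\<^sub>F (y, t) in nhds q \<times>\<^sub>F at_right 0.
      (Psi \<phi> U (y + t *\<^sub>R e *\<^sub>R L2_indicator A) - Psi \<phi> U y) / t \<le> c)"
  then have not_ev: "\<not> (\<forall>\<^sub>F (y, t) in nhds q \<times>\<^sub>F at_right 0. (Psi \<phi> U (y + t *\<^sub>R h) - Psi \<phi> U y) / t \<le> c)"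
    by (simp add: h_def)
  have "\<exists>p. norm (fst p - q) \<le> (1/2)^n \<and> 0 < snd p \<and> snd p < (1/2)^n \<and>
      c < (Psi \<phi> U (fst p + snd p *\<^sub>R h) - Psi \<phi> U (fst p)) / snd p" for n
  proof (rule ccontr)
    assume *: "\<not> ?thesis"
    have "\<forall>\<^sub>F y in nhds q. norm (y - q) \<le> (1/2)^n"
      unfolding eventually_nhds_metric by (intro exI[of _ "(1/2)^n"]) (auto simp: dist_norm)
    moreover have "\<forall>\<^sub>F t in at_right (0::real). 0 < t \<and> t < (1/2)^n"
      by (rule eventually_at_rightI[of 0 "(1/2)^n"]) auto
    ultimately have "\<forall>\<^sub>F p in nhds q \<times>\<^sub>F at_right (0::real). norm (fst p - q) \<le> (1/2)^n \<and> 0 < snd p \<and> snd p < (1/2)^n"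
      unfolding eventually_prod_filter
      by (intro exI[of _ "\<lambda>y. norm (y - q) \<le> (1/2)^n"] exI[of _ "\<lambda>t::real. 0 < t \<and> t < (1/2)^n"]) simp
    then have "\<forall>\<^sub>F p in nhds q \<times>\<^sub>F at_right 0.
        (Psi \<phi> U (fst p + snd p *\<^sub>R h) - Psi \<phi> U (fst p)) / snd p \<le> c"
    proof eventually_elim
      case (elim p)
      show ?case
      proof (rule ccontr)
        assume "\<not> ?case"
        with elim have "norm (fst p - q) \<le> (1/2)^n \<and> 0 < snd p \<and> snd p < (1/2)^n \<and>
            c < (Psi \<phi> U (fst p + snd p *\<^sub>R h) - Psi \<phi> U (fst p)) / snd p" by simp
        with * show False by blast
      qed
    qed
    with not_ev show False by (simp add: case_prod_unfold)
  qed
  then have "\<forall>n. \<exists>p. norm (fst p - q) \<le> (1/2)^n \<and> 0 < snd p \<and> snd p < (1/2)^n \<and>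
      c < (Psi \<phi> U (fst p + snd p *\<^sub>R h) - Psi \<phi> U (fst p)) / snd p" by (rule allI)
  from choice[OF this] obtain p where p: "\<forall>n. norm (fst (p n) - q) \<le> (1/2)^n \<and> 0 < snd (p n) \<and> snd (p n) < (1/2)^n \<and>
      c < (Psi \<phi> U (fst (p n) + snd (p n) *\<^sub>R h) - Psi \<phi> U (fst (p n))) / snd (p n)" ..
  define y t where "y n = fst (p n)" and "t n = snd (p n)" for n
  note p = p[folded y_def t_def, rule_format]
  have y: "norm (y n - q) \<le> (1/2)^n" and t: "0 < t n" "t n < (1/2)^n"
    and big: "c < (Psi \<phi> U (y n + t n *\<^sub>R h) - Psi \<phi> U (y n)) / t n" for n
    using p[of n] by simp_all
  have t_le1: "t n \<le> 1" for n
    using t(2)[of n] power_le_one[of "1/2::real" n] by linarith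
  have t_lim: "t \<longlonglongrightarrow> 0"
  proof (rule tendsto_sandwich[of "\<lambda>_. 0" _ _ "\<lambda>n. (1/2)^n"])
    show "(\<lambda>n. (1/2::real)^n) \<longlonglongrightarrow> 0" by (rule LIMSEQ_power_zero) simp
  qed (use t in \<open>auto intro!: always_eventually less_imp_le\<close>)
  obtain H where H: "integrable I01 H"
    "AE u in I01. (\<forall>n. \<bar>rep_L2 (y n) u - rep_L2 q u\<bar> \<le> H u) \<and> (\<lambda>n. rep_L2 (y n) u) \<longlonglongrightarrow> rep_L2 q u"
    using L2_fast_convergence_dominated[OF y] by blast
  define Q where "Q n u = w u * ((U (rep_L2 (y n) u + t n * (e * indicator A u)) - U (rep_L2 (y n) u)) / t n)" for n u
  \<comment> \<open>The steps t n are at most 1, which accounts for the summand 1.\<close>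
  define G where "G u = W * (a + b * (2 * (\<bar>rep_L2 q u\<bar> + H u) + 1))" for u
  have G: "integrable I01 G"
    unfolding G_def
    by (intro integrable_mult_right Bochner_Integration.integrable_add integrable_abs integrable_rep_L2 H(1)
        finite_measure.integrable_const finite_measure_I01)
  have v: "integrable I01 v"
    unfolding v_def D_def by (intro integrable_I01_indicator A integrable_w_clarke_deriv e)
  have rep: "AE u in I01. rep_L2 (y n + t n *\<^sub>R h) u = rep_L2 (y n) u + t n * (e * indicator A u)" for n
    using rep_add_L2[of "y n" "t n *\<^sub>R h"] rep_scaleR_L2[of "t n" h]
      rep_scaleR_L2[of e "L2_indicator A"] rep_L2_indicator[OF A]
    unfolding h_def by eventually_elim simp
  have Q_rep: "AE u in I01. w u * (U (rep_L2 (y n + t n *\<^sub>R h) u) - U (rep_L2 (y n) u)) / t n = Q n u" for n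
    using rep[of n] by eventually_elim (simp add: Q_def)
  have "(\<lambda>u. indicator A u :: real) \<in> borel_measurable I01"
    using square_integrable_indicator[OF A] by (simp add: square_integrable_def)
  then have Q_meas[measurable]: "Q n \<in> borel_measurable I01" for n
    unfolding Q_def by measurable
  have "integrable I01 (\<lambda>u. w u * (U (rep_L2 (y n + t n *\<^sub>R h) u) - U (rep_L2 (y n) u)) / t n)" for n
    using integrable_U_rep[of "y n + t n *\<^sub>R h"] integrable_U_rep[of "y n"] by (simp add: right_diff_distrib)
  then have Q: "integrable I01 (Q n)" for n
    by (rule integrable_cong_AE_imp[OF _ Q_meas Q_rep])
  have Q_big: "c < (\<integral>u. Q n u \<partial>I01)" for n
  proof -
    have "(\<integral>u. Q n u \<partial>I01) = (\<integral>u. w u * (U (rep_L2 (y n + t n *\<^sub>R h) u) - U (rep_L2 (y n) u)) / t n \<partial>I01)"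
      using Q_rep[of n] by (intro integral_cong_AE) auto
    also have "\<dots> = (Psi \<phi> U (y n + t n *\<^sub>R h) - Psi \<phi> U (y n)) / t n"
      by (simp add: Psi_diff_eq)
    finally show ?thesis using big by simp
  qed
  have pointwise: "AE u in I01. (\<forall>n. \<bar>Q n u\<bar> \<le> G u) \<and> \<bar>v u\<bar> \<le> G u \<and>
      ennreal (G u - v u) \<le> liminf (\<lambda>n. ennreal (G u - Q n u))"
    using H(2) W_bounds(2) w_nonneg
  proof eventually_elim
    case (elim u)
    have H_nonneg: "0 \<le> H u" using elim(1) abs_ge_zero order_trans by blast
    have y_le: "\<bar>rep_L2 (y n) u\<bar> \<le> \<bar>rep_L2 q u\<bar> + H u" for n
      using spec[OF conjunct1[OF elim(1)], of n] by linarith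
    have ind: "\<bar>e * indicator A u\<bar> \<le> 1" using e by (auto simp: indicator_def)
    have Q_le: "\<bar>Q n u\<bar> \<le> G u" for n
    proof -
      let ?x = "rep_L2 (y n) u" and ?d = "t n * (e * indicator A u)"
      have d: "\<bar>?d\<bar> \<le> t n"
        using ind t(1)[of n] by (simp add: abs_mult mult_left_le)
      have "\<bar>U (?x + ?d) - U ?x\<bar> \<le> (a + b * (\<bar>?x\<bar> + \<bar>?x + ?d\<bar>)) * \<bar>?d\<bar>"
        using U_diff[of "?x + ?d" ?x] by simp
      also have "\<dots> \<le> (a + b * (2 * (\<bar>rep_L2 q u\<bar> + H u) + 1)) * t n"
      proof (intro mult_mono add_left_mono mult_left_mono)
        show "\<bar>?x\<bar> + \<bar>?x + ?d\<bar> \<le> 2 * (\<bar>rep_L2 q u\<bar> + H u) + 1"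
        proof -
          have arith: "X + Z \<le> 2 * R + 1" if "X \<le> R" "Y \<le> T" "T \<le> 1" "Z \<le> X + Y" for X Y Z R T :: real
            using that by linarith
          show ?thesis by (rule arith[OF y_le d t_le1 abs_triangle_ineq])
        qed
      qed (use ab d H_nonneg in auto)
      finally have "\<bar>(U (?x + ?d) - U ?x) / t n\<bar> \<le> a + b * (2 * (\<bar>rep_L2 q u\<bar> + H u) + 1)"
        using t(1)[of n] by (simp add: abs_divide pos_divide_le_eq)
      then show ?thesis
        unfolding Q_def G_def abs_mult using elim W_bounds(1) by (intro mult_mono) auto
    qed
    have v_le: "\<bar>v u\<bar> \<le> G u"
    proof -
      have "\<bar>D u\<bar> \<le> a + b * (2 * (\<bar>rep_L2 q u\<bar> + H u) + 1)"
      proof -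
        have "b * \<bar>rep_L2 q u\<bar> \<le> b * (2 * (\<bar>rep_L2 q u\<bar> + H u) + 1)"
          using ab H_nonneg by (intro mult_left_mono) auto
        then show ?thesis using clarke_deriv_U_bound[OF e, of "rep_L2 q u"] by (simp add: D_def)
      qed
      then have "\<bar>w u * D u\<bar> \<le> G u"
        unfolding G_def abs_mult using elim W_bounds(1) by (intro mult_mono) auto
      then show ?thesis by (auto simp: v_def indicator_def)
    qed
    \<comment> \<open>Off A and where the density vanishes, Q n u and v u are both zero; division by the density
      is only needed in the remaining case.\<close>
    have Q_lim: "\<forall>\<^sub>F n in sequentially. Q n u < c'" if "v u < c'" for c'
    proof (cases "u \<in> A \<and> 0 < w u")
      case False
      then have "Q n u = v u" for n using elim by (auto simp: Q_def v_def)
      then show ?thesis using that by simp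
    next
      case True
      then have "clarke_dd U (rep_L2 q u) e < ereal (c' / w u)"
        using that by (simp add: v_def D_def pos_less_divide_eq mult.commute
            flip: locally_lipschitz_ereal_clarke_deriv[OF U_lip])
      from clarke_quotient_less_sequentially[OF this _ t_lim t(1), of "\<lambda>n. rep_L2 (y n) u"] elim(1)
      show ?thesis
        using True by (auto elim!: eventually_mono simp: Q_def pos_less_divide_eq mult.commute)
    qed
    have "ennreal (G u - v u) \<le> liminf (\<lambda>n. ennreal (G u - Q n u))"
      unfolding le_Liminf_iff
    proof (intro allI impI)
      fix z assume z: "z < ennreal (G u - v u)"
      then obtain r where r: "z = ennreal r" "0 \<le> r" by (cases z) auto
      then have "r < G u - v u" using z by (simp add: ennreal_less_iff)
      then have "\<forall>\<^sub>F n in sequentially. Q n u < G u - r" by (intro Q_lim) simp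
      then show "\<forall>\<^sub>F n in sequentially. z < ennreal (G u - Q n u)"
        by eventually_elim (use r in \<open>simp add: ennreal_less_iff\<close>)
    qed
    then show ?case using Q_le v_le by blast
  qed
  have "ennreal ((\<integral>u. G u \<partial>I01) - (\<integral>u. v u \<partial>I01)) = (\<integral>\<^sup>+u. ennreal (G u - v u) \<partial>I01)"
    using G v pointwise
    by (subst nn_integral_eq_integral) (auto elim!: eventually_mono simp: abs_le_iff)
  also have "\<dots> \<le> (\<integral>\<^sup>+u. liminf (\<lambda>n. ennreal (G u - Q n u)) \<partial>I01)"
    using pointwise by (intro nn_integral_mono_AE) (auto elim!: eventually_mono)
  also have "\<dots> \<le> liminf (\<lambda>n. \<integral>\<^sup>+u. ennreal (G u - Q n u) \<partial>I01)"
  proof (rule nn_integral_liminf)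
    fix n
    have "(\<lambda>u. G u - Q n u) \<in> borel_measurable I01"
      using G Q[of n] by (intro borel_measurable_diff borel_measurable_integrable)
    then show "(\<lambda>u. ennreal (G u - Q n u)) \<in> borel_measurable I01" by simp
  qed
  also have "\<dots> \<le> ennreal ((\<integral>u. G u \<partial>I01) - c)"
  proof (rule Liminf_le)
    show "\<forall>\<^sub>F n in sequentially. (\<integral>\<^sup>+u. ennreal (G u - Q n u) \<partial>I01) \<le> ennreal ((\<integral>u. G u \<partial>I01) - c)"
    proof (rule always_eventually, rule allI)
      fix n
      have "(\<integral>\<^sup>+u. ennreal (G u - Q n u) \<partial>I01) = ennreal ((\<integral>u. G u \<partial>I01) - (\<integral>u. Q n u \<partial>I01))"
        using G Q[of n] pointwise
        by (subst nn_integral_eq_integral) (auto elim!: eventually_mono simp: abs_le_iff)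
      also have "\<dots> \<le> ennreal ((\<integral>u. G u \<partial>I01) - c)"
        using Q_big[of n] by (intro ennreal_leI) simp
      finally show "(\<integral>\<^sup>+u. ennreal (G u - Q n u) \<partial>I01) \<le> ennreal ((\<integral>u. G u \<partial>I01) - c)" .
    qed
  qed simp
  finally have le: "ennreal ((\<integral>u. G u \<partial>I01) - (\<integral>u. v u \<partial>I01)) \<le> ennreal ((\<integral>u. G u \<partial>I01) - c)" .
  have "(\<integral>u. Q 0 u \<partial>I01) \<le> (\<integral>u. G u \<partial>I01)"
    using G Q pointwise by (intro integral_mono_AE) (auto elim!: eventually_mono simp: abs_le_iff)
  then have "(\<integral>u. G u \<partial>I01) - (\<integral>u. v u \<partial>I01) \<le> (\<integral>u. G u \<partial>I01) - c"
    using le Q_big[of 0] by (simp add: ennreal_le_iff)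
  then show False using c by (simp add: v_def D_def)
qed

lemma clarke_gradient_Psi_AE_le:
  assumes \<zeta>: "\<zeta> \<in> clarke_gradient (Psi \<phi> U) q" and e: "\<bar>e\<bar> = 1"
  shows "AE u in I01. e * rep_L2 \<zeta> u \<le> w u * clarke_deriv U (rep_L2 q u) e"
proof (rule AE_le_of_set_integrals_le)
  show "integrable I01 (\<lambda>u. e * rep_L2 \<zeta> u)" by (intro integrable_mult_right integrable_rep_L2)
  show "integrable I01 (\<lambda>u. w u * clarke_deriv U (rep_L2 q u) e)" by (rule integrable_w_clarke_deriv[OF e])
  fix A :: "real set" assume A: "A \<in> sets borel"
  have "(\<integral>u. indicator A u * (e * rep_L2 \<zeta> u) \<partial>I01) = e * (\<integral>u. indicator A u * rep_L2 \<zeta> u \<partial>I01)"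
    by (simp add: mult.left_commute)
  also have "\<dots> = inner \<zeta> (e *\<^sub>R L2_indicator A)"
    by (simp add: inner_L2_indicator[OF A])
  also have "\<dots> \<le> (\<integral>u. indicator A u * (w u * clarke_deriv U (rep_L2 q u) e) \<partial>I01)"
  proof (rule dense_ge)
    fix c assume "(\<integral>u. indicator A u * (w u * clarke_deriv U (rep_L2 q u) e) \<partial>I01) < c"
    from clarke_dd_Psi_indicator_le[OF e A this]
    have "ereal (inner \<zeta> (e *\<^sub>R L2_indicator A)) \<le> ereal c"
      using \<zeta> order_trans unfolding mem_clarke_gradient_iff by blast
    then show "inner \<zeta> (e *\<^sub>R L2_indicator A) \<le> c" by simp
  qed
  finally show "(\<integral>u. indicator A u * (e * rep_L2 \<zeta> u) \<partial>I01)
      \<le> (\<integral>u. indicator A u * (w u * clarke_deriv U (rep_L2 q u) e) \<partial>I01)" .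
qed

text \<open>
The inclusion of Aubin and Clarke. The directions \<open>1\<close> and \<open>- 1\<close> trap \<open>\<zeta>\<close> between \<open>\<phi>'\<close> times the two
ends of the Clarke gradient of \<open>U\<close>; division by \<open>\<phi>'\<close> gives the selector, and where \<open>\<phi>'\<close>
vanishes so does \<open>\<zeta>\<close>, and any measurable choice will do.
\<close>

theorem clarke_gradient_Psi_selector:
  assumes \<zeta>: "\<zeta> \<in> clarke_gradient (Psi \<phi> U) q"
  obtains \<xi> where "\<xi> \<in> borel_measurable I01"
    "AE u in I01. \<xi> u \<in> clarke_gradient U (rep_L2 q u)"
    "AE u in I01. rep_L2 \<zeta> u = w u * \<xi> u"
proof -
  define \<xi> where "\<xi> u = (if w u = 0 then clarke_deriv U (rep_L2 q u) 1 else rep_L2 \<zeta> u / w u)" for u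
  have "\<xi> \<in> borel_measurable I01" unfolding \<xi>_def by measurable
  moreover have "AE u in I01. \<xi> u \<in> clarke_gradient U (rep_L2 q u) \<and> rep_L2 \<zeta> u = w u * \<xi> u"
    using clarke_gradient_Psi_AE_le[OF \<zeta>, of 1, simplified]
      clarke_gradient_Psi_AE_le[OF \<zeta>, of "- 1", simplified] w_nonneg
  proof eventually_elim
    case (elim u)
    show ?case
    proof (cases "w u = 0")
      case True
      then show ?thesis
        using elim clarke_deriv_real_nonempty[OF U_lip, of "rep_L2 q u"]
        by (simp add: \<xi>_def clarke_gradient_real[OF U_lip])
    next
      case False
      then have w: "0 < w u" using elim by simp
      then have "rep_L2 \<zeta> u / w u \<le> clarke_deriv U (rep_L2 q u) 1"
        using elim by (simp add: pos_divide_le_eq mult.commute)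
      moreover have "(- rep_L2 \<zeta> u) / w u \<le> clarke_deriv U (rep_L2 q u) (- 1)"
        using elim w by (subst pos_divide_le_eq) (simp_all add: mult.commute)
      ultimately show ?thesis
        using w by (auto simp: \<xi>_def clarke_gradient_real[OF U_lip])
    qed
  qed
  ultimately show ?thesis by (intro that[of \<xi>]) (auto elim!: eventually_mono)
qed

end

section \<open>Stationarity\<close>

lemma L2_const_scale: "c *\<^sub>R L2_const 1 = L2_const c"
  by transfer (simp add: L2_rel_def square_integrable_const)

lemma rep_zero_L2: "AE u in I01. rep_L2 0 u = 0"
  using rep_scaleR_L2[of 0 0] by simp

theorem theorem1:
  fixes \<mu> \<sigma> a b :: real and \<phi> U :: "real \<Rightarrow> real" and q :: L2
  assumes "\<sigma> \<ge> 0" and "\<phi> \<in> distortion_functions" and "mono U"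
    and A1: "absolutely_continuous_01 \<phi>" "deriv \<phi> \<in> L_infinity"
    and A2: "locally_lipschitz U"
    and A3: "a \<ge> 0" "b \<ge> 0"
      "\<forall>x. (SUP \<zeta>\<in>clarke_gradient U x. ereal \<bar>\<zeta>\<bar>) \<le> ereal (a + b * \<bar>x\<bar>)"
    and "q \<in> moment_set \<mu> \<sigma> \<inter> monotone_cone"
    and "LICQ q"
    and "local_minimizer_on (Psi \<phi> U) (moment_set \<mu> \<sigma> \<inter> monotone_cone) q"
  shows
    "(\<exists>l1 l2.
        (\<exists>z\<in>normal_cone monotone_cone q. \<exists>\<zeta>\<in>clarke_gradient (Psi \<phi> U) q.
           0 = \<zeta> + L2_const l1 + (2 * l2) *\<^sub>R q + z) \<and>
        selector_stationarity \<phi> U q l1 l2) \<and>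
     normal_cone monotone_cone q =
       {z. (\<forall>t\<in>{0..1}. primitive z t \<ge> 0) \<and> primitive z 1 = 0 \<and>
           (\<integral>\<^sup>+t. ennreal (primitive z t) \<partial>stieltjes (mono_rep q)) = 0} \<and>
     (\<forall>l1 l2 c d. selector_stationarity \<phi> U q l1 l2 \<and> 0 \<le> c \<and> c < d \<and> d \<le> 1 \<and>
        strictly_increasing_on {c<..<d} q \<longrightarrow>
        (AE u in I01. u \<in> {c<..<d} \<longrightarrow>
           - l1 - 2 * l2 * rep_L2 q u \<in> (\<lambda>\<zeta>. deriv \<phi> u * \<zeta>) ` clarke_gradient U (rep_L2 q u)))"
proof (intro conjI)
  have q: "q \<in> moment_set \<mu> \<sigma>" "q \<in> monotone_cone"
    using \<open>q \<in> moment_set \<mu> \<sigma> \<inter> monotone_cone\<close> by auto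
  have "0 < \<sigma>"
    using LICQ_iff[OF q(1)] \<open>LICQ q\<close> \<open>\<sigma> \<ge> 0\<close> by (cases "\<sigma> = 0") auto
  have growth: "clarke_deriv U x 1 \<le> a + b * \<bar>x\<bar>" for x
  proof -
    have "clarke_deriv U x 1 \<in> clarke_gradient U x"
      using clarke_deriv_real_nonempty[OF A2, of x] by (simp add: clarke_gradient_real[OF A2])
    then have "ereal \<bar>clarke_deriv U x 1\<bar> \<le> (SUP \<zeta>\<in>clarke_gradient U x. ereal \<bar>\<zeta>\<bar>)"
      by (rule SUP_upper)
    also have "\<dots> \<le> ereal (a + b * \<bar>x\<bar>)" using A3(3) by blast
    finally show ?thesis by simp
  qed
  interpret distortion_functional \<phi> U a b
    by unfold_locales (use assms growth in auto)
  show "\<exists>l1 l2.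
        (\<exists>z\<in>normal_cone monotone_cone q. \<exists>\<zeta>\<in>clarke_gradient (Psi \<phi> U) q.
           0 = \<zeta> + L2_const l1 + (2 * l2) *\<^sub>R q + z) \<and>
        selector_stationarity \<phi> U q l1 l2"
  proof -
    have "\<exists>l1 l2. \<exists>z\<in>normal_cone monotone_cone q. \<exists>\<zeta>\<in>clarke_gradient (Psi \<phi> U) q.
        0 = \<zeta> + l1 *\<^sub>R L2_const 1 + (2 * l2) *\<^sub>R q + z"
    proof (rule multiplier_rule_on_convex_cone[OF _ _ _ _ _ _ _ _ _ Psi_lipschitz])
      show "L2_const 1 \<in> monotone_cone" by (rule monotone_cone_const)
      show "- L2_const 1 \<in> monotone_cone"
        using monotone_cone_const[of "- 1"] by (simp flip: L2_const_scale[of "- 1"])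
      show "local_minimizer_on (Psi \<phi> U)
          ({x. inner (L2_const 1) x = \<mu> \<and> inner x x = \<mu>\<^sup>2 + \<sigma>\<^sup>2} \<inter> monotone_cone) q"
        using assms(12) unfolding moment_set_def .
    qed (use q \<open>0 < \<sigma>\<close> in \<open>auto simp: moment_set_def inner_L2_const_1
        intro: monotone_cone_add monotone_cone_scale\<close>)
    then obtain l1 l2 z \<zeta> where z: "z \<in> normal_cone monotone_cone q"
      and \<zeta>: "\<zeta> \<in> clarke_gradient (Psi \<phi> U) q"
      and eq: "0 = \<zeta> + L2_const l1 + (2 * l2) *\<^sub>R q + z"
      unfolding L2_const_scale by blast
    obtain \<xi> where \<xi>: "\<xi> \<in> borel_measurable I01"
      "AE u in I01. \<xi> u \<in> clarke_gradient U (rep_L2 q u)" "AE u in I01. rep_L2 \<zeta> u = deriv \<phi> u * \<xi> u"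
      using clarke_gradient_Psi_selector[OF \<zeta>] by blast
    have "AE u in I01. 0 = deriv \<phi> u * \<xi> u + l1 + 2 * l2 * rep_L2 q u + rep_L2 z u"
      using rep_zero_L2 \<xi>(3) rep_add_L2[of "\<zeta> + L2_const l1 + (2 * l2) *\<^sub>R q" z]
        rep_add_L2[of "\<zeta> + L2_const l1" "(2 * l2) *\<^sub>R q"] rep_add_L2[of \<zeta> "L2_const l1"]
        rep_const_L2[of l1] rep_scaleR_L2[of "2 * l2" q]
      unfolding eq[symmetric] by eventually_elim simp
    then have "selector_stationarity \<phi> U q l1 l2"
      unfolding selector_stationarity_def using \<xi>(1,2) z by blast
    with z \<zeta> eq show ?thesis by blast
  qed
  show "normal_cone monotone_cone q =
       {z. (\<forall>t\<in>{0..1}. primitive z t \<ge> 0) \<and> primitive z 1 = 0 \<and>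
           (\<integral>\<^sup>+t. ennreal (primitive z t) \<partial>stieltjes (mono_rep q)) = 0}"
    by (rule normal_cone_monotone_cone[OF q(2)])
  show "\<forall>l1 l2 c d. selector_stationarity \<phi> U q l1 l2 \<and> 0 \<le> c \<and> c < d \<and> d \<le> 1 \<and>
        strictly_increasing_on {c<..<d} q \<longrightarrow>
        (AE u in I01. u \<in> {c<..<d} \<longrightarrow>
           - l1 - 2 * l2 * rep_L2 q u \<in> (\<lambda>\<zeta>. deriv \<phi> u * \<zeta>) ` clarke_gradient U (rep_L2 q u))"
  proof (intro allI impI, elim conjE)
    fix l1 l2 c d
    assume "selector_stationarity \<phi> U q l1 l2"
      and cd: "0 \<le> c" "d \<le> 1" and strict: "strictly_increasing_on {c<..<d} q"
    then obtain \<xi> z where \<xi>: "AE u in I01. \<xi> u \<in> clarke_gradient U (rep_L2 q u)"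
      and z: "z \<in> normal_cone monotone_cone q"
      and eq: "AE u in I01. 0 = deriv \<phi> u * \<xi> u + l1 + 2 * l2 * rep_L2 q u + rep_L2 z u"
      unfolding selector_stationarity_def by blast
    from normal_cone_vanishes_where_strictly_increasing[OF q(2) z cd strict] \<xi> eq
    show "AE u in I01. u \<in> {c<..<d} \<longrightarrow>
        - l1 - 2 * l2 * rep_L2 q u \<in> (\<lambda>\<zeta>. deriv \<phi> u * \<zeta>) ` clarke_gradient U (rep_L2 q u)"
    proof eventually_elim
      case (elim u)
      show ?case
      proof
        assume "u \<in> {c<..<d}"
        then have "- l1 - 2 * l2 * rep_L2 q u = deriv \<phi> u * \<xi> u" using elim by simp
        then show "- l1 - 2 * l2 * rep_L2 q u \<in> (\<lambda>\<zeta>. deriv \<phi> u * \<zeta>) ` clarke_gradient U (rep_L2 q u)"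
          using elim by blast
      qed
    qed
  qed
qed

end
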